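(* Let $X$ be a locally convex space, let $\gamma$ be a centered Radon Gaussian measure on $X$, and let $H$ be its Cameron--Martin space with norm $|\cdot|_H$. Let $v\colon X\to H$ be a Borel vector field and let $b(x)=-x+v(x)$. Let $\mu$ be a Borel probability measure on $X$ such that $|v|_H\in L^1(\mu)$ and $L_b^*\mu=0$. Then $\mu$ is absolutely continuous with respect to $\gamma$ and for $f:=d\mu/d\gamma$ we have $$\int_X f\,\bigl(\log(f+1)\bigr)^{\alpha}\,d\gamma\le C(\alpha)\Bigl[1+\bigl\||v|_H\bigr\|_{L^1(\mu)}\Bigl(\log\bigl(1+\bigl\||v|_H\bigr\|_{L^1(\mu)}\bigr)\Bigr)^{\alpha}\Bigr],$$ where $\alpha<1/4$ and $C(\alpha)$ are the same numbers as in the finite-dimensional estimate (FD) described in the context (for every $\alpha<1/4$ a number $C(\alpha)$ with property (FD) exists).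
   Context: Gaussian measures. $X^*$ is the topological dual of $X$. A centered Radon Gaussian measure $\gamma$ on $X$ is a Borel probability measure such that for every Borel set $B$ and every $\varepsilon>0$ there is a compact set $S\subset B$ with $\gamma(B\setminus S)<\varepsilon$, and every $l\in X^*$ is a centered Gaussian random variable on $(X,\gamma)$ (possibly zero almost everywhere). The Cameron--Martin space $H$ consists of all vectors $h\in X$ with finite norm $|h|_H=\sup\{l(h)\colon l\in X^*,\ \|l\|_{L^2(\gamma)}\le 1\}$; it is a separable Hilbert space with inner product $(\cdot,\cdot)_H$. The equation. Let $\{e_i\}$ be an orthonormal basis in $H$ for which there is a sequence $\{\widehat e_j\}\subset X^*$ with $\widehat e_i(e_j)=\delta_{ij}$. Test functions are the cylindrical functions $\varphi(l_1,\ldots,l_n)$ with $\varphi\in C_0^\infty(\mathbb{R}^n)$ and $l_i\in X^*$ (alternatively, one may fix a sequence $\{l_i\}\subset X^*$, say, one separating points if it exists, and take only $l_i$ from this sequence). On test functions $$L\varphi=\sum_{i=1}^\infty\bigl[\partial_{e_i}^2\varphi-\widehat e_i\,\partial_{e_i}\varphi\bigr],\qquad L_b\varphi=L\varphi+\sum_{i=1}^\infty (v,e_i)_H\,\partial_{e_i}\varphi .$$ For a cylindrical function, $L\varphi=\sum_{j,k\le n}(\widetilde l_j,\widetilde l_k)_H\,\partial_{x_j}\partial_{x_k}\varphi(l_1,\ldots,l_n)-\sum_{j=1}^n l_j\,\partial_{x_j}\varphi(l_1,\ldots,l_n)$, where $\widetilde l\in H$ is the vector with $l(u)=(\widetilde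 l,u)_H$ for all $u\in H$. The measure $\mu$, for which the functions $(v,e_i)_H$ are $\mu$-integrable, satisfies $L_b^*\mu=0$ if $\int_X L_b\varphi\,d\mu=0$ for all test functions $\varphi$. In the main example, $X=\mathbb{R}^\infty$ is the space of all real sequences, $\gamma$ is the countable power of the standard Gaussian measure on the real line, $H=l^2$, the test functions are $\varphi_0(x_1,\ldots,x_n)$ with $\varphi_0\in C_0^\infty(\mathbb{R}^n)$, $L\varphi=\sum_i[\partial_{x_i}^2\varphi-x_i\partial_{x_i}\varphi]$ and $L_b\varphi=L\varphi+\sum_i v_i\,\partial_{x_i}\varphi$. Property (FD) of $C(\alpha)$: for every $d\ge1$, with $\gamma_d$ the standard Gaussian measure on $\mathbb{R}^d$, whenever $\mu'=g\cdot\gamma_d$ is a probability measure on $\mathbb{R}^d$ and $u\colon\mathbb{R}^d\to\mathbb{R}^d$ is a Borel vector field with $|u|\in L^1(\mu')$ such that $\int_{\mathbb{R}^d}[\Delta\varphi(x)+\langle -x+u(x),\nabla\varphi(x)\rangle]\,\mu'(dx)=0$ for all $\varphi\in C_0^\infty(\mathbb{R}^d)$, one has $$\int_{\mathbb{R}^d} g\,(\log(g+1))^\alpha\,d\gamma_d\le C(\alpha)\bigl[1+\|u\|_{L^1(\mu')}(\log(1+\|u\|_{L^1(\mu')}))^\alpha\bigr],\qquad \|u\|_{L^1(\mu')}=\int|u|\,d\mu'.$$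
   Formalization: The Borel probability measure μ is assumed to be Radon (automatic on ℝ^∞ and on separable Fréchet spaces); for arbitrary Borel measures the claim fails, and absolute continuity with respect to the Radon measure γ forces μ to be Radon. *)

theory Defs
  imports "HOL-Probability.Probability"
begin

section \<open>Locally convex spaces and centered Radon Gaussian measures\<close>

text \<open>Real Hausdorff locally convex spaces. Convexity is spelled out because \<open>convex\<close> is not
  available inside the class declaration.\<close>

class locally_convex_space = real_vector + topological_ab_group_add + t2_space +
  assumes tendsto_scaleR_Pair:
    "LIM p (nhds a \<times>\<^sub>F nhds x). fst p *\<^sub>R snd p :> nhds (a *\<^sub>R x)"
  and convex_nhds_base:
    "open U \<Longrightarrow> 0 \<in> U \<Longrightarrow> \<exists>V. open V \<and> 0 \<in> V \<and> V \<subseteq> U \<and>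
       (\<forall>x\<in>V. \<forall>y\<in>V. \<forall>t. 0 \<le> t \<and> t \<le> 1 \<longrightarrow> (1 - t) *\<^sub>R x + t *\<^sub>R y \<in> V)"

definition top_dual :: "('a::locally_convex_space \<Rightarrow> real) set" where
  "top_dual = {l. linear l \<and> continuous_on UNIV l}"

definition radon_prob :: "'a::topological_space measure \<Rightarrow> bool" where
  "radon_prob M \<longleftrightarrow> prob_space M \<and> sets M = sets borel \<and>
     (\<forall>B\<in>sets borel. \<forall>\<epsilon>>0. \<exists>S. compact S \<and> S \<subseteq> B \<and> measure M (B - S) < \<epsilon>)"

text \<open>A centered Gaussian law on the line may be degenerate (the Dirac measure at 0).\<close>

definition centered_gaussian_law :: "real measure \<Rightarrow> bool" where
  "centered_gaussian_law N \<longleftrightarrow>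
     N = return borel 0 \<or>
     (\<exists>\<sigma>>0. N = density lborel (\<lambda>t. ennreal (normal_density 0 \<sigma> t)))"

definition centered_radon_gaussian :: "'a::locally_convex_space measure \<Rightarrow> bool" where
  "centered_radon_gaussian \<gamma> \<longleftrightarrow>
     radon_prob \<gamma> \<and> (\<forall>l\<in>top_dual. centered_gaussian_law (distr \<gamma> borel l))"


section \<open>The Cameron--Martin space\<close>

definition dual_unit_ball :: "'a::locally_convex_space measure \<Rightarrow> ('a \<Rightarrow> real) set" where
  "dual_unit_ball \<gamma> = {l \<in> top_dual. sqrt (\<integral>x. (l x)\<^sup>2 \<partial>\<gamma>) \<le> 1}"

definition cm_space :: "'a::locally_convex_space measure \<Rightarrow> 'a set" where
  "cm_space \<gamma> = {h. bdd_above ((\<lambda>l. l h) ` dual_unit_ball \<gamma>)}"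

definition cm_norm :: "'a::locally_convex_space measure \<Rightarrow> 'a \<Rightarrow> real" where
  "cm_norm \<gamma> h = (SUP l\<in>dual_unit_ball \<gamma>. l h)"

text \<open>The inner product of the Hilbert norm, recovered by polarization.\<close>

definition cm_inner :: "'a::locally_convex_space measure \<Rightarrow> 'a \<Rightarrow> 'a \<Rightarrow> real" where
  "cm_inner \<gamma> h k = ((cm_norm \<gamma> (h + k))\<^sup>2 - (cm_norm \<gamma> (h - k))\<^sup>2) / 4"

definition cm_open :: "'a::locally_convex_space measure \<Rightarrow> 'a set \<Rightarrow> bool" where
  "cm_open \<gamma> U \<longleftrightarrow> U \<subseteq> cm_space \<gamma> \<and>
     (\<forall>h\<in>U. \<exists>\<epsilon>>0. \<forall>k\<in>cm_space \<gamma>. cm_norm \<gamma> (k - h) < \<epsilon> \<longrightarrow> k \<in> U)"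

text \<open>The measurable space $H$ with the Borel $\sigma$-algebra of its norm topology.\<close>

definition cm_borel :: "'a::locally_convex_space measure \<Rightarrow> 'a measure" where
  "cm_borel \<gamma> = sigma (cm_space \<gamma>) {U. cm_open \<gamma> U}"

text \<open>For $l \in X^*$ the vector $\widetilde l \in H$ with $l(u) = (\widetilde l, u)_H$ on $H$.\<close>

definition cm_riesz :: "'a::locally_convex_space measure \<Rightarrow> ('a \<Rightarrow> real) \<Rightarrow> 'a" where
  "cm_riesz \<gamma> l = (THE w. w \<in> cm_space \<gamma> \<and> (\<forall>u\<in>cm_space \<gamma>. l u = cm_inner \<gamma> w u))"

text \<open>The index set \<open>I\<close> accommodates finite-dimensional $H$; bases are sequences because
  $H$ is separable.\<close>

definition cm_orthonormal_basis ::
    "'a::locally_convex_space measure \<Rightarrow> nat set \<Rightarrow> (nat \<Rightarrow> 'a) \<Rightarrow> bool" where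
  "cm_orthonormal_basis \<gamma> I e \<longleftrightarrow>
     e ` I \<subseteq> cm_space \<gamma> \<and>
     (\<forall>i\<in>I. \<forall>j\<in>I. cm_inner \<gamma> (e i) (e j) = (if i = j then 1 else 0)) \<and>
     (\<forall>h\<in>cm_space \<gamma>. \<forall>\<epsilon>>0. \<exists>w\<in>span (e ` I). cm_norm \<gamma> (h - w) < \<epsilon>)"


section \<open>Smooth compactly supported functions on $\mathbb{R}^d$\<close>

text \<open>$\mathbb{R}^d$ is represented by the extensional functions on \<open>{..<d}\<close>, the carrier of
  \<open>PiM {..<d}\<close>; its topology is induced by the product topology of \<open>nat \<Rightarrow> real\<close>.\<close>

abbreviation Rn :: "nat \<Rightarrow> (nat \<Rightarrow> real) set" where
  "Rn d \<equiv> {..<d} \<rightarrow>\<^sub>E UNIV"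

definition pderiv_at :: "nat \<Rightarrow> ((nat \<Rightarrow> real) \<Rightarrow> real) \<Rightarrow> (nat \<Rightarrow> real) \<Rightarrow> real" where
  "pderiv_at i \<phi> x = deriv (\<lambda>t. \<phi> (x(i := t))) (x i)"

text \<open>All iterated partial derivatives exist and are continuous; the list \<open>is\<close> contains the
  indices of the derivatives already taken.\<close>

definition smooth_Rn :: "nat \<Rightarrow> ((nat \<Rightarrow> real) \<Rightarrow> real) \<Rightarrow> bool" where
  "smooth_Rn d \<phi> \<longleftrightarrow>
     (\<forall>is. set is \<subseteq> {..<d} \<longrightarrow>
        continuous_on (Rn d) (foldr pderiv_at is \<phi>) \<and>
        (\<forall>i<d. \<forall>x\<in>Rn d.
           (\<lambda>t. foldr pderiv_at is \<phi> (x(i := t))) differentiable at (x i)))"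

definition test_fun_Rn :: "nat \<Rightarrow> ((nat \<Rightarrow> real) \<Rightarrow> real) \<Rightarrow> bool" where
  "test_fun_Rn d \<phi> \<longleftrightarrow> smooth_Rn d \<phi> \<and>
     (\<exists>K. compact K \<and> K \<subseteq> Rn d \<and> (\<forall>x\<in>Rn d - K. \<phi> x = 0))"


section \<open>The finite-dimensional estimate\<close>

definition std_gauss :: "nat \<Rightarrow> (nat \<Rightarrow> real) measure" where
  "std_gauss d = PiM {..<d} (\<lambda>_. density lborel (\<lambda>t. ennreal (std_normal_density t)))"

text \<open>\<open>L2_set (u x) {..<d}\<close> is the Euclidean norm of \<open>u x\<close>. The base of \<open>powr\<close> vanishes only
  where the prefactor vanishes as well, so \<open>0 powr \<alpha> = 0\<close> is harmless. The integral on the left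
  is that of a nonnegative function, and its finiteness is part of the inequality.\<close>

definition FD_estimate :: "real \<Rightarrow> real \<Rightarrow> bool" where
  "FD_estimate \<alpha> C \<longleftrightarrow>
     (\<forall>d\<ge>1. \<forall>(g :: (nat \<Rightarrow> real) \<Rightarrow> real) (u :: (nat \<Rightarrow> real) \<Rightarrow> nat \<Rightarrow> real) \<mu>'.
        g \<in> borel_measurable (std_gauss d) \<longrightarrow>
        (\<forall>x\<in>Rn d. 0 \<le> g x) \<longrightarrow>
        \<mu>' = density (std_gauss d) (\<lambda>x. ennreal (g x)) \<longrightarrow>
        prob_space \<mu>' \<longrightarrow>
        (\<forall>i<d. (\<lambda>x. u x i) \<in> borel_measurable (PiM {..<d} (\<lambda>_. borel))) \<longrightarrow>
        integrable \<mu>' (\<lambda>x. L2_set (u x) {..<d}) \<longrightarrow>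
        (\<forall>\<phi>. test_fun_Rn d \<phi> \<longrightarrow>
           (\<integral>x. (\<Sum>i<d. pderiv_at i (pderiv_at i \<phi>) x)
                 + (\<Sum>i<d. (- x i + u x i) * pderiv_at i \<phi> x) \<partial>\<mu>') = 0) \<longrightarrow>
        (let N = (\<integral>x. L2_set (u x) {..<d} \<partial>\<mu>') in
           (\<integral>\<^sup>+x. ennreal (g x * ln (g x + 1) powr \<alpha>) \<partial>(std_gauss d))
             \<le> ennreal (C * (1 + N * ln (1 + N) powr \<alpha>))))"


section \<open>The equation $L_b^* \mu = 0$ on $X$\<close>

definition tuple_map :: "nat \<Rightarrow> (nat \<Rightarrow> 'a \<Rightarrow> real) \<Rightarrow> 'a \<Rightarrow> (nat \<Rightarrow> real)" where
  "tuple_map n l x = (\<lambda>j\<in>{..<n}. l j x)"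

definition dir_deriv :: "'a::real_vector \<Rightarrow> ('a \<Rightarrow> real) \<Rightarrow> 'a \<Rightarrow> real" where
  "dir_deriv h F x = deriv (\<lambda>t. F (x + t *\<^sub>R h)) 0"

text \<open>$L$ on the cylindrical function $\varphi(l_1,\dots,l_n)$. The pointwise formula is used
  because the series $\sum_i \widehat e_i\,\partial_{e_i}\varphi$ need not converge to it outside
  a $\gamma$-null set, and such sets are not known in advance to be $\mu$-null.\<close>

definition OU_cyl ::
    "'a::locally_convex_space measure \<Rightarrow> nat \<Rightarrow> (nat \<Rightarrow> 'a \<Rightarrow> real) \<Rightarrow>
     ((nat \<Rightarrow> real) \<Rightarrow> real) \<Rightarrow> 'a \<Rightarrow> real" where
  "OU_cyl \<gamma> n l \<phi> x =
     (\<Sum>j<n. \<Sum>k<n. cm_inner \<gamma> (cm_riesz \<gamma> (l j)) (cm_riesz \<gamma> (l k))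
                    * pderiv_at j (pderiv_at k \<phi>) (tuple_map n l x))
     - (\<Sum>j<n. l j x * pderiv_at j \<phi> (tuple_map n l x))"

definition Lb_cyl ::
    "'a::locally_convex_space measure \<Rightarrow> nat set \<Rightarrow> (nat \<Rightarrow> 'a) \<Rightarrow> ('a \<Rightarrow> 'a) \<Rightarrow>
     nat \<Rightarrow> (nat \<Rightarrow> 'a \<Rightarrow> real) \<Rightarrow> ((nat \<Rightarrow> real) \<Rightarrow> real) \<Rightarrow> 'a \<Rightarrow> real" where
  "Lb_cyl \<gamma> I e v n l \<phi> x =
     OU_cyl \<gamma> n l \<phi> x
     + (\<Sum>\<^sub>\<infinity>i\<in>I. cm_inner \<gamma> (v x) (e i) * dir_deriv (e i) (\<lambda>y. \<phi> (tuple_map n l y)) x)"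

definition Lb_stationary ::
    "'a::locally_convex_space measure \<Rightarrow> nat set \<Rightarrow> (nat \<Rightarrow> 'a) \<Rightarrow> ('a \<Rightarrow> 'a) \<Rightarrow>
     'a measure \<Rightarrow> bool" where
  "Lb_stationary \<gamma> I e v \<mu> \<longleftrightarrow>
     (\<forall>i\<in>I. integrable \<mu> (\<lambda>x. cm_inner \<gamma> (v x) (e i))) \<and>
     (\<forall>n l \<phi>. (\<forall>j<n. l j \<in> top_dual) \<longrightarrow> test_fun_Rn n \<phi> \<longrightarrow>
        (\<integral>x. Lb_cyl \<gamma> I e v n l \<phi> x \<partial>\<mu>) = 0)"

end

theory Submission
  imports Defs
begin

text \<open>Translating a test function by \<open>c\<close> replaces the drift \<open>u\<close> by \<open>u + c\<close>. Hence, if \<open>P\<close> is a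
  finite-dimensional orthonormal projection and \<open>z\<close> an independent Gaussian vector, the law of
  \<open>P + \<epsilon> z\<close> under \<open>\<mu>\<close> satisfies the finite-dimensional equation with a drift of almost the same
  \<open>L\<^sup>1\<close> norm, and it has a density, so the finite-dimensional estimate applies to it. The resulting entropy
  bound does not depend on \<open>P\<close> and \<open>\<epsilon>\<close>; letting \<open>\<epsilon> \<rightarrow> 0\<close> it makes \<open>\<mu>\<close> uniformly small on open
  cylindrical sets of small \<open>\<gamma>\<close> measure. Disjoint compact sets are separated by such sets, so the
  Radon property yields \<open>\<mu> \<ll> \<gamma>\<close>. Now the projections of \<open>\<mu>\<close> have densities, namely the conditional
  expectations of \<open>f\<close>, the estimate holds for them without smoothing, and Fatou's lemma transfers it
  to \<open>f\<close>. The identification of the operator on cylindrical functions rests on the fact that the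
  Cameron--Martin vector of a functional in \<open>X\<^sup>*\<close> lies in \<open>X\<close>, which uses the Radon property of \<open>\<gamma>\<close>.\<close>

section \<open>Separation of points by continuous functionals\<close>

text \<open>\<open>FD_estimate\<close> presupposes a density, the very thing to be proved. Noise
  supplies one but enlarges the drift, so the smoothed bound carries \<open>drift_norm + 1\<close>;
  the sharp constant needs a second pass, once absolute continuity is known. The first pass must
  yield uniform integrability, which an exponent \<le> 0 cannot give; for
  \<open>\<alpha> \<le> 0\<close> it runs with another exponent \<open>\<beta> > 0\<close>, whose
  constant does not matter. A set depending on finitely many functionals is a function of
  orthonormal coordinates only up to functionals that vanish \<open>\<gamma>\<close>-almost
  everywhere, and these must be shown to vanish \<open>\<mu>\<close>-almost everywhere before
  absolute continuity is available: a separate one-dimensional argument. Since \<open>X\<close> need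
  not be separable or metrizable, cylindrical sets need not generate the Borel sets, and every
  passage between them goes through compact sets. The drift of a projection is a conditional
  expectation with a possibly smaller norm, so the bound has to be monotone in the norm; this holds
  for exponents \<ge> -1, a restriction extracted from \<open>FD_estimate\<close> itself.\<close>

definition sublin :: "('a::real_vector \<Rightarrow> real) \<Rightarrow> bool" where
  "sublin p \<longleftrightarrow> (\<forall>x y. p (x + y) \<le> p x + p y) \<and> (\<forall>c\<ge>0. \<forall>x. p (c *\<^sub>R x) = c * p x)"

lemma sublin_add: "sublin p \<Longrightarrow> p (x + y) \<le> p x + p y"
  and sublin_scale: "sublin p \<Longrightarrow> 0 \<le> c \<Longrightarrow> p (c *\<^sub>R x) = c * p x"
  by (auto simp: sublin_def)

lemma sublin_zero: "sublin p \<Longrightarrow> p 0 = 0"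
  using sublin_scale[of p 0 0] by simp

lemma sublin_minus: "sublin p \<Longrightarrow> - p (- x) \<le> p x"
  using sublin_add[of p x "- x"] sublin_zero[of p] by simp

text \<open>Forces linearity along \<open>y\<close>: for sublinear \<open>p\<close> the parameter
  \<open>t = 1\<close> gives \<open>sublin_contract p y (- y) \<le> - p y\<close>, so any linear
  functional below the contraction takes the value \<open>p y\<close> at \<open>y\<close>.\<close>

definition sublin_contract :: "('a::real_vector \<Rightarrow> real) \<Rightarrow> 'a \<Rightarrow> 'a \<Rightarrow> real" where
  "sublin_contract p y x = (INF t\<in>{0..}. p (x + t *\<^sub>R y) - t * p y)"

lemma sublin_contract_bdd:
  assumes "sublin p" shows "bdd_below ((\<lambda>t. p (x + t *\<^sub>R y) - t * p y) ` {0..})"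
proof (rule bdd_belowI2[where m = "- p (- x)"])
  fix t :: real assume t: "t \<in> {0..}"
  have "t * p y = p ((x + t *\<^sub>R y) + (- x))"
    using sublin_scale[OF assms, of t y] t by simp
  also have "\<dots> \<le> p (x + t *\<^sub>R y) + p (- x)" by (rule sublin_add[OF assms])
  finally show "- p (- x) \<le> p (x + t *\<^sub>R y) - t * p y" by simp
qed

lemma sublin_contract_le:
  assumes "sublin p" "0 \<le> t" shows "sublin_contract p y x \<le> p (x + t *\<^sub>R y) - t * p y"
  unfolding sublin_contract_def by (rule cINF_lower[OF sublin_contract_bdd[OF assms(1)]]) (use assms in auto)

text \<open>Competitors with parameters \<open>t\<close> and \<open>s\<close> for two points combine
  to one with parameter \<open>t + s\<close> for their sum, and multiplying a point by
  \<open>c > 0\<close> multiplies its parameter by \<open>c\<close>.\<close>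

lemma sublin_contract:
  assumes p: "sublin p" shows "sublin (sublin_contract p y)"
proof -
  have add: "sublin_contract p y (a + b) \<le> sublin_contract p y a + sublin_contract p y b" for a b
  proof -
    have *: "sublin_contract p y (a + b) - (p (b + s *\<^sub>R y) - s * p y) \<le> p (a + t *\<^sub>R y) - t * p y"
      if "0 \<le> t" "0 \<le> s" for t s
    proof -
      have "sublin_contract p y (a + b) \<le> p ((a + b) + (t + s) *\<^sub>R y) - (t + s) * p y"
        by (rule sublin_contract_le[OF p]) (use that in auto)
      also have "(a + b) + (t + s) *\<^sub>R y = (a + t *\<^sub>R y) + (b + s *\<^sub>R y)" by (simp add: algebra_simps)
      also have "p \<dots> \<le> p (a + t *\<^sub>R y) + p (b + s *\<^sub>R y)" by (rule sublin_add[OF p])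
      finally show ?thesis by (simp add: algebra_simps)
    qed
    have "sublin_contract p y (a + b) - (p (b + s *\<^sub>R y) - s * p y) \<le> sublin_contract p y a" if "0 \<le> s" for s
      unfolding sublin_contract_def[of p y a] by (rule cINF_greatest) (use * that in auto)
    then have "sublin_contract p y (a + b) - sublin_contract p y a \<le> p (b + s *\<^sub>R y) - s * p y" if "0 \<le> s" for s
      using that by (simp add: algebra_simps)
    then have "sublin_contract p y (a + b) - sublin_contract p y a \<le> sublin_contract p y b"
      unfolding sublin_contract_def[of p y b] by (intro cINF_greatest) auto
    then show ?thesis by simp
  qed
  have le: "sublin_contract p y (c *\<^sub>R x) \<le> c * sublin_contract p y x" if c: "c > 0" for c x
  proof -
    have "sublin_contract p y (c *\<^sub>R x) / c \<le> p (x + t *\<^sub>R y) - t * p y" if t: "0 \<le> t" for t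
    proof -
      have "sublin_contract p y (c *\<^sub>R x) \<le> p (c *\<^sub>R x + (c * t) *\<^sub>R y) - (c * t) * p y"
        by (rule sublin_contract_le[OF p]) (use c t in auto)
      also have "c *\<^sub>R x + (c * t) *\<^sub>R y = c *\<^sub>R (x + t *\<^sub>R y)" by (simp add: algebra_simps)
      also have "p \<dots> = c * p (x + t *\<^sub>R y)" using sublin_scale[OF p] c by simp
      finally show ?thesis using c by (simp add: field_simps)
    qed
    then have "sublin_contract p y (c *\<^sub>R x) / c \<le> sublin_contract p y x"
      unfolding sublin_contract_def[of p y x] by (intro cINF_greatest) auto
    then show ?thesis using c by (simp add: field_simps)
  qed
  have zero: "sublin_contract p y 0 = 0"
  proof -
    have "(\<lambda>t. p (0 + t *\<^sub>R y) - t * p y) ` {0..} = {0}"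
      using sublin_scale[OF p] by (auto simp: image_def intro!: exI[of _ 0])
    then show ?thesis unfolding sublin_contract_def by simp
  qed
  have "sublin_contract p y (c *\<^sub>R x) = c * sublin_contract p y x" if c: "c \<ge> 0" for c x
  proof (cases "c = 0")
    case False
    with c have c: "c > 0" by simp
    have "sublin_contract p y ((1/c) *\<^sub>R (c *\<^sub>R x)) \<le> 1/c * sublin_contract p y (c *\<^sub>R x)"
      by (rule le) (use c in auto)
    then have "c * sublin_contract p y x \<le> sublin_contract p y (c *\<^sub>R x)" using c by (simp add: field_simps)
    with le[OF c, of x] show ?thesis by simp
  qed (simp add: zero)
  with add show ?thesis unfolding sublin_def by blast
qed

lemma sublin_minimal:
  assumes p: "sublin (p :: 'a::real_vector \<Rightarrow> real)"
  obtains q where "sublin q" "q \<le> p" "\<And>r. sublin r \<Longrightarrow> r \<le> q \<Longrightarrow> r = q"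
proof -
  define A where "A = {q. sublin q \<and> q \<le> p}"
  \<comment> \<open>The order is reversed, so that upper bounds of chains are lower bounds and the
    maximal element of Zorn's lemma is a minimal functional.\<close>
  define R where "R = {(q, r). q \<in> A \<and> r \<in> A \<and> r \<le> q}"
  have Field: "Field R = A" by (auto simp: R_def Field_def)
  have PO: "Partial_order R"
    unfolding partial_order_on_def preorder_on_def refl_on_def trans_def antisym_def Field
    by (auto simp: R_def)
  have "\<exists>m\<in>Field R. \<forall>a\<in>Field R. (m, a) \<in> R \<longrightarrow> a = m"
  proof (rule Zorns_po_lemma[OF PO])
    fix Ch assume Ch: "Ch \<in> Chains R"
    show "\<exists>u\<in>Field R. \<forall>a\<in>Ch. (a, u) \<in> R"
    proof (cases "Ch = {}")
      case True
      then show ?thesis using p by (auto simp: Field A_def)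
    next
      case False
      have sub: "Ch \<subseteq> A" using Ch by (auto simp: Chains_def R_def)
      have comp: "q \<le> r \<or> r \<le> q" if "q \<in> Ch" "r \<in> Ch" for q r
        using Ch that by (auto simp: Chains_def R_def)
      define u where "u x = (INF q\<in>Ch. q x)" for x
      \<comment> \<open>Every sublinear functional below \<open>p\<close> lies above
        \<open>x \<mapsto> - p (- x)\<close>, so the pointwise infimum of a chain is finite.\<close>
      have bdd: "bdd_below ((\<lambda>q. q x) ` Ch)" for x
      proof (rule bdd_belowI2[where m = "- p (- x)"])
        fix q assume "q \<in> Ch"
        then have "sublin q" "q \<le> p" using sub by (auto simp: A_def)
        then show "- p (- x) \<le> q x" using sublin_minus[of q x] le_funD[of q p "- x"] by linarith
      qed
      have le: "u x \<le> q x" if "q \<in> Ch" for q x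
        unfolding u_def by (rule cINF_lower[OF bdd that])
      have ge: "m \<le> u x" if "\<And>q. q \<in> Ch \<Longrightarrow> m \<le> q x" for m x
        unfolding u_def using False that by (intro cINF_greatest) auto
      have "u (x + y) \<le> u x + u y" for x y
      proof -
        \<comment> \<open>Two members of a chain are comparable, and the smaller one serves for both
          arguments.\<close>
        have *: "u (x + y) \<le> q x + r y" if qr: "q \<in> Ch" "r \<in> Ch" for q r
        proof -
          obtain s where s: "s \<in> Ch" "s \<le> q" "s \<le> r" using comp[OF qr] qr by blast
          have "u (x + y) \<le> s x + s y"
            using le[OF s(1), of "x + y"] sublin_add[of s x y] sub s(1) by (auto simp: A_def)
          then show ?thesis using le_funD[OF s(2), of x] le_funD[OF s(3), of y] by linarith
        qed
        have "u (x + y) - r y \<le> u x" if "r \<in> Ch" for r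
          by (rule ge) (use *[OF _ that] in \<open>auto simp: algebra_simps\<close>)
        then have "u (x + y) - u x \<le> u y" by (intro ge) (auto simp: algebra_simps)
        then show ?thesis by simp
      qed
      moreover have "u (c *\<^sub>R x) = c * u x" if c: "0 \<le> c" for c x
      proof (rule antisym)
        have sc: "q (c *\<^sub>R x) = c * q x" if "q \<in> Ch" for q
          using sub that c sublin_scale[of q c x] by (auto simp: A_def)
        show "c * u x \<le> u (c *\<^sub>R x)"
          by (rule ge) (auto simp: sc intro!: mult_left_mono le c)
        show "u (c *\<^sub>R x) \<le> c * u x"
        proof (cases "c = 0")
          case True
          obtain q where q: "q \<in> Ch" using False by blast
          show ?thesis using le[OF q, of "c *\<^sub>R x"] sc[OF q] True by simp
        next
          case c0: False
          have "u (c *\<^sub>R x) / c \<le> u x"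
          proof (rule ge)
            fix q assume q: "q \<in> Ch"
            show "u (c *\<^sub>R x) / c \<le> q x" using le[OF q, of "c *\<^sub>R x"] sc[OF q] c c0 by (simp add: field_simps)
          qed
          then show ?thesis using c c0 by (simp add: field_simps)
        qed
      qed
      ultimately have "sublin u" by (simp add: sublin_def)
      moreover have "u \<le> p"
      proof -
        obtain q where q: "q \<in> Ch" using False by blast
        then have "q \<le> p" using sub by (auto simp: A_def)
        with le[OF q] show ?thesis by (meson le_fun_def order_trans)
      qed
      ultimately have "u \<in> A" by (simp add: A_def)
      then show ?thesis
        using le sub by (intro bexI[of _ u]) (auto simp: Field, auto simp: R_def le_fun_def)
    qed
  qed
  then obtain q where q: "q \<in> A" "\<And>a. a \<in> A \<Longrightarrow> (q, a) \<in> R \<Longrightarrow> a = q" unfolding Field by blast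
  show ?thesis
  proof (rule that[of q])
    show "sublin q" "q \<le> p" using q(1) by (auto simp: A_def)
    show "r = q" if "sublin r" "r \<le> q" for r
      using q that by (auto simp: A_def R_def intro: order_trans)
  qed
qed

lemma sublin_contract_le_self: "sublin p \<Longrightarrow> sublin_contract p y \<le> p"
  using sublin_contract_le[of p 0 y] by (auto simp: le_fun_def)

text \<open>A minimal sublinear functional \<open>q\<close> equals each of its contractions, which forces
  \<open>q (x + y) = q x + q y\<close>.\<close>

lemma hahn_banach_sublin:
  assumes p: "sublin (p :: 'a::real_vector \<Rightarrow> real)"
  obtains l where "linear l" "\<And>x. l x \<le> p x" "l x0 = p x0"
proof -
  \<comment> \<open>Minimality starts from the contraction at \<open>x0\<close> rather than from
    \<open>p\<close>; this fixes the value at \<open>x0\<close>.\<close>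
  obtain q where q: "sublin q" "q \<le> sublin_contract p x0" "\<And>r. sublin r \<Longrightarrow> r \<le> q \<Longrightarrow> r = q"
    using sublin_minimal[OF sublin_contract[OF p]] by blast
  have add: "q (x + y) = q x + q y" for x y
  proof -
    have "sublin_contract q y = q"
      by (rule q(3)[OF sublin_contract[OF q(1)] sublin_contract_le_self[OF q(1)]])
    then have "q x \<le> q (x + y) - q y"
      using sublin_contract_le[OF q(1), of 1 y x] by simp
    with sublin_add[OF q(1), of x y] show ?thesis by simp
  qed
  have minus: "q (- x) = - q x" for x
    using add[of x "- x"] sublin_zero[OF q(1)] by simp
  have "q (c *\<^sub>R x) = c * q x" for c x
  proof (cases "c \<ge> 0")
    case False
    then show ?thesis using sublin_scale[OF q(1), of "- c" x] minus[of "c *\<^sub>R x"] by simp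
  qed (simp add: sublin_scale[OF q(1)])
  then have lin: "linear q" by (intro linearI) (auto simp: add)
  have le: "q x \<le> p x" for x
    using q(2) sublin_contract_le_self[OF p, of x0] by (meson le_funD order_trans)
  have "q (- x0) \<le> sublin_contract p x0 (- x0)" using q(2) by (simp add: le_fun_def)
  also have "\<dots> \<le> - p x0" using sublin_contract_le[OF p, of 1 x0 "- x0"] sublin_zero[OF p] by simp
  finally have "q x0 = p x0" using le[of x0] minus[of x0] by simp
  with lin le show ?thesis by (rule that)
qed

section \<open>Continuity of scaling and the gauge of a convex neighbourhood\<close>

lemma tendsto_scaleR_lcs:
  fixes x :: "'a::locally_convex_space"
  assumes "(f \<longlongrightarrow> a) F" "(g \<longlongrightarrow> x) F"
  shows "((\<lambda>i. f i *\<^sub>R g i) \<longlongrightarrow> a *\<^sub>R x) F"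
  using filterlim_compose[OF tendsto_scaleR_Pair filterlim_Pair[OF assms]] by simp

lemma continuous_on_scaleR_lcs[continuous_intros]:
  fixes g :: "'b::topological_space \<Rightarrow> 'a::locally_convex_space"
  assumes "continuous_on A f" "continuous_on A g"
  shows "continuous_on A (\<lambda>x. f x *\<^sub>R g x)"
  using assms unfolding continuous_on_def by (auto intro: tendsto_scaleR_lcs)

definition minkowski :: "'a::real_vector set \<Rightarrow> 'a \<Rightarrow> real" where
  "minkowski V x = Inf {t. 0 < t \<and> (1 / t) *\<^sub>R x \<in> V}"

context
  fixes V :: "'a::locally_convex_space set"
  assumes V: "open V" "0 \<in> V"
    and conv: "\<And>x y t. x \<in> V \<Longrightarrow> y \<in> V \<Longrightarrow> 0 \<le> t \<Longrightarrow> t \<le> 1 \<Longrightarrow> (1 - t) *\<^sub>R x + t *\<^sub>R y \<in> V"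
begin

text \<open>Scaling is continuous at 0, so \<open>t *\<^sub>R x\<close> enters \<open>V\<close> as
  \<open>t\<close> decreases to 0.\<close>

lemma minkowski_absorbing: "\<exists>t>0. (1 / t) *\<^sub>R x \<in> V"
proof -
  have "((\<lambda>t::real. t *\<^sub>R x) \<longlongrightarrow> 0 *\<^sub>R x) (at_right 0)"
    by (intro tendsto_scaleR_lcs tendsto_const tendsto_ident_at)
  then have "\<forall>\<^sub>F t in at_right 0. t *\<^sub>R x \<in> V"
    using V by (auto dest: topological_tendstoD)
  then obtain b where b: "b > 0" "\<And>t. 0 < t \<Longrightarrow> t < b \<Longrightarrow> t *\<^sub>R x \<in> V"
    unfolding eventually_at_right_field by auto
  then have "(1 / (2 / b)) *\<^sub>R x \<in> V" by simp
  with b(1) show ?thesis by (intro exI[of _ "2 / b"]) auto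
qed

lemma minkowski_bdd: "bdd_below {t. 0 < t \<and> (1 / t) *\<^sub>R x \<in> V}"
  by (rule bdd_belowI[of _ 0]) auto

lemma minkowski_nonneg: "0 \<le> minkowski V x"
  unfolding minkowski_def using minkowski_absorbing[of x] by (intro cInf_greatest) auto

lemma minkowski_le: "0 < t \<Longrightarrow> (1 / t) *\<^sub>R x \<in> V \<Longrightarrow> minkowski V x \<le> t"
  unfolding minkowski_def by (rule cInf_lower[OF _ minkowski_bdd]) auto

lemma minkowski_less: "minkowski V x < t \<Longrightarrow> \<exists>s>0. s < t \<and> (1 / s) *\<^sub>R x \<in> V"
  unfolding minkowski_def using cInf_lessD[of "{t. 0 < t \<and> (1 / t) *\<^sub>R x \<in> V}" t] minkowski_absorbing[of x] by auto

lemma sublin_minkowski: "sublin (minkowski V)"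
proof -
  have add: "minkowski V (x + y) \<le> minkowski V x + minkowski V y" for x y
  proof (rule field_le_epsilon)
    fix e :: real assume "e > 0"
    obtain s where s: "s > 0" "s < minkowski V x + e / 2" "(1 / s) *\<^sub>R x \<in> V"
      using minkowski_less[of x "minkowski V x + e / 2"] \<open>e > 0\<close> by auto
    obtain t where t: "t > 0" "t < minkowski V y + e / 2" "(1 / t) *\<^sub>R y \<in> V"
      using minkowski_less[of y "minkowski V y + e / 2"] \<open>e > 0\<close> by auto
    \<comment> \<open>The weights \<open>s / (s + t)\<close> and \<open>t / (s + t)\<close> carry
      the two points of \<open>V\<close> to \<open>(x + y) / (s + t)\<close>.\<close>
    have "(1 - t / (s + t)) *\<^sub>R ((1 / s) *\<^sub>R x) + (t / (s + t)) *\<^sub>R ((1 / t) *\<^sub>R y) \<in> V"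
      by (rule conv) (use s t in auto)
    also have "(1 - t / (s + t)) *\<^sub>R ((1 / s) *\<^sub>R x) + (t / (s + t)) *\<^sub>R ((1 / t) *\<^sub>R y)
        = (1 / (s + t)) *\<^sub>R (x + y)"
    proof -
      have "(1 - t / (s + t)) * (1 / s) = 1 / (s + t)" "(t / (s + t)) * (1 / t) = 1 / (s + t)"
        using s(1) t(1) by (auto simp: field_simps)
      then show ?thesis by (simp only: scaleR_scaleR scaleR_add_right)
    qed
    finally have "minkowski V (x + y) \<le> s + t" using s t by (intro minkowski_le) auto
    then show "minkowski V (x + y) \<le> minkowski V x + minkowski V y + e" using s t by simp
  qed
  have le: "minkowski V (c *\<^sub>R x) \<le> c * minkowski V x" if c: "c > 0" for c x
  proof -
    have "minkowski V (c *\<^sub>R x) / c \<le> minkowski V x"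
      unfolding minkowski_def[of V x]
    proof (rule cInf_greatest)
      fix t assume t: "t \<in> {t. 0 < t \<and> (1 / t) *\<^sub>R x \<in> V}"
      then have "minkowski V (c *\<^sub>R x) \<le> c * t" using c by (intro minkowski_le) auto
      then show "minkowski V (c *\<^sub>R x) / c \<le> t" using c by (simp add: field_simps)
    qed (use minkowski_absorbing[of x] in auto)
    then show ?thesis using c by (simp add: field_simps)
  qed
  have zero: "minkowski V 0 = 0"
  proof (rule antisym[OF _ minkowski_nonneg])
    show "minkowski V 0 \<le> 0"
      by (rule field_le_epsilon) (use V in \<open>auto intro: minkowski_le\<close>)
  qed
  have "minkowski V (c *\<^sub>R x) = c * minkowski V x" if c: "c \<ge> 0" for c x
  proof (cases "c = 0")
    case False
    with c have c: "c > 0" by simp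
    have "minkowski V ((1/c) *\<^sub>R (c *\<^sub>R x)) \<le> 1/c * minkowski V (c *\<^sub>R x)"
      by (rule le) (use c in auto)
    then have "c * minkowski V x \<le> minkowski V (c *\<^sub>R x)" using c by (simp add: field_simps)
    with le[OF c, of x] show ?thesis by simp
  qed (simp add: zero)
  with add show ?thesis unfolding sublin_def by blast
qed

lemma minkowski_ge_1:
  assumes "x \<notin> V" shows "1 \<le> minkowski V x"
proof (rule ccontr)
  assume "\<not> ?thesis"
  then obtain s where s: "s > 0" "s < 1" "(1 / s) *\<^sub>R x \<in> V" using minkowski_less[of x 1] by auto
  have "(1 - s) *\<^sub>R 0 + s *\<^sub>R ((1 / s) *\<^sub>R x) \<in> V" by (rule conv) (use s V in auto)
  with s assms show False by simp
qed

text \<open>\<open>l\<close> is at most 1 on \<open>V\<close>. As \<open>V\<close> need not be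
  symmetric, smallness of \<open>|l x|\<close> requires both \<open>(2 / e) x\<close> and its
  negative in \<open>V\<close>.\<close>

lemma continuous_of_le_minkowski:
  assumes l: "linear l" "\<And>x. l x \<le> minkowski V x"
  shows "continuous_on UNIV l"
proof -
  have 0: "(l \<longlongrightarrow> 0) (nhds 0)"
  proof (rule tendstoI)
    fix e :: real assume e: "e > 0"
    have c: "((\<lambda>x. (2 / e) *\<^sub>R x) \<longlongrightarrow> (2 / e) *\<^sub>R 0) (nhds (0::'a))"
      by (intro tendsto_scaleR_lcs tendsto_const filterlim_ident)
    then have "\<forall>\<^sub>F x in nhds (0::'a). (2 / e) *\<^sub>R x \<in> V"
      using V by (auto dest: topological_tendstoD)
    moreover have "\<forall>\<^sub>F x in nhds (0::'a). - ((2 / e) *\<^sub>R x) \<in> V"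
      using tendsto_minus[OF c] V by (auto dest: topological_tendstoD)
    ultimately show "\<forall>\<^sub>F x in nhds 0. dist (l x) 0 < e"
    proof eventually_elim
      case (elim x)
      have "l y \<le> 1" if "y \<in> V" for y
        using l(2)[of y] minkowski_le[of 1 y] that by simp
      then have "l ((2 / e) *\<^sub>R x) \<le> 1" "l (- ((2 / e) *\<^sub>R x)) \<le> 1" using elim by blast+
      then have "2 / e * l x \<le> 1" "- (2 / e * l x) \<le> 1"
        by (auto simp: linear_scale[OF l(1)] linear_neg[OF l(1)])
      then have "\<bar>l x\<bar> \<le> e / 2" using e by (auto simp: field_simps abs_if)
      then show ?case using e by (simp add: dist_real_def)
    qed
  qed
  show ?thesis
  proof (rule continuous_at_imp_continuous_on, clarsimp simp: isCont_def)
    fix x :: 'a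
    have "((\<lambda>y. y - x) \<longlongrightarrow> x - x) (at x)" by (intro tendsto_intros)
    then have "((\<lambda>y. l (y - x)) \<longlongrightarrow> 0) (at x)" using filterlim_compose[OF 0] by simp
    then have "((\<lambda>y. l (y - x) + l x) \<longlongrightarrow> 0 + l x) (at x)" by (intro tendsto_intros)
    then show "l \<midarrow>x\<rightarrow> l x" by (simp add: linear_diff[OF l(1)])
  qed
qed

end

text \<open>The Hahn--Banach functional for the gauge at \<open>y - x\<close> attains the gauge
  there, which is at least 1 because \<open>y - x\<close> lies outside the convex
  neighbourhood.\<close>

lemma top_dual_separates:
  fixes x y :: "'a::locally_convex_space"
  assumes "x \<noteq> y"
  obtains l where "l \<in> top_dual" "l x < l y"
proof -
  have "y - x \<noteq> 0" using assms by simp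
  then obtain U where U: "open U" "0 \<in> U" "y - x \<notin> U" using t1_space[of 0 "y - x"] by metis
  obtain V where V: "open V" "0 \<in> V" "V \<subseteq> U"
    "\<And>x y t. x \<in> V \<Longrightarrow> y \<in> V \<Longrightarrow> 0 \<le> t \<Longrightarrow> t \<le> 1 \<Longrightarrow> (1 - t) *\<^sub>R x + t *\<^sub>R y \<in> V"
    using convex_nhds_base[OF U(1,2)] by metis
  obtain l where l: "linear l" "\<And>x. l x \<le> minkowski V x" "l (y - x) = minkowski V (y - x)"
    using hahn_banach_sublin[OF sublin_minkowski[OF V(1,2,4)]] by blast
  have "l \<in> top_dual"
    using l(1) continuous_of_le_minkowski[OF V(1,2,4) l(1,2)] by (simp add: top_dual_def)
  moreover have "l x < l y"
    using minkowski_ge_1[OF V(1,2,4), of "y - x"] U(3) V(3) l(3) linear_diff[OF l(1), of y x] by fastforce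
  ultimately show ?thesis by (rule that)
qed


section \<open>Characteristic functions in several variables\<close>

text \<open>Levy's uniqueness theorem concerns probability measures; the total mass is the
  characteristic function at 0, so both measures can be divided by it, and mass 0 is
  trivial.\<close>

lemma finite_measure_char_unique:
  fixes N1 N2 :: "real measure"
  assumes fin: "finite_measure N1" "finite_measure N2"
    and sets[measurable_cong]: "sets N1 = sets borel" "sets N2 = sets borel"
    and char: "\<And>t. char N1 t = char N2 t"
  shows "N1 = N2"
proof -
  interpret N1: finite_measure N1 by fact
  interpret N2: finite_measure N2 by fact
  have sp: "space N1 = UNIV" "space N2 = UNIV" using sets_eq_imp_space_eq[OF sets(1)] sets_eq_imp_space_eq[OF sets(2)] by auto
  define c where "c = measure N1 UNIV"
  have c2: "measure N2 UNIV = c"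
    using char[of 0] by (simp add: char_def c_def sp)
  show ?thesis
  proof (cases "c = 0")
    case True
    then have "emeasure N1 UNIV = 0" "emeasure N2 UNIV = 0"
      using c2 by (auto simp: c_def N1.emeasure_eq_measure N2.emeasure_eq_measure)
    then have "emeasure N1 A = 0" "emeasure N2 A = 0" for A
      using emeasure_space[of N1 A] emeasure_space[of N2 A] by (auto simp: sp)
    then show ?thesis by (intro measure_eqI) (auto simp: sets)
  next
    case False
    then have c: "c > 0" using measure_nonneg[of N1 UNIV] by (simp add: c_def less_le)
    have real: "real_distribution (density N (\<lambda>_. ennreal (1 / c)))"
      if "sets N = sets borel" "emeasure N UNIV = ennreal c" for N :: "real measure"
    proof -
      have "prob_space (density N (\<lambda>_. ennreal (1 / c)))"
      proof (rule prob_spaceI)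
      show "emeasure (density N (\<lambda>_. ennreal (1 / c))) (space (density N (\<lambda>_. ennreal (1 / c)))) = 1"
        using that c sets_eq_imp_space_eq[OF that(1)]
        by (simp add: emeasure_density_const flip: ennreal_mult)
      qed
      then show ?thesis
        using that by (simp add: real_distribution_def real_distribution_axioms_def)
    qed
    have ch: "char (density N (\<lambda>_. ennreal (1 / c))) t = (1 / c) *\<^sub>R char N t"
      if "sets N = sets borel" for N :: "real measure" and t
      unfolding char_def using c that
      by (subst integral_density) (auto simp: measurable_cong_sets[OF that])
    have e: "emeasure N1 UNIV = ennreal c" "emeasure N2 UNIV = ennreal c"
      using c2 by (auto simp: c_def N1.emeasure_eq_measure N2.emeasure_eq_measure)
    have eq: "density N1 (\<lambda>_. ennreal (1 / c)) = density N2 (\<lambda>_. ennreal (1 / c))"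
      by (intro Levy_uniqueness real sets e ext) (simp add: ch sets char)
    show ?thesis
    proof (rule measure_eqI)
      fix A assume "A \<in> sets N1"
      have "ennreal (1 / c) * emeasure N1 A = ennreal (1 / c) * emeasure N2 A"
        using arg_cong[OF eq, of "\<lambda>M. emeasure M A"] \<open>A \<in> sets N1\<close> by (simp add: emeasure_density_const sets)
      then show "emeasure N1 A = emeasure N2 A"
        using c by (simp add: ennreal_mult_cancel_left)
    qed (simp add: sets)
  qed
qed

text \<open>The nonnegative trigonometric weights \<open>1\<close>, \<open>1 + cos Y\<close> and \<open>1 + sin Y\<close> reduce the joint
  characteristic function to characteristic functions of measures on the line.\<close>

lemma char_integral_eq_step:
  assumes fin: "finite_measure M1" "finite_measure M2"
    and meas: "w1 \<in> borel_measurable M1" "X1 \<in> borel_measurable M1" "Y1 \<in> borel_measurable M1"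
      "w2 \<in> borel_measurable M2" "X2 \<in> borel_measurable M2" "Y2 \<in> borel_measurable M2"
    and w: "\<And>x. 0 \<le> w1 x" "\<And>x. w1 x \<le> 1" "\<And>x. 0 \<le> w2 x" "\<And>x. w2 x \<le> (1::real)"
    and eq: "\<And>s r. (CLINT x|M1. w1 x *\<^sub>R iexp (s * X1 x + r * Y1 x)) = (CLINT x|M2. w2 x *\<^sub>R iexp (s * X2 x + r * Y2 x))"
    and B: "B \<in> sets borel"
  shows "(CLINT x|M1. (w1 x * indicator B (X1 x)) *\<^sub>R iexp (Y1 x)) = (CLINT x|M2. (w2 x * indicator B (X2 x)) *\<^sub>R iexp (Y2 x))"
proof -
  note [measurable] = meas B
  \<comment> \<open>A weight \<open>c\<close> of \<open>Y\<close> that combines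
    \<open>iexp (r Y)\<close> for \<open>r = 0, 1, -1\<close> turns the characteristic function of
    the weighted law of \<open>X\<close> into the same combination of values assumed equal;
    nonnegativity of \<open>c\<close> makes the weighted law a measure.\<close>
  have main: "(LINT x|M1. w1 x * c (Y1 x) * indicator B (X1 x)) = (LINT x|M2. w2 x * c (Y2 x) * indicator B (X2 x))"
    if c[measurable]: "c \<in> borel_measurable borel" and c_nn: "\<And>y. 0 \<le> c y" and c_le: "\<And>y. c y \<le> 2"
      and c_eq: "\<And>y. complex_of_real (c y) = a0 + a1 * iexp y + a2 * iexp (- y)" for c a0 a1 a2
  proof -
    have gen: "finite_measure D \<and> sets D = sets borel \<and>
        (\<forall>t. char D t = a0 * (CLINT x|M. w x *\<^sub>R iexp (t * X x + 0 * Y x)) + a1 * (CLINT x|M. w x *\<^sub>R iexp (t * X x + 1 * Y x))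
          + a2 * (CLINT x|M. w x *\<^sub>R iexp (t * X x + (-1) * Y x))) \<and>
        measure D B = (LINT x|M. w x * c (Y x) * indicator B (X x))"
      if M: "finite_measure M" and [measurable]: "w \<in> borel_measurable M" "X \<in> borel_measurable M" "Y \<in> borel_measurable M"
        and w: "\<And>x. 0 \<le> w x" "\<And>x. w x \<le> 1"
        and D: "D = distr (density M (\<lambda>x. ennreal (w x * c (Y x)))) borel X"
      for M :: "'q measure" and w X Y D
    proof -
      interpret M: finite_measure M by fact
      have wc: "0 \<le> w x * c (Y x)" "w x * c (Y x) \<le> 2" for x
        using w[of x] c_nn[of "Y x"] c_le[of "Y x"] mult_mono[of "w x" 1 "c (Y x)" 2] by auto
      have int: "integrable M (\<lambda>x. w x *\<^sub>R iexp (t * X x + r * Y x))" for t r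
        by (rule M.integrable_const_bound[where B = 1]) (use w in \<open>auto simp: norm_mult\<close>)
      have fin: "finite_measure D"
      proof
        have "emeasure D (space D) = (\<integral>\<^sup>+x. ennreal (w x * c (Y x)) \<partial>M)"
          unfolding D by (simp add: emeasure_distr emeasure_density cong: nn_integral_cong)
        also have "\<dots> \<le> (\<integral>\<^sup>+x. ennreal 2 \<partial>M)" by (intro nn_integral_mono ennreal_leI wc)
        also have "\<dots> < \<infinity>" by (simp add: M.emeasure_eq_measure ennreal_mult_less_top)
        finally show "emeasure D (space D) \<noteq> \<infinity>" by simp
      qed
      moreover have "char D t = a0 * (CLINT x|M. w x *\<^sub>R iexp (t * X x + 0 * Y x)) + a1 * (CLINT x|M. w x *\<^sub>R iexp (t * X x + 1 * Y x))
          + a2 * (CLINT x|M. w x *\<^sub>R iexp (t * X x + (-1) * Y x))" for t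
      proof -
        have "char D t = (CLINT x|M. (w x * c (Y x)) *\<^sub>R iexp (t * X x))"
          unfolding char_def D using wc by (subst integral_distr) (auto simp: integral_density)
        also have "\<dots> = (CLINT x|M. a0 * (w x *\<^sub>R iexp (t * X x + 0 * Y x)) + a1 * (w x *\<^sub>R iexp (t * X x + 1 * Y x))
           + a2 * (w x *\<^sub>R iexp (t * X x + (-1) * Y x)))"
        proof (rule Bochner_Integration.integral_cong[OF refl])
          fix x
          have "iexp (t * X x + 1 * Y x) = iexp (t * X x) * iexp (Y x)" "iexp (t * X x + (-1) * Y x) = iexp (t * X x) * iexp (- Y x)"
            by (auto simp: ring_distribs exp_add exp_minus exp_diff divide_inverse)
          then show "(w x * c (Y x)) *\<^sub>R iexp (t * X x) = a0 * (w x *\<^sub>R iexp (t * X x + 0 * Y x)) + a1 * (w x *\<^sub>R iexp (t * X x + 1 * Y x))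
             + a2 * (w x *\<^sub>R iexp (t * X x + (-1) * Y x))"
            by (simp add: scaleR_conv_of_real c_eq algebra_simps)
        qed
        also have "\<dots> = a0 * (CLINT x|M. w x *\<^sub>R iexp (t * X x + 0 * Y x)) + a1 * (CLINT x|M. w x *\<^sub>R iexp (t * X x + 1 * Y x))
            + a2 * (CLINT x|M. w x *\<^sub>R iexp (t * X x + (-1) * Y x))"
          by (subst Bochner_Integration.integral_add, (intro Bochner_Integration.integrable_add integrable_mult_right int)+)+ 
             (simp only: integral_mult_right_zero)
        finally show ?thesis .
      qed
      moreover have "measure D B = (LINT x|M. w x * c (Y x) * indicator B (X x))"
      proof -
        have "emeasure D B = (\<integral>\<^sup>+x. ennreal (w x * c (Y x)) * indicator (X -` B \<inter> space M) x \<partial>M)"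
          unfolding D by (simp add: emeasure_distr emeasure_density)
        also have "\<dots> = (\<integral>\<^sup>+x. ennreal (w x * c (Y x) * indicator B (X x)) \<partial>M)"
          by (intro nn_integral_cong) (auto simp: indicator_def)
        finally show ?thesis
          unfolding measure_def using wc by (subst integral_eq_nn_integral) (auto simp: indicator_def)
      qed
      ultimately show ?thesis by (simp add: D)
    qed
    define D1 where "D1 = distr (density M1 (\<lambda>x. ennreal (w1 x * c (Y1 x)))) borel X1"
    define D2 where "D2 = distr (density M2 (\<lambda>x. ennreal (w2 x * c (Y2 x)))) borel X2"
    note g1 = gen[OF fin(1) meas(1-3) w(1,2) D1_def]
    note g2 = gen[OF fin(2) meas(4-6) w(3,4) D2_def]
    have "char D1 t = char D2 t" for t
      unfolding g1[THEN conjunct2, THEN conjunct2, THEN conjunct1, rule_format] g2[THEN conjunct2, THEN conjunct2, THEN conjunct1, rule_format] eq ..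
    then have "D1 = D2"
      by (intro finite_measure_char_unique) (use g1 g2 in blast)+
    then show ?thesis using g1 g2 by simp
  qed
  have e1: "(LINT x|M1. w1 x * indicator B (X1 x)) = (LINT x|M2. w2 x * indicator B (X2 x))"
    using main[of "\<lambda>_. 1" 1 0 0] by simp
  have ie: "iexp y = Complex (cos y) (sin y)" for y :: real by (simp add: complex_eq_iff Re_exp Im_exp)
  have nn: "0 \<le> 1 + cos y" "0 \<le> 1 + sin y" for y :: real
    using cos_ge_minus_one[of y] sin_ge_minus_one[of y] by linarith+
  have e2: "(LINT x|M1. w1 x * (1 + cos (Y1 x)) * indicator B (X1 x)) = (LINT x|M2. w2 x * (1 + cos (Y2 x)) * indicator B (X2 x))"
    by (rule main[of "\<lambda>y. 1 + cos y" 1 "1/2" "1/2"])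
       (auto simp: complex_eq_iff Re_exp Im_exp nn)
  have e3: "(LINT x|M1. w1 x * (1 + sin (Y1 x)) * indicator B (X1 x)) = (LINT x|M2. w2 x * (1 + sin (Y2 x)) * indicator B (X2 x))"
    by (rule main[of "\<lambda>y. 1 + sin y" 1 "-\<i>/2" "\<i>/2"]) (auto simp: complex_eq_iff Re_exp Im_exp nn)
  \<comment> \<open>\<open>cos Y\<close> and \<open>sin Y\<close> are the weights
    \<open>1 + cos Y\<close> and \<open>1 + sin Y\<close> minus the weight 1, so the three
    identities recover the real and imaginary parts.\<close>
  have split: "(CLINT x|M. (w x * indicator B (X x)) *\<^sub>R iexp (Y x)) =
      Complex ((LINT x|M. w x * (1 + cos (Y x)) * indicator B (X x)) - (LINT x|M. w x * indicator B (X x)))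
        ((LINT x|M. w x * (1 + sin (Y x)) * indicator B (X x)) - (LINT x|M. w x * indicator B (X x)))"
    if M: "finite_measure M" and [measurable]: "w \<in> borel_measurable M" "X \<in> borel_measurable M" "Y \<in> borel_measurable M"
        and w: "\<And>x. 0 \<le> w x" "\<And>x. w x \<le> 1" for M :: "'q measure" and w X Y
  proof -
    interpret M: finite_measure M by fact
    have i0: "integrable M (\<lambda>x. w x * indicator B (X x))"
      by (rule M.integrable_const_bound[where B = 1]) (use w in \<open>auto simp: indicator_def\<close>)
    have bd: "integrable M (\<lambda>x. w x * f (Y x) * indicator B (X x))" 
      if [measurable]: "f \<in> borel_measurable borel" and "\<And>y. \<bar>f y\<bar> \<le> 2" for f :: "real \<Rightarrow> real"
    proof (rule M.integrable_const_bound[where B = 2])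
      have "\<bar>w x * f (Y x)\<bar> \<le> 2" for x
        using mult_mono[of "w x" 1 "\<bar>f (Y x)\<bar>" 2] w[of x] that(2)[of "Y x"] by (simp add: abs_mult)
      then show "AE x in M. norm (w x * f (Y x) * indicator B (X x)) \<le> 2"
        by (auto simp: indicator_def)
    qed measurable
    have b: "\<bar>1 + cos y\<bar> \<le> 2" "\<bar>1 + sin y\<bar> \<le> 2" for y :: real
      using nn[of y] cos_le_one[of y] sin_le_one[of y] by (simp_all add: abs_of_nonneg)
    have i1: "integrable M (\<lambda>x. w x * (1 + cos (Y x)) * indicator B (X x))" "integrable M (\<lambda>x. w x * (1 + sin (Y x)) * indicator B (X x))"
      by (rule bd; use b in simp)+
    have i: "integrable M (\<lambda>x. (w x * indicator B (X x)) *\<^sub>R iexp (Y x))"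
      by (rule M.integrable_const_bound[where B = 1]) (use w in \<open>auto simp: indicator_def\<close>)
    show ?thesis
    proof (rule complex_eqI)
      show "Re (CLINT x|M. (w x * indicator B (X x)) *\<^sub>R iexp (Y x)) = Re (Complex ((LINT x|M. w x * (1 + cos (Y x)) * indicator B (X x)) - (LINT x|M. w x * indicator B (X x)))
        ((LINT x|M. w x * (1 + sin (Y x)) * indicator B (X x)) - (LINT x|M. w x * indicator B (X x))))"
        by (subst integral_Re[OF i, symmetric], simp, subst Bochner_Integration.integral_diff[OF i1(1) i0, symmetric])
           (auto intro!: Bochner_Integration.integral_cong simp: algebra_simps ie)
      show "Im (CLINT x|M. (w x * indicator B (X x)) *\<^sub>R iexp (Y x)) = Im (Complex ((LINT x|M. w x * (1 + cos (Y x)) * indicator B (X x)) - (LINT x|M. w x * indicator B (X x)))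
        ((LINT x|M. w x * (1 + sin (Y x)) * indicator B (X x)) - (LINT x|M. w x * indicator B (X x))))"
        by (subst integral_Im[OF i, symmetric], simp, subst Bochner_Integration.integral_diff[OF i1(2) i0, symmetric])
           (auto intro!: Bochner_Integration.integral_cong simp: algebra_simps ie)
    qed
  qed
  show ?thesis
    unfolding split[OF fin(1) meas(1-3) w(1,2)] split[OF fin(2) meas(4-6) w(3,4)] e1 e2 e3 ..
qed

text \<open>The exponential is traded for indicators one coordinate at a time; the frequencies of
  the coordinates not yet treated stay arbitrary, which is what the next step needs. After
  \<open>d\<close> steps the measures agree on boxes.\<close>

lemma PiM_char_unique:
  fixes M1 M2 :: "(nat \<Rightarrow> real) measure"
  assumes fin: "finite_measure M1" "finite_measure M2"
    and sets[measurable_cong]: "sets M1 = sets (PiM {..<d} (\<lambda>_. borel))" "sets M2 = sets (PiM {..<d} (\<lambda>_. borel))"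
    and char: "\<And>t. (CLINT x|M1. iexp (\<Sum>i<d. t i * x i)) = (CLINT x|M2. iexp (\<Sum>i<d. t i * x i))"
  shows "M1 = M2"
proof -
  interpret M1: finite_measure M1 by fact
  interpret M2: finite_measure M2 by fact
  have step: "\<forall>t. (CLINT x|M1. (\<Prod>j<k. indicator (B j) (x j)) *\<^sub>R iexp (\<Sum>i\<in>{k..<d}. t i * x i)) =
      (CLINT x|M2. (\<Prod>j<k. indicator (B j) (x j)) *\<^sub>R iexp (\<Sum>i\<in>{k..<d}. t i * x i))"
    if "k \<le> d" and B: "\<And>j. j < d \<Longrightarrow> B j \<in> sets borel" for k and B :: "nat \<Rightarrow> real set"
    using that(1)
  proof (induction k)
    case 0
    then show ?case using char by (simp add: atLeast0LessThan)
  next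
    case (Suc k)
    then have k: "k < d" by simp
    show ?case
    proof
      fix t :: "nat \<Rightarrow> real"
      have m: "(\<lambda>x. (\<Prod>j<k. indicator (B j) (x j)) :: real) \<in> borel_measurable (PiM {..<d} (\<lambda>_. borel))"
      proof (rule borel_measurable_prod)
        fix j assume "j \<in> {..<k}"
        then have j: "j < d" using k by simp
        note [measurable] = B[OF j]
        have [measurable]: "(\<lambda>x. x j) \<in> borel_measurable (PiM {..<d} (\<lambda>_. borel))" using j by simp
        show "(\<lambda>x. indicator (B j) (x j) :: real) \<in> borel_measurable (PiM {..<d} (\<lambda>_. borel))" by measurable
      qed
      have mX: "(\<lambda>x. x k) \<in> borel_measurable (PiM {..<d} (\<lambda>_. borel))" using k by simp
      have mY: "(\<lambda>x. \<Sum>i\<in>{Suc k..<d}. t i * x i) \<in> borel_measurable (PiM {..<d} (\<lambda>_. borel))"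
        by (intro borel_measurable_sum borel_measurable_times borel_measurable_const) simp
      have ins: "{k..<d} = insert k {Suc k..<d}" using k by auto
      have p: "(\<Prod>j<k. indicator (B j) (x j) :: real) \<in> {0..1}" for x
        by (auto intro!: prod_nonneg prod_le_1 simp: indicator_def)
      have "(CLINT x|M1. ((\<Prod>j<k. indicator (B j) (x j)) * indicator (B k) (x k)) *\<^sub>R iexp (\<Sum>i\<in>{Suc k..<d}. t i * x i)) =
          (CLINT x|M2. ((\<Prod>j<k. indicator (B j) (x j)) * indicator (B k) (x k)) *\<^sub>R iexp (\<Sum>i\<in>{Suc k..<d}. t i * x i))"
      proof (rule char_integral_eq_step[OF fin])
        show "(CLINT x|M1. (\<Prod>j<k. indicator (B j) (x j)) *\<^sub>R iexp (s * x k + r * (\<Sum>i\<in>{Suc k..<d}. t i * x i))) =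
          (CLINT x|M2. (\<Prod>j<k. indicator (B j) (x j)) *\<^sub>R iexp (s * x k + r * (\<Sum>i\<in>{Suc k..<d}. t i * x i)))" for s r
        proof -
          have e: "s * x k + r * (\<Sum>i\<in>{Suc k..<d}. t i * x i) = (\<Sum>i\<in>{k..<d}. (if i = k then s else r * t i) * x i)" for x :: "nat \<Rightarrow> real"
            unfolding ins by (auto simp: sum_distrib_left mult.assoc intro!: sum.cong)
          show ?thesis unfolding e using Suc k by auto
        qed
      qed (use m mX mY p B k in \<open>auto simp: measurable_cong_sets[OF sets(1)] measurable_cong_sets[OF sets(2)]\<close>)
      then show "(CLINT x|M1. (\<Prod>j<Suc k. indicator (B j) (x j)) *\<^sub>R iexp (\<Sum>i\<in>{Suc k..<d}. t i * x i)) =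
        (CLINT x|M2. (\<Prod>j<Suc k. indicator (B j) (x j)) *\<^sub>R iexp (\<Sum>i\<in>{Suc k..<d}. t i * x i))"
        by (simp add: mult.commute)
    qed
  qed
  have sp: "space M1 = Rn d" "space M2 = Rn d"
    using sets_eq_imp_space_eq[OF sets(1)] sets_eq_imp_space_eq[OF sets(2)] by (auto simp: space_PiM)
  show ?thesis
  proof (rule measure_eqI_PiM_finite[where A = "\<lambda>_. Rn d"])
    show "emeasure M1 (Pi\<^sub>E {..<d} B) = emeasure M2 (Pi\<^sub>E {..<d} B)" if B: "\<And>i. i \<in> {..<d} \<Longrightarrow> B i \<in> sets borel" for B
    proof -
      have Bs: "Pi\<^sub>E {..<d} B \<in> sets (PiM {..<d} (\<lambda>_. borel))" using B by (intro sets_PiM_I_finite) auto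
      have ind: "(\<Prod>j<d. indicator (B j) (x j)) = (indicator (Pi\<^sub>E {..<d} B) x :: real)" if "x \<in> Rn d" for x
        using that by (auto simp: indicator_def PiE_iff)
      have cong: "(CLINT x|M. (\<Prod>j<d. indicat_real (B j) (x j)) *\<^sub>R 1) = (CLINT x|M. indicator (Pi\<^sub>E {..<d} B) x *\<^sub>R 1)"
        if "space M = Rn d" for M :: "(nat \<Rightarrow> real) measure"
        by (rule Bochner_Integration.integral_cong[OF refl]) (use that in \<open>simp only: ind\<close>)
      have "(CLINT x|M1. indicator (Pi\<^sub>E {..<d} B) x *\<^sub>R 1) = (CLINT x|M2. indicator (Pi\<^sub>E {..<d} B) x *\<^sub>R 1)"
        using step[OF order_refl, of B] B
        by (simp add: cong[OF sp(1)] cong[OF sp(2)] del: of_real_prod)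
      then have "measure M1 (Pi\<^sub>E {..<d} B) = measure M2 (Pi\<^sub>E {..<d} B)"
        using Bs by (simp add: sets M1.emeasure_eq_measure M2.emeasure_eq_measure)
      then show ?thesis by (simp add: M1.emeasure_eq_measure M2.emeasure_eq_measure)
    qed
    show "range (\<lambda>_. Rn d) \<subseteq> prod_algebra {..<d} (\<lambda>_. borel)"
      using prod_algebraI_finite[of "{..<d}" "\<lambda>_. UNIV" "\<lambda>_. borel"] by auto
  qed (auto simp: sets space_PiM M1.emeasure_eq_measure)
qed

section \<open>The standard Gaussian measures\<close>

abbreviation gauss1 :: "real measure" where
  "gauss1 \<equiv> density lborel (\<lambda>t. ennreal (std_normal_density t))"

lemma prob_space_gauss1: "prob_space gauss1"
  by (rule prob_space_normal_density) simp

lemma product_prob_space_gauss1: "product_prob_space (\<lambda>_::nat. gauss1)"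
  by (intro product_prob_spaceI prob_space_gauss1)

lemma sets_std_gauss[measurable_cong, simp]: "sets (std_gauss d) = sets (PiM {..<d} (\<lambda>_. borel))"
  unfolding std_gauss_def by (intro sets_PiM_cong) auto

lemma space_std_gauss[simp]: "space (std_gauss d) = Rn d"
  by (simp add: std_gauss_def space_PiM)

lemma prob_space_std_gauss: "prob_space (std_gauss d)"
  unfolding std_gauss_def by (intro prob_space_PiM prob_space_gauss1)

lemma char_std_gauss:
  "(CLINT x|std_gauss d. iexp (\<Sum>i<d. t i * x i)) = complex_of_real (exp (- (\<Sum>i<d. (t i)\<^sup>2) / 2))"
proof -
  interpret product_prob_space "\<lambda>_::nat. gauss1" by (rule product_prob_space_gauss1)
  have "(CLINT x|std_gauss d. iexp (\<Sum>i<d. t i * x i)) = (CLINT x|std_gauss d. (\<Prod>i<d. iexp (t i * x i)))"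
    by (simp add: exp_sum sum_distrib_left)
  also have "\<dots> = (\<Prod>i<d. CLINT x|gauss1. iexp (t i * x))"
    unfolding std_gauss_def
    by (rule product_integral_prod) (auto intro!: prob_space.integrable_iexp prob_space_gauss1)
  also have "\<dots> = (\<Prod>i<d. complex_of_real (exp (- ((t i)\<^sup>2) / 2)))"
    using char_std_normal_distribution by (simp add: char_def fun_eq_iff)
  also have "\<dots> = complex_of_real (exp (- (\<Sum>i<d. (t i)\<^sup>2) / 2))"
    by (simp add: exp_sum[symmetric] sum_negf[symmetric] sum_divide_distrib del: of_real_exp flip: of_real_prod)
  finally show ?thesis .
qed


section \<open>Gaussian functionals\<close>

lemma top_dual_linear: "l \<in> top_dual \<Longrightarrow> linear l"
  and top_dual_continuous: "l \<in> top_dual \<Longrightarrow> continuous_on UNIV l"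
  by (auto simp: top_dual_def)

lemma top_dual_borel: "l \<in> top_dual \<Longrightarrow> l \<in> borel_measurable borel"
  by (intro borel_measurable_continuous_onI top_dual_continuous)

lemma top_dual_zero: "(\<lambda>x. 0) \<in> top_dual"
  by (auto simp: top_dual_def linear_iff)

lemma top_dual_add: "l \<in> top_dual \<Longrightarrow> k \<in> top_dual \<Longrightarrow> (\<lambda>x. l x + k x) \<in> top_dual"
  by (auto simp: top_dual_def intro!: linear_compose_add continuous_intros)

lemma top_dual_diff: "l \<in> top_dual \<Longrightarrow> k \<in> top_dual \<Longrightarrow> (\<lambda>x. l x - k x) \<in> top_dual"
  by (auto simp: top_dual_def intro!: linear_compose_sub continuous_intros)

lemma top_dual_mult: "l \<in> top_dual \<Longrightarrow> (\<lambda>x. c * l x) \<in> top_dual"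
  by (auto simp: top_dual_def linear_iff ring_distribs intro!: continuous_on_mult_left)

lemma top_dual_sum: "(\<And>i. i \<in> A \<Longrightarrow> l i \<in> top_dual) \<Longrightarrow> (\<lambda>x. \<Sum>i\<in>A. l i x) \<in> top_dual"
  by (induction A rule: infinite_finite_induct) (auto intro: top_dual_zero top_dual_add)

lemma top_dual_eqI:
  fixes x y :: "'a::locally_convex_space"
  assumes "\<And>l. l \<in> top_dual \<Longrightarrow> l x = l y" shows "x = y"
  by (metis assms less_irrefl top_dual_separates)

text \<open>On the carrier, coordinates \<ge> \<open>d\<close> are constantly
  \<open>undefined\<close> and thus measurable; this lets Borel functions on all of
  \<open>nat \<Rightarrow> real\<close> be used on the product space.\<close>

lemma measurable_PiM_id: "(\<lambda>x. x) \<in> measurable (PiM {..<d} (\<lambda>_. borel)) (borel :: (nat \<Rightarrow> real) measure)"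
proof -
  have "(\<lambda>x. x) \<in> measurable (PiM {..<d} (\<lambda>_. borel)) (PiM UNIV (\<lambda>_. borel :: real measure))"
  proof (rule measurable_PiM_single')
    fix i :: nat
    show "(\<lambda>x. x i) \<in> measurable (PiM {..<d} (\<lambda>_. borel :: real measure)) borel"
    proof (cases "i < d")
      case False
      then have "(\<lambda>x. x i) \<in> measurable (PiM {..<d} (\<lambda>_. borel :: real measure)) borel \<longleftrightarrow>
          (\<lambda>x. undefined :: real) \<in> measurable (PiM {..<d} (\<lambda>_. borel :: real measure)) borel"
        by (intro measurable_cong) (auto simp: space_PiM PiE_iff extensional_def)
      then show ?thesis by simp
    qed simp
  qed auto
  then show ?thesis by (simp only: measurable_cong_sets[OF refl sets_PiM_equal_borel])
qed

lemma continuous_on_tuple_borel: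
  fixes f :: "(nat \<Rightarrow> real) \<Rightarrow> 'b::topological_space"
  assumes "continuous_on UNIV f"
  shows "f \<in> borel_measurable (PiM {..<d} (\<lambda>_. borel))"
  using measurable_compose[OF measurable_PiM_id borel_measurable_continuous_onI[OF assms]] .

lemma tuple_map_measurable:
  assumes "\<And>i. i < d \<Longrightarrow> k i \<in> borel_measurable M"
  shows "tuple_map d k \<in> measurable M (PiM {..<d} (\<lambda>_. borel))"
  unfolding tuple_map_def by (rule measurable_restrict) (use assms in auto)

locale radon_gaussian =
  fixes \<gamma> :: "'a::locally_convex_space measure"
  assumes centered_radon_gaussian: "centered_radon_gaussian \<gamma>"
begin

sublocale prob_space \<gamma>
  using centered_radon_gaussian by (simp add: centered_radon_gaussian_def radon_prob_def)

lemma sets_gamma[measurable_cong, simp]: "sets \<gamma> = sets borel"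
  using centered_radon_gaussian by (simp add: centered_radon_gaussian_def radon_prob_def)

lemma space_gamma[simp]: "space \<gamma> = UNIV"
  using sets_eq_imp_space_eq[OF sets_gamma] by simp

lemma radon_gamma: "radon_prob \<gamma>"
  using centered_radon_gaussian by (simp add: centered_radon_gaussian_def)

lemma top_dual_measurable[measurable_dest]: "l \<in> top_dual \<Longrightarrow> l \<in> borel_measurable \<gamma>"
  using top_dual_borel[of l] by (simp add: measurable_cong_sets[OF sets_gamma refl])

text \<open>The covariance form; it may be degenerate, since a nonzero functional can vanish
  \<open>\<gamma>\<close>-almost everywhere.\<close>

definition ip :: "('a \<Rightarrow> real) \<Rightarrow> ('a \<Rightarrow> real) \<Rightarrow> real" where
  "ip l k = (\<integral>x. l x * k x \<partial>\<gamma>)"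

lemma ip_commute: "ip l k = ip k l" by (simp add: ip_def mult.commute)

lemma gaussian_functional:
  assumes l: "l \<in> top_dual"
  shows "integrable \<gamma> (\<lambda>x. l x * l x) \<and> (CLINT x|\<gamma>. iexp (l x)) = complex_of_real (exp (- ip l l / 2))"
proof -
  note [measurable] = top_dual_measurable[OF l]
  have "centered_gaussian_law (distr \<gamma> borel l)"
    using centered_radon_gaussian l by (simp add: centered_radon_gaussian_def)
  then consider "distr \<gamma> borel l = return borel 0"
    | \<sigma> where "\<sigma> > 0" "distr \<gamma> borel l = density lborel (\<lambda>t. ennreal (normal_density 0 \<sigma> t))"
    by (auto simp: centered_gaussian_law_def)
  then show ?thesis
  proof cases
    case 1
    have "AE t in distr \<gamma> borel l. t = 0" unfolding 1 by (simp add: AE_return)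
    then have ae: "AE x in \<gamma>. l x = 0" by (simp add: AE_distr_iff)
    then have "integrable \<gamma> (\<lambda>x. l x * l x) \<longleftrightarrow> integrable \<gamma> (\<lambda>x. 0 :: real)"
      by (intro integrable_cong_AE) auto
    moreover have "ip l l = (\<integral>x. 0 \<partial>\<gamma>)" unfolding ip_def using ae by (intro integral_cong_AE) auto
    moreover have "(CLINT x|\<gamma>. iexp (l x)) = (CLINT x|\<gamma>. 1)" using ae by (intro integral_cong_AE) auto
    ultimately show ?thesis by (simp add: prob_space[simplified])
  next
    case 2
    have "integrable lborel (\<lambda>t. normal_density 0 \<sigma> t * (t - 0)^2)" using 2 by (intro integrable_normal_moment)
    then have "integrable (distr \<gamma> borel l) (\<lambda>t. t * t)"
      unfolding 2 by (subst integrable_density) (auto simp: power2_eq_square)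
    then have int: "integrable \<gamma> (\<lambda>x. l x * l x)" by (simp add: integrable_distr_eq)
    have "ip l l = (\<integral>t. t * t \<partial>distr \<gamma> borel l)" unfolding ip_def by (simp add: integral_distr)
    also have "\<dots> = (\<integral>t. normal_density 0 \<sigma> t * (t - 0)^(2 * 1) \<partial>lborel)"
      unfolding 2 by (subst integral_density) (auto simp: power2_eq_square)
    also have "\<dots> = \<sigma>\<^sup>2" using 2 by (subst integral_normal_moment_even) auto
    finally have ip: "ip l l = \<sigma>\<^sup>2" .
    have d: "distributed \<gamma> lborel l (normal_density 0 \<sigma>)"
    proof -
      have "distr \<gamma> lborel l = distr \<gamma> borel l" by (rule distr_cong) auto
      then show ?thesis unfolding distributed_def by (simp add: 2(2))
    qed
    then have "distributed \<gamma> lborel (\<lambda>x. (l x - 0) / \<sigma>) std_normal_density"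
      using normal_standard_normal_convert[of \<sigma> l 0] 2 by simp
    then have "distr \<gamma> lborel (\<lambda>x. l x / \<sigma>) = gauss1" by (simp add: distributed_def)
    moreover have "distr \<gamma> lborel (\<lambda>x. l x / \<sigma>) = distr \<gamma> borel (\<lambda>x. l x / \<sigma>)" by (rule distr_cong) auto
    ultimately have "distr \<gamma> borel (\<lambda>x. l x / \<sigma>) = gauss1" by simp
    \<comment> \<open>The characteristic function of \<open>l / \<sigma>\<close> at
      \<open>\<sigma>\<close> is the one of \<open>l\<close> at 1.\<close>
    then have "char (distr \<gamma> borel (\<lambda>x. l x / \<sigma>)) \<sigma> = complex_of_real (exp (- \<sigma>\<^sup>2 / 2))"
      using char_std_normal_distribution by simp
    moreover have "char (distr \<gamma> borel (\<lambda>x. l x / \<sigma>)) \<sigma> = (CLINT x|\<gamma>. iexp (l x))"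
      unfolding char_def using 2 by (subst integral_distr) auto
    ultimately show ?thesis using int ip by simp
  qed
qed

lemma integrable_ip[simp, intro]:
  assumes l: "l \<in> top_dual" and k: "k \<in> top_dual"
  shows "integrable \<gamma> (\<lambda>x. l x * k x)"
proof (rule Bochner_Integration.integrable_bound)
  note [measurable] = top_dual_measurable[OF l] top_dual_measurable[OF k]
  show "integrable \<gamma> (\<lambda>x. l x * l x + k x * k x)" using gaussian_functional l k by auto
  show "(\<lambda>x. l x * k x) \<in> borel_measurable \<gamma>" by measurable
  have "norm (a * b) \<le> norm (a * a + b * b)" for a b :: real
  proof -
    have "2 * (\<bar>a\<bar> * \<bar>b\<bar>) \<le> \<bar>a\<bar>\<^sup>2 + \<bar>b\<bar>\<^sup>2" using sum_squares_bound[of "\<bar>a\<bar>" "\<bar>b\<bar>"] by simp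
    then show ?thesis by (simp add: abs_mult power2_eq_square) (smt (verit) mult_nonneg_nonneg abs_ge_zero)
  qed
  then show "AE x in \<gamma>. norm (l x * k x) \<le> norm (l x * l x + k x * k x)" by simp
qed

lemma integrable_top_dual[simp, intro]: "l \<in> top_dual \<Longrightarrow> integrable \<gamma> l"
proof (rule Bochner_Integration.integrable_bound)
  assume l: "l \<in> top_dual"
  show "integrable \<gamma> (\<lambda>x. l x * l x + 1)" using l by auto
  have "\<bar>a\<bar> \<le> \<bar>a * a + 1\<bar>" for a :: real
    using zero_le_power2[of "\<bar>a\<bar> - 1 / 2"] by (simp add: power2_eq_square algebra_simps)
  then show "AE x in \<gamma>. norm (l x) \<le> norm (l x * l x + 1)" by simp
qed (rule top_dual_measurable)

lemma ip_add: "l \<in> top_dual \<Longrightarrow> l' \<in> top_dual \<Longrightarrow> k \<in> top_dual \<Longrightarrow> ip (\<lambda>x. l x + l' x) k = ip l k + ip l' k"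
  unfolding ip_def by (simp add: ring_distribs)

lemma ip_diff: "l \<in> top_dual \<Longrightarrow> l' \<in> top_dual \<Longrightarrow> k \<in> top_dual \<Longrightarrow> ip (\<lambda>x. l x - l' x) k = ip l k - ip l' k"
  unfolding ip_def by (simp add: ring_distribs left_diff_distrib)

lemma ip_mult: "ip (\<lambda>x. c * l x) k = c * ip l k"
  unfolding ip_def by (simp add: mult.assoc)

lemma ip_sum:
  assumes "\<And>i. i \<in> A \<Longrightarrow> l i \<in> top_dual" "k \<in> top_dual"
  shows "ip (\<lambda>x. \<Sum>i\<in>A. l i x) k = (\<Sum>i\<in>A. ip (l i) k)"
  unfolding ip_def using assms by (simp add: sum_distrib_right)

lemma ip_add2: "l \<in> top_dual \<Longrightarrow> l' \<in> top_dual \<Longrightarrow> k \<in> top_dual \<Longrightarrow> ip k (\<lambda>x. l x + l' x) = ip k l + ip k l'"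
  by (simp add: ip_commute[of k] ip_add)

lemma ip_diff2: "l \<in> top_dual \<Longrightarrow> l' \<in> top_dual \<Longrightarrow> k \<in> top_dual \<Longrightarrow> ip k (\<lambda>x. l x - l' x) = ip k l - ip k l'"
  by (simp add: ip_commute[of k] ip_diff)

lemma ip_mult2: "ip k (\<lambda>x. c * l x) = c * ip k l"
  by (simp add: ip_commute[of k] ip_mult)

lemma ip_sum2: "(\<And>i. i \<in> A \<Longrightarrow> l i \<in> top_dual) \<Longrightarrow> k \<in> top_dual \<Longrightarrow> ip k (\<lambda>x. \<Sum>i\<in>A. l i x) = (\<Sum>i\<in>A. ip k (l i))"
  by (simp add: ip_commute[of k] ip_sum)

lemma ip_nonneg: "0 \<le> ip l l"
  unfolding ip_def by (intro Bochner_Integration.integral_nonneg) simp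

lemma ip_eq_0_AE: "l \<in> top_dual \<Longrightarrow> ip l l = 0 \<Longrightarrow> AE x in \<gamma>. l x = 0"
  unfolding ip_def by (subst (asm) integral_nonneg_eq_0_iff_AE) auto

lemma ip_null:
  assumes "l \<in> top_dual" "ip l l = 0" shows "ip k l = 0"
proof -
  have "AE x in \<gamma>. k x * l x = 0" using ip_eq_0_AE[OF assms] by eventually_elim simp
  then show ?thesis unfolding ip_def by (rule integral_eq_zero_AE)
qed

section \<open>Orthonormal functionals and the Gram--Schmidt process\<close>

definition orthon :: "nat \<Rightarrow> (nat \<Rightarrow> 'a \<Rightarrow> real) \<Rightarrow> bool" where
  "orthon d k \<longleftrightarrow> (\<forall>i<d. k i \<in> top_dual) \<and> (\<forall>i<d. \<forall>j<d. ip (k i) (k j) = (if i = j then 1 else 0))"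

lemma orthon_top_dual: "orthon d k \<Longrightarrow> i < d \<Longrightarrow> k i \<in> top_dual"
  and orthon_ip: "orthon d k \<Longrightarrow> i < d \<Longrightarrow> j < d \<Longrightarrow> ip (k i) (k j) = (if i = j then 1 else 0)"
  by (auto simp: orthon_def)

text \<open>Vanishing variance of the residual means that \<open>l\<close> is
  \<open>\<gamma>\<close>-almost everywhere a linear combination of the \<open>k i\<close>; it does
  not make the residual zero as a functional.\<close>

definition residual :: "nat \<Rightarrow> (nat \<Rightarrow> 'a \<Rightarrow> real) \<Rightarrow> ('a \<Rightarrow> real) \<Rightarrow> 'a \<Rightarrow> real" where
  "residual d k l x = l x - (\<Sum>i<d. ip l (k i) * k i x)"

lemma residual_top_dual: "orthon d k \<Longrightarrow> l \<in> top_dual \<Longrightarrow> residual d k l \<in> top_dual"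
  unfolding residual_def[abs_def] by (intro top_dual_diff top_dual_sum top_dual_mult) (auto simp: orthon_top_dual)

lemma ip_orthon_sum:
  assumes "orthon d k" "j < d"
  shows "ip (\<lambda>x. \<Sum>i<d. c i * k i x) (k j) = c j"
proof -
  have "ip (\<lambda>x. \<Sum>i<d. c i * k i x) (k j) = (\<Sum>i<d. c i * ip (k i) (k j))"
    using assms by (subst ip_sum) (auto simp: ip_mult intro: top_dual_mult orthon_top_dual)
  also have "\<dots> = (\<Sum>i<d. if i = j then c i else 0)"
    using assms by (intro sum.cong) (auto simp: orthon_ip)
  finally show ?thesis using assms by simp
qed

lemma ip_orthon_sum_self:
  assumes "orthon d k"
  shows "ip (\<lambda>x. \<Sum>i<d. c i * k i x) (\<lambda>x. \<Sum>i<d. c i * k i x) = (\<Sum>i<d. (c i)\<^sup>2)"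
proof -
  have "(\<lambda>x. \<Sum>i<d. c i * k i x) \<in> top_dual"
    using assms by (intro top_dual_sum top_dual_mult) (auto simp: orthon_top_dual)
  then have "ip (\<lambda>x. \<Sum>i<d. c i * k i x) (\<lambda>x. \<Sum>i<d. c i * k i x) = (\<Sum>i<d. c i * ip (\<lambda>x. \<Sum>i<d. c i * k i x) (k i))"
    using assms by (subst ip_sum2) (auto simp: ip_mult2 intro: top_dual_mult orthon_top_dual)
  then show ?thesis using assms by (simp add: ip_orthon_sum power2_eq_square)
qed

lemma residual_orthogonal:
  assumes "orthon d k" "l \<in> top_dual" "j < d" shows "ip (residual d k l) (k j) = 0"
proof -
  have "(\<lambda>x. \<Sum>i<d. ip l (k i) * k i x) \<in> top_dual"
    using assms by (intro top_dual_sum top_dual_mult) (auto simp: orthon_top_dual)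
  then show ?thesis
    using assms ip_orthon_sum[OF assms(1,3), of "\<lambda>i. ip l (k i)"]
    by (simp add: residual_def[abs_def] ip_diff orthon_top_dual)
qed

lemma ip_residual:
  assumes "orthon d k" "l \<in> top_dual"
  shows "ip (residual d k l) (residual d k l) = ip l l - (\<Sum>i<d. (ip l (k i))\<^sup>2)"
proof -
  have s: "(\<lambda>x. \<Sum>i<d. ip l (k i) * k i x) \<in> top_dual"
    using assms by (intro top_dual_sum top_dual_mult) (auto simp: orthon_top_dual)
  have c: "ip l (\<lambda>x. \<Sum>i<d. ip l (k i) * k i x) = (\<Sum>i<d. (ip l (k i))\<^sup>2)"
    using assms by (subst ip_sum2) (auto simp: ip_mult2 power2_eq_square intro: top_dual_mult orthon_top_dual)
  show ?thesis
    using assms s c trans[OF ip_commute c]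
    by (simp add: residual_def[abs_def] ip_diff ip_diff2 top_dual_diff ip_orthon_sum_self)
qed

text \<open>An element is added only when the residual has positive variance, because
  \<open>ip\<close> may be degenerate; hence the conclusion is about variances. The given initial
  family is kept, so a prescribed first direction survives.\<close>

lemma gram_schmidt:
  assumes L: "finite L" "L \<subseteq> top_dual" and k0: "orthon d0 k0"
  shows "\<exists>d k. d0 \<le> d \<and> orthon d k \<and> (\<forall>i<d0. k i = k0 i) \<and> (\<forall>l\<in>L. ip (residual d k l) (residual d k l) = 0)"
  using L
proof (induction L rule: finite_induct)
  case empty
  show ?case by (intro exI[of _ d0] exI[of _ k0]) (use k0 in auto)
next
  case (insert l L)
  then obtain d k where dk: "d0 \<le> d" "orthon d k" "\<forall>i<d0. k i = k0 i"
    and res: "\<And>l. l \<in> L \<Longrightarrow> ip (residual d k l) (residual d k l) = 0" by auto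
  have l: "l \<in> top_dual" using insert by simp
  define r where "r = residual d k l"
  have r: "r \<in> top_dual" unfolding r_def by (rule residual_top_dual[OF dk(2) l])
  show ?case
  proof (cases "ip r r = 0")
    case True
    then show ?thesis by (intro exI[of _ d] exI[of _ k]) (use dk res in \<open>auto simp: r_def\<close>)
  next
    case False
    then have pos: "ip r r > 0" using ip_nonneg[of r] by simp
    define k' where "k' = k(d := (\<lambda>x. 1 / sqrt (ip r r) * r x))"
    have k'_eq: "k' i = k0 i" if "i < d0" for i using that dk by (simp add: k'_def)
    have kd: "k' d \<in> top_dual" unfolding k'_def using r by (simp add: top_dual_mult del: times_divide_eq_left)
    have o: "orthon (Suc d) k'"
      unfolding orthon_def
    proof (intro conjI allI impI)
      show "k' i \<in> top_dual" if "i < Suc d" for i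
        using that kd dk(2) by (cases "i = d") (auto simp: k'_def orthon_top_dual)
      show "ip (k' i) (k' j) = (if i = j then 1 else 0)" if ij: "i < Suc d" "j < Suc d" for i j
      proof -
        have 1: "ip r (k j) = 0" if "j < d" for j
          unfolding r_def by (rule residual_orthogonal[OF dk(2) l that])
        have 2: "ip (\<lambda>x. 1 / sqrt (ip r r) * r x) (\<lambda>x. 1 / sqrt (ip r r) * r x) = 1"
          unfolding ip_mult ip_mult2 using pos by (simp add: field_simps)
        have 3: "ip (\<lambda>x. 1 / sqrt (ip r r) * r x) (k j) = 0" "ip (k j) (\<lambda>x. 1 / sqrt (ip r r) * r x) = 0" if "j < d" for j
          using 1[OF that] by (simp_all only: ip_mult ip_mult2 ip_commute[of "k j" r])
        consider "i < d" "j < d" | "i = d" "j < d" | "i < d" "j = d" | "i = d" "j = d"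
          using ij by linarith
        then show ?thesis
          by cases (use dk(2) 2 3 in \<open>auto simp: k'_def orthon_ip simp del: times_divide_eq_left\<close>)
      qed
    qed
    \<comment> \<open>A further orthonormal element can only lower a residual variance, so
      functionals already exhausted stay exhausted.\<close>
    have dec: "ip (residual (Suc d) k' m) (residual (Suc d) k' m) = ip (residual d k m) (residual d k m) - (ip m (k' d))\<^sup>2"
      if "m \<in> top_dual" for m
      using ip_residual[OF o that] ip_residual[OF dk(2) that] by (simp add: k'_def)
    have "ip (residual (Suc d) k' m) (residual (Suc d) k' m) = 0" if "m \<in> insert l L" for m
    proof (cases "m = l")
      case True
      have m: "(\<lambda>x. ip l (k i) * k i x) \<in> top_dual" if "i < d" for i
        by (intro top_dual_mult orthon_top_dual[OF dk(2) that])
      have s: "(\<lambda>x. \<Sum>i<d. ip l (k i) * k i x) \<in> top_dual" by (intro top_dual_sum m) simp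
      \<comment> \<open>The residual \<open>r\<close> is orthogonal to the projection of
        \<open>l\<close>, so \<open>ip l r = ip r r\<close>, and the normalized \<open>r\<close>
        removes exactly the variance that was left.\<close>
      have "ip r (\<lambda>x. \<Sum>i<d. ip l (k i) * k i x) = (\<Sum>i<d. ip r (\<lambda>x. ip l (k i) * k i x))"
        by (intro ip_sum2 m r) simp
      also have "\<dots> = 0"
        using residual_orthogonal[OF dk(2) l] by (intro sum.neutral ballI) (simp add: ip_mult2 r_def)
      finally have "ip r (residual d k l) = ip r l"
        unfolding residual_def[abs_def] using ip_diff2[OF l s r] by simp
      then have "ip l r = ip r r" by (metis r_def ip_commute)
      then have "ip l (k' d) = 1 / sqrt (ip r r) * ip r r"
        by (simp only: k'_def fun_upd_same ip_mult2)
      then have "ip l (k' d) = sqrt (ip r r)" using pos by (simp add: real_div_sqrt)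
      then have "(ip l (k' d))\<^sup>2 = ip r r" using pos by simp
      then show ?thesis using dec[OF l] True by (simp add: r_def)
    next
      case False
      then have m: "m \<in> L" "m \<in> top_dual" using that insert by auto
      show ?thesis using dec[OF m(2)] res[OF m(1)] ip_nonneg[of "residual (Suc d) k' m"] by simp
    qed
    then show ?thesis
      by (intro exI[of _ "Suc d"] exI[of _ k']) (use dk o k'_eq in auto)
  qed
qed

text \<open>No joint normality is assumed: a linear combination of functionals is again a
  functional, hence Gaussian with variance the sum of squares, and this determines the joint
  characteristic function.\<close>

lemma orthon_law:
  assumes "orthon d k"
  shows "distr \<gamma> (PiM {..<d} (\<lambda>_. borel)) (tuple_map d k) = std_gauss d"
proof (rule PiM_char_unique)
  note [measurable] = tuple_map_measurable[OF top_dual_measurable[OF orthon_top_dual[OF assms]]]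
  show "finite_measure (distr \<gamma> (PiM {..<d} (\<lambda>_. borel)) (tuple_map d k))"
    by (intro prob_space.finite_measure prob_space_distr) measurable
  show "finite_measure (std_gauss d)" by (intro prob_space.finite_measure prob_space_std_gauss)
  fix t :: "nat \<Rightarrow> real"
  have s: "(\<lambda>x. \<Sum>i<d. t i * k i x) \<in> top_dual"
    using assms by (intro top_dual_sum top_dual_mult) (auto simp: orthon_top_dual)
  have "(CLINT x|distr \<gamma> (PiM {..<d} (\<lambda>_. borel)) (tuple_map d k). iexp (\<Sum>i<d. t i * x i))
      = (CLINT x|\<gamma>. iexp (\<Sum>i<d. t i * tuple_map d k x i))"
    by (rule integral_distr) measurable
  also have "\<dots> = (CLINT x|\<gamma>. iexp (\<Sum>i<d. t i * k i x))"
    by (intro Bochner_Integration.integral_cong refl arg_cong[where f = iexp] sum.cong) (simp add: tuple_map_def)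
  also have "\<dots> = (CLINT x|std_gauss d. iexp (\<Sum>i<d. t i * x i))"
    using gaussian_functional[OF s] by (simp only: ip_orthon_sum_self[OF assms] char_std_gauss)
  finally show "(CLINT x|distr \<gamma> (PiM {..<d} (\<lambda>_. borel)) (tuple_map d k). iexp (\<Sum>i<d. t i * x i))
      = (CLINT x|std_gauss d. iexp (\<Sum>i<d. t i * x i))" .
qed simp_all

end


section \<open>The Cameron--Martin space\<close>

lemma measurable_shift0:
  fixes s :: real and d :: nat
  assumes "1 \<le> d"
  shows "(\<lambda>z. z(0 := z 0 - s)) \<in> measurable (PiM {..<d} (\<lambda>_. borel :: real measure)) (PiM {..<d} (\<lambda>_. borel :: real measure))"
proof -
  have "(\<lambda>z. \<lambda>i\<in>{..<d}. if i = 0 then z i - s else z i) \<in> measurable (PiM {..<d} (\<lambda>_. borel :: real measure)) (PiM {..<d} (\<lambda>_. borel :: real measure))"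
    by (rule measurable_restrict) (auto intro!: measurable_If borel_measurable_diff)
  moreover have "(\<lambda>i\<in>{..<d}. if i = 0 then z i - s else z i) = z(0 := z 0 - s)" if "z \<in> space (PiM {..<d} (\<lambda>_. borel :: real measure))" for z :: "nat \<Rightarrow> real"
    using that assms by (auto simp: space_PiM PiE_iff extensional_def restrict_def fun_eq_iff)
  ultimately show ?thesis by (subst (asm) measurable_cong) auto
qed

text \<open>The Cameron--Martin formula for one coordinate: the ratio of the shifted to the original
  density is the exponential, and Fubini isolates coordinate 0.\<close>

lemma std_gauss_shift:
  assumes d: "1 \<le> d" and F[measurable]: "F \<in> borel_measurable (PiM {..<d} (\<lambda>_. borel))"
  shows "(\<integral>\<^sup>+z. F (z(0 := z 0 - s)) \<partial>std_gauss d) = (\<integral>\<^sup>+z. F z * ennreal (exp (- s * z 0 - s\<^sup>2 / 2)) \<partial>std_gauss d)"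
proof -
  interpret product_prob_space "\<lambda>_::nat. gauss1" by (rule product_prob_space_gauss1)
  have ins: "{..<d} = insert 0 {Suc 0..<d}" using d by auto
  have sets_ins: "sets (PiM {..<d} (\<lambda>_. gauss1)) = sets (PiM {..<d} (\<lambda>_. borel))" by (intro sets_PiM_cong) auto
  have [measurable]: "F \<in> borel_measurable (PiM {..<d} (\<lambda>_. gauss1))"
    by (simp add: measurable_cong_sets[OF sets_ins refl])
  have "(\<lambda>z. F (z(0 := z 0 - s))) \<in> borel_measurable (PiM {..<d} (\<lambda>_. borel))"
    by (rule measurable_compose[OF measurable_shift0[OF d] F])
  then have [measurable]: "(\<lambda>z. F (z(0 := z 0 - s))) \<in> borel_measurable (PiM {..<d} (\<lambda>_. gauss1))"
    by (simp add: measurable_cong_sets[OF sets_ins refl])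
  have one: "(\<integral>\<^sup>+y. f (y - s) \<partial>gauss1) = (\<integral>\<^sup>+y. f y * ennreal (exp (- s * y - s\<^sup>2 / 2)) \<partial>gauss1)"
    if [measurable]: "f \<in> borel_measurable borel" for f
  proof -
    have dens: "std_normal_density (s + y) = std_normal_density y * exp (- s * y - s\<^sup>2 / 2)" for y
      by (simp add: std_normal_density_def mult_exp_exp power2_eq_square algebra_simps add_divide_distrib diff_divide_distrib)
    have "(\<integral>\<^sup>+y. f (y - s) \<partial>gauss1) = (\<integral>\<^sup>+y. ennreal (std_normal_density y) * f (y - s) \<partial>lborel)"
      by (subst nn_integral_density) auto
    also have "\<dots> = (\<integral>\<^sup>+y. ennreal (std_normal_density (s + y)) * f y \<partial>lborel)"
      by (subst nn_integral_real_affine[where c = 1 and t = s]) auto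
    also have "\<dots> = (\<integral>\<^sup>+y. ennreal (std_normal_density y) * (f y * ennreal (exp (- s * y - s\<^sup>2 / 2))) \<partial>lborel)"
      unfolding dens by (simp add: ennreal_mult mult_ac)
    also have "\<dots> = (\<integral>\<^sup>+y. f y * ennreal (exp (- s * y - s\<^sup>2 / 2)) \<partial>gauss1)"
      by (subst nn_integral_density) auto
    finally show ?thesis .
  qed
  have "(\<integral>\<^sup>+z. F (z(0 := z 0 - s)) \<partial>std_gauss d) = (\<integral>\<^sup>+x. \<integral>\<^sup>+y. F (x(0 := y - s)) \<partial>gauss1 \<partial>PiM {Suc 0..<d} (\<lambda>_. gauss1))"
    unfolding std_gauss_def ins by (subst product_nn_integral_insert) (auto simp flip: ins)
  also have "\<dots> = (\<integral>\<^sup>+x. \<integral>\<^sup>+y. F (x(0 := y)) * ennreal (exp (- s * y - s\<^sup>2 / 2)) \<partial>gauss1 \<partial>PiM {Suc 0..<d} (\<lambda>_. gauss1))"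
  proof (rule nn_integral_cong)
    fix x assume x: "x \<in> space (PiM {Suc 0..<d} (\<lambda>_. gauss1))"
    have "(\<lambda>y. x(0 := y)) \<in> measurable borel (PiM {..<d} (\<lambda>_. borel))"
    proof (rule measurable_PiM_single')
      show "(\<lambda>y. (x(0 := y)) i) \<in> measurable borel borel" if "i \<in> {..<d}" for i
        by (cases "i = 0") auto
    qed (use x d in \<open>auto simp: space_PiM PiE_iff extensional_def\<close>)
    then have "(\<lambda>y. F (x(0 := y))) \<in> borel_measurable borel" by measurable
    then show "(\<integral>\<^sup>+y. F (x(0 := y - s)) \<partial>gauss1) = (\<integral>\<^sup>+y. F (x(0 := y)) * ennreal (exp (- s * y - s\<^sup>2 / 2)) \<partial>gauss1)"
      by (rule one[of "\<lambda>y. F (x(0 := y))"])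
  qed
  also have "\<dots> = (\<integral>\<^sup>+z. F z * ennreal (exp (- s * z 0 - s\<^sup>2 / 2)) \<partial>std_gauss d)"
    unfolding std_gauss_def ins by (subst product_nn_integral_insert) (use d in \<open>auto simp flip: ins\<close>)
  finally show ?thesis .
qed

context radon_gaussian begin

text \<open>By \<open>exp u \<ge> 1 + u\<close> the mass lost under the shift is at most
  \<open>1/8\<close> times the first absolute moment, which is at most 1, plus \<open>1/128\<close>;
  the length \<open>1/8\<close> keeps this below \<open>1/4\<close>.\<close>

lemma orthon_shift:
  assumes o: "orthon d k" and d: "1 \<le> d" and B[measurable]: "B \<in> sets (PiM {..<d} (\<lambda>_. borel))"
  shows "measure \<gamma> {x. tuple_map d k x \<in> B} - 1 / 4 \<le> measure \<gamma> {x. (tuple_map d k x)(0 := tuple_map d k x 0 - 1 / 8) \<in> B}"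
proof -
  let ?P = "tuple_map d k" and ?U = "\<lambda>z::nat \<Rightarrow> real. z(0 := z 0 - 1 / 8)"
  have P[measurable]: "?P \<in> measurable \<gamma> (PiM {..<d} (\<lambda>_. borel))"
    by (rule tuple_map_measurable) (auto intro: top_dual_measurable orthon_top_dual[OF o])
  have k0: "k 0 \<in> top_dual" by (rule orthon_top_dual[OF o]) (use d in simp)
  note [measurable] = top_dual_measurable[OF k0]
  have P0: "?P x 0 = k 0 x" for x using d by (simp add: tuple_map_def)
  note U[measurable] = measurable_shift0[OF d, of "1 / 8"]
  let ?r = "\<lambda>x. exp (- (1 / 8) * k 0 x - (1 / 8)\<^sup>2 / 2)"
  have ms[measurable]: "{x. ?P x \<in> B} \<in> sets \<gamma>" "{x. ?U (?P x) \<in> B} \<in> sets \<gamma>"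
    using measurable_sets[OF P B] measurable_sets[OF measurable_compose[OF P U] B] by (auto simp: vimage_def)
  have "emeasure \<gamma> {x. ?U (?P x) \<in> B} = (\<integral>\<^sup>+x. indicator B (?U (?P x)) \<partial>\<gamma>)"
    unfolding nn_integral_indicator[OF ms(2), symmetric] by (intro nn_integral_cong) (simp add: indicator_def)
  also have "\<dots> = (\<integral>\<^sup>+z. indicator B (?U z) \<partial>std_gauss d)"
    by (subst orthon_law[OF o, symmetric], subst nn_integral_distr) auto
  also have "\<dots> = (\<integral>\<^sup>+z. indicator B z * ennreal (exp (- (1 / 8) * z 0 - (1 / 8)\<^sup>2 / 2)) \<partial>std_gauss d)"
    by (rule std_gauss_shift[OF d]) measurable
  also have "\<dots> = (\<integral>\<^sup>+x. indicator B (?P x) * ennreal (exp (- (1 / 8) * ?P x 0 - (1 / 8)\<^sup>2 / 2)) \<partial>\<gamma>)"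
    using d by (subst orthon_law[OF o, symmetric], subst nn_integral_distr) auto
  finally have e: "emeasure \<gamma> {x. ?U (?P x) \<in> B} = (\<integral>\<^sup>+x. indicator B (?P x) * ennreal (?r x) \<partial>\<gamma>)"
    by (simp only: P0)
  have i0: "integrable \<gamma> (\<lambda>x. indicator {x. ?P x \<in> B} x - (1 / 8 * \<bar>k 0 x\<bar> + 1 / 128))"
    using k0 ms by (intro Bochner_Integration.integrable_diff Bochner_Integration.integrable_add integrable_mult_right integrable_real_indicator)
      (auto simp: emeasure_eq_measure)
  have low: "indicator {x. ?P x \<in> B} x - (1 / 8 * \<bar>k 0 x\<bar> + 1 / 128) \<le> indicator {x. ?P x \<in> B} x * ?r x" for x
  proof -
    have "1 + (- (1 / 8) * k 0 x - (1 / 8)\<^sup>2 / 2) \<le> ?r x" by (rule exp_ge_add_one_self)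
    then show ?thesis by (auto simp: indicator_def power2_eq_square abs_if split: if_splits)
  qed
  have e1: "(\<integral>x. \<bar>k 0 x\<bar> \<partial>\<gamma>) \<le> 1"
  proof -
    have "(\<integral>x. \<bar>k 0 x\<bar> \<partial>\<gamma>) \<le> (\<integral>x. (1 + k 0 x * k 0 x) / 2 \<partial>\<gamma>)"
    proof (rule integral_mono)
      show "\<bar>k 0 x\<bar> \<le> (1 + k 0 x * k 0 x) / 2" for x
        using zero_le_power2[of "\<bar>k 0 x\<bar> - 1"] by (simp add: power2_eq_square algebra_simps)
    qed (use k0 in auto)
    also have "\<dots> = (1 + ip (k 0) (k 0)) / 2"
      using k0 by (simp add: ip_def prob_space[simplified])
    also have "\<dots> = 1" using orthon_ip[OF o, of 0 0] d by simp
    finally show ?thesis .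
  qed
  have "measure \<gamma> {x. ?P x \<in> B} - (1 / 8 * (\<integral>x. \<bar>k 0 x\<bar> \<partial>\<gamma>) + 1 / 128)
      = (\<integral>x. indicator {x. ?P x \<in> B} x - (1 / 8 * \<bar>k 0 x\<bar> + 1 / 128) \<partial>\<gamma>)"
    using k0 ms by (subst Bochner_Integration.integral_diff) (auto simp: prob_space[simplified] emeasure_eq_measure)
  also have "\<dots> \<le> measure \<gamma> {x. ?U (?P x) \<in> B}"
  proof -
    have fin: "(\<integral>\<^sup>+x. ennreal (indicator {x. ?P x \<in> B} x * ?r x) \<partial>\<gamma>) = emeasure \<gamma> {x. ?U (?P x) \<in> B}"
      unfolding e by (intro nn_integral_cong) (auto simp: indicator_def)
    have int: "integrable \<gamma> (\<lambda>x. indicator {x. ?P x \<in> B} x * ?r x)"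
    proof (rule integrableI_nonneg)
      show "(\<integral>\<^sup>+x. ennreal (indicator {x. ?P x \<in> B} x * ?r x) \<partial>\<gamma>) < \<infinity>"
        unfolding fin by (simp add: emeasure_eq_measure)
    qed auto
    have "(\<integral>x. indicator {x. ?P x \<in> B} x - (1 / 8 * \<bar>k 0 x\<bar> + 1 / 128) \<partial>\<gamma>) \<le> (\<integral>x. indicator {x. ?P x \<in> B} x * ?r x \<partial>\<gamma>)"
      by (rule integral_mono) (use i0 int low in auto)
    also have "\<dots> = measure \<gamma> {x. ?U (?P x) \<in> B}"
    proof -
      have "(\<integral>x. indicator {x. ?P x \<in> B} x * ?r x \<partial>\<gamma>) = enn2real (\<integral>\<^sup>+x. ennreal (indicator {x. ?P x \<in> B} x * ?r x) \<partial>\<gamma>)"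
        by (rule integral_eq_nn_integral) auto
      then show ?thesis unfolding fin measure_def .
    qed
    finally show ?thesis .
  qed
  finally show ?thesis using e1 by simp
qed

text \<open>The vector representing \<open>k \<mapsto> ip k l\<close> lies in \<open>X\<close> itself, although \<open>X\<close> need not be complete:
  a compact set of large measure must meet its small shift along that vector.\<close>

lemma cm_vector_unit:
  assumes k0: "k0 \<in> top_dual" "ip k0 k0 = 1"
  shows "\<exists>h. \<forall>l\<in>top_dual. l h = 1 / 8 * ip l k0"
proof -
  \<comment> \<open>Mass above \<open>3/4\<close> leaves more than \<open>1/2\<close> after the loss
    of \<open>1/4\<close> under the shift, so the two masses add up to more than 1.\<close>
  obtain S where S: "compact S" "measure \<gamma> (UNIV - S) < 1 / 4"
    using radon_gamma unfolding radon_prob_def by (metis sets.top space_borel zero_less_divide_iff zero_less_numeral zero_less_one)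
  have Sb: "S \<in> sets \<gamma>" using S(1) by (simp add: borel_closed compact_imp_closed)
  have mS: "measure \<gamma> S > 3 / 4" using S(2) prob_compl[OF Sb] by simp
  \<comment> \<open>Pairs of points whose difference has the prescribed value under
    \<open>l\<close>. These sets are closed, so compactness of \<open>S \<times> S\<close> reduces
    the claim to finitely many functionals.\<close>
  define F where "F l = {p :: 'a \<times> 'a. l (snd p) - l (fst p) = 1 / 8 * ip l k0}" for l
  have fin: "(S \<times> S) \<inter> (\<Inter>l\<in>L. F l) \<noteq> {}" if L: "finite L" "L \<subseteq> top_dual" for L
  proof -
    have "orthon 1 (\<lambda>_. k0)" using k0 by (simp add: orthon_def)
    then obtain d k where dk: "1 \<le> d" "orthon d k" "k 0 = k0"
        and res: "\<And>l. l \<in> L \<Longrightarrow> ip (residual d k l) (residual d k l) = 0"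
      using gram_schmidt[OF L, of 1 "\<lambda>_. k0"] by force
    have ae: "AE x in \<gamma>. \<forall>l\<in>L. residual d k l x = 0"
      using L by (intro AE_finite_allI) (auto intro!: ip_eq_0_AE residual_top_dual dk res)
    obtain n :: nat and m where m: "L = m ` {i. i < n}" using finite_imp_nat_seg_image_inj_on[OF L(1)] by blast
    then have mL: "m j \<in> L" "m j \<in> top_dual" if "j < n" for j using that L(2) by auto
    \<comment> \<open>The image of \<open>S\<close> under the finitely many functionals, padded by
      zeros to a compact set in \<open>nat \<Rightarrow> real\<close>; \<open>A\<close> computes the
      same values from the orthonormal coordinates, almost everywhere.\<close>
    define K where "K = (\<lambda>y j. if j < n then m j y else 0) ` S"
    define A where "A z j = (if j < n then \<Sum>i<d. ip (m j) (k i) * z i else 0)" for z :: "nat \<Rightarrow> real" and j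
    have "compact K" unfolding K_def
    proof (rule compact_continuous_image[OF _ S(1)], rule continuous_on_coordinatewise_then_product)
      show "continuous_on S (\<lambda>y. if j < n then m j y else 0)" for j
        using continuous_on_subset[OF top_dual_continuous[OF mL(2)], of j S] by (cases "j < n") auto
    qed
    then have Kb: "K \<in> sets borel" by (intro borel_closed compact_imp_closed)
    have "continuous_on UNIV A" unfolding A_def
    proof (rule continuous_on_coordinatewise_then_product)
      show "continuous_on UNIV (\<lambda>z. if j < n then \<Sum>i<d. ip (m j) (k i) * z i else 0)" for j
        by (cases "j < n") (auto intro!: continuous_intros continuous_on_product_coordinates)
    qed
    then have Am: "A \<in> borel_measurable (PiM {..<d} (\<lambda>_. borel))" by (rule continuous_on_tuple_borel)
    define T where "T = A -` K \<inter> space (PiM {..<d} (\<lambda>_. borel))"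
    have T: "T \<in> sets (PiM {..<d} (\<lambda>_. borel))" unfolding T_def by (rule measurable_sets[OF Am Kb])
    let ?P = "tuple_map d k" and ?U = "\<lambda>z::nat \<Rightarrow> real. z(0 := z 0 - 1 / 8)"
    have P: "?P \<in> measurable \<gamma> (PiM {..<d} (\<lambda>_. borel))"
      by (rule tuple_map_measurable) (auto intro: top_dual_measurable orthon_top_dual[OF dk(2)])
    have PT: "{x. ?P x \<in> T} \<in> sets \<gamma>" using measurable_sets[OF P T] by (simp add: vimage_def)
    have "measure \<gamma> S \<le> measure \<gamma> {x. ?P x \<in> T}"
    proof (rule finite_measure_mono_AE[OF _ PT])
      show "AE x in \<gamma>. x \<in> S \<longrightarrow> x \<in> {x. ?P x \<in> T}"
        using ae
      proof eventually_elim
        case (elim x)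
        have "A (?P x) = (\<lambda>j. if j < n then m j x else 0)"
          using elim mL(1) by (auto simp: A_def fun_eq_iff residual_def tuple_map_def)
        then show ?case by (auto simp: T_def K_def space_PiM tuple_map_def)
      qed
    qed
    with orthon_shift[OF dk(2,1) T] mS have gt: "measure \<gamma> {x. ?P x \<in> T} + measure \<gamma> {x. ?U (?P x) \<in> T} > 1"
      by linarith
    \<comment> \<open>Two events of total probability above 1 meet; a common point gives two points
      of \<open>S\<close> that differ, under the functionals of \<open>L\<close>, by the
      shift.\<close>
    have "\<exists>x. ?P x \<in> T \<and> ?U (?P x) \<in> T"
    proof (rule ccontr)
      assume "\<not> ?thesis"
      then have "{x. ?U (?P x) \<in> T} \<subseteq> space \<gamma> - {x. ?P x \<in> T}" by auto
      then have "measure \<gamma> {x. ?U (?P x) \<in> T} \<le> measure \<gamma> (space \<gamma> - {x. ?P x \<in> T})"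
        by (rule finite_measure_mono) (use PT in auto)
      with gt prob_compl[OF PT] show False by simp
    qed
    then obtain x where "?P x \<in> T" "?U (?P x) \<in> T" by blast
    then obtain y y' where y: "y \<in> S" "A (?P x) = (\<lambda>j. if j < n then m j y else 0)"
        and y': "y' \<in> S" "A (?U (?P x)) = (\<lambda>j. if j < n then m j y' else 0)"
      unfolding T_def K_def by auto
    have "(y', y) \<in> F l" if "l \<in> L" for l
    proof -
      obtain j where l: "l = m j" "j < n" using \<open>l \<in> L\<close> m by auto
      have "l y = (\<Sum>i<d. ip l (k i) * ?P x i)" "l y' = (\<Sum>i<d. ip l (k i) * ?U (?P x) i)"
        using fun_cong[OF y(2), of j] fun_cong[OF y'(2), of j] l by (auto simp: A_def)
      then have "l y - l y' = (\<Sum>i<d. ip l (k i) * ?P x i - ip l (k i) * ?U (?P x) i)"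
        by (simp add: sum_subtractf)
      also have "\<dots> = (\<Sum>i<d. if i = 0 then ip l (k i) * (1 / 8) else 0)"
        by (intro sum.cong) (auto simp: algebra_simps)
      also have "\<dots> = 1 / 8 * ip l k0" using dk by (simp add: sum.delta)
      finally show ?thesis by (simp add: F_def)
    qed
    then show ?thesis using y y' by blast
  qed
  have cl: "closed (F l)" if "l \<in> top_dual" for l
    unfolding F_def by (intro closed_Collect_eq continuous_intros continuous_on_compose2[OF top_dual_continuous[OF that]]) auto
  have "(S \<times> S) \<inter> \<Inter>(F ` top_dual) \<noteq> {}"
  proof (rule compact_imp_fip)
    show "compact (S \<times> S)" by (intro compact_Times S)
    fix B assume "finite B" "B \<subseteq> F ` top_dual"
    then obtain L where "finite L" "L \<subseteq> top_dual" "B = F ` L" by (meson finite_subset_image)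
    then show "(S \<times> S) \<inter> \<Inter>B \<noteq> {}" using fin by auto
  qed (use cl in auto)
  then obtain x y where xy: "\<And>l. l \<in> top_dual \<Longrightarrow> (x, y) \<in> F l" by auto
  show ?thesis
  proof (intro exI ballI)
    fix l :: "'a \<Rightarrow> real" assume l: "l \<in> top_dual"
    then show "l (y - x) = 1 / 8 * ip l k0"
      using xy[OF l] by (simp add: F_def linear_diff[OF top_dual_linear])
  qed
qed

text \<open>Normalizing \<open>l\<close> reduces to unit variance, and the factor 8 undoes the shift
  length \<open>1/8\<close>; a null \<open>l\<close> has covariance 0 with every functional.\<close>

lemma cm_vector_exists:
  assumes l: "l \<in> top_dual"
  shows "\<exists>h. \<forall>k\<in>top_dual. k h = ip k l"
proof (cases "ip l l = 0")
  case True
  then show ?thesis using ip_null[OF l] by (intro exI[of _ 0]) (auto simp: linear_0[OF top_dual_linear])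
next
  case False
  define c where "c = sqrt (ip l l)"
  have c: "c > 0" "c * c = ip l l" using False ip_nonneg[of l] by (auto simp: c_def)
  have "ip (\<lambda>x. 1 / c * l x) (\<lambda>x. 1 / c * l x) = 1"
    unfolding ip_mult ip_mult2 using c False by (simp flip: c(2))
  then obtain h where h: "\<And>k. k \<in> top_dual \<Longrightarrow> k h = 1 / 8 * ip k (\<lambda>x. 1 / c * l x)"
    using cm_vector_unit[OF top_dual_mult[OF l]] by blast
  show ?thesis
    by (intro exI[of _ "(8 * c) *\<^sub>R h"] ballI)
       (use c in \<open>simp only: linear_scale[OF top_dual_linear] h ip_mult2, simp\<close>)
qed

text \<open>The covariance image of \<open>l\<close>, chosen without reference to the
  Cameron--Martin norm. It is unique because \<open>top_dual\<close> separates points, and it turns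
  out to be \<open>cm_riesz \<gamma> l\<close>.\<close>

definition cmv :: "('a \<Rightarrow> real) \<Rightarrow> 'a" where
  "cmv l = (SOME h. \<forall>k\<in>top_dual. k h = ip k l)"

lemma cmv: "l \<in> top_dual \<Longrightarrow> k \<in> top_dual \<Longrightarrow> k (cmv l) = ip k l"
  unfolding cmv_def using someI_ex[OF cm_vector_exists] by blast

section \<open>Norm and inner product\<close>

lemma dual_unit_ball_iff: "l \<in> dual_unit_ball \<gamma> \<longleftrightarrow> l \<in> top_dual \<and> ip l l \<le> 1"
  by (auto simp: dual_unit_ball_def ip_def power2_eq_square)

lemma zero_dual_unit_ball: "(\<lambda>x. 0) \<in> dual_unit_ball \<gamma>"
  using top_dual_zero by (simp add: dual_unit_ball_iff ip_def)

lemma cm_norm_upper: "h \<in> cm_space \<gamma> \<Longrightarrow> l \<in> top_dual \<Longrightarrow> ip l l \<le> 1 \<Longrightarrow> l h \<le> cm_norm \<gamma> h"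
  unfolding cm_norm_def by (rule cSUP_upper) (auto simp: cm_space_def dual_unit_ball_iff)

lemma cm_norm_nonneg: "h \<in> cm_space \<gamma> \<Longrightarrow> 0 \<le> cm_norm \<gamma> h"
  using cm_norm_upper[of h "\<lambda>x. 0"] top_dual_zero by (simp add: ip_def)

lemma cm_norm_bound:
  assumes h: "h \<in> cm_space \<gamma>" and l: "l \<in> top_dual"
  shows "\<bar>l h\<bar> \<le> sqrt (ip l l) * cm_norm \<gamma> h"
proof -
  have *: "l h \<le> sqrt (ip l l) * cm_norm \<gamma> h" if l: "l \<in> top_dual" for l
  proof (cases "ip l l = 0")
    case True
    \<comment> \<open>All multiples of a null functional lie in the unit ball, so its values at
      \<open>h\<close> would be unbounded unless it vanishes there.\<close>
    have le: "t * l h \<le> cm_norm \<gamma> h" for t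
      using cm_norm_upper[OF h top_dual_mult[OF l, of t]] True by (simp add: ip_mult ip_mult2)
    have "l h = 0"
    proof (rule ccontr)
      assume "l h \<noteq> 0"
      then show False using le[of "(cm_norm \<gamma> h + 1) / l h"] by simp
    qed
    then show ?thesis using True by simp
  next
    case False
    define c where "c = sqrt (ip l l)"
    have c: "c > 0" "c * c = ip l l" using False ip_nonneg[of l] by (auto simp: c_def)
    have "ip (\<lambda>x. 1 / c * l x) (\<lambda>x. 1 / c * l x) = 1"
      unfolding ip_mult ip_mult2 using c False by (simp flip: c(2))
    then have "1 / c * l h \<le> cm_norm \<gamma> h" using cm_norm_upper[OF h top_dual_mult[OF l], of "1 / c"] by linarith
    then show ?thesis using c by (simp add: c_def[symmetric] field_simps)
  qed
  show ?thesis
    using *[OF l] *[OF top_dual_mult[OF l, of "-1"]] unfolding ip_mult ip_mult2 by (simp add: abs_le_iff)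
qed

text \<open>The dual norm through its Legendre transform, \<open>|h|\<^sup>2 = sup (2 l h - ip l l)\<close> over all \<open>l\<close>;
  completing the square turns this into the geometry of the Cameron--Martin space.\<close>

lemma cm_norm_legendre_upper:
  assumes h: "h \<in> cm_space \<gamma>" and l: "l \<in> top_dual"
  shows "2 * l h - ip l l \<le> (cm_norm \<gamma> h)\<^sup>2"
proof -
  have "2 * l h \<le> 2 * (sqrt (ip l l) * cm_norm \<gamma> h)" using cm_norm_bound[OF h l] by simp
  also have "\<dots> \<le> (sqrt (ip l l))\<^sup>2 + (cm_norm \<gamma> h)\<^sup>2"
    using sum_squares_bound[of "sqrt (ip l l)" "cm_norm \<gamma> h"] by (simp only: mult.assoc)
  finally show ?thesis using ip_nonneg[of l] by simp
qed

text \<open>For \<open>l\<close> in the unit ball with \<open>l h > 0\<close>, testing with the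
  multiple of \<open>l\<close> by \<open>l h\<close> already yields
  \<open>(l h)\<^sup>2 \<le> C\<close>. Membership of \<open>h\<close> in the space comes out at the
  same time, so it need not be known beforehand.\<close>

lemma cm_norm_legendre_least:
  assumes "\<And>l. l \<in> top_dual \<Longrightarrow> 2 * l h - ip l l \<le> C"
  shows "h \<in> cm_space \<gamma>" "(cm_norm \<gamma> h)\<^sup>2 \<le> C"
proof -
  have C: "0 \<le> C" using assms[OF top_dual_zero] by (simp add: ip_def)
  have le: "l h \<le> sqrt C" if "l \<in> dual_unit_ball \<gamma>" for l
  proof (cases "l h \<le> 0")
    case False
    have l: "l \<in> top_dual" "ip l l \<le> 1" using that by (auto simp: dual_unit_ball_iff)
    have "2 * (l h * l h) - l h * (l h * ip l l) \<le> C"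
      using assms[OF top_dual_mult[OF l(1), of "l h"]] by (simp add: ip_mult ip_mult2)
    moreover have "l h * (l h * ip l l) \<le> l h * (l h * 1)"
      using l False by (intro mult_left_mono) auto
    ultimately have "(l h)\<^sup>2 \<le> C" by (simp add: power2_eq_square)
    then show ?thesis by (simp add: real_le_rsqrt)
  qed (use C in \<open>auto intro: order_trans\<close>)
  show h: "h \<in> cm_space \<gamma>" unfolding cm_space_def using le by (auto intro!: bdd_aboveI2)
  have "cm_norm \<gamma> h \<le> sqrt C" unfolding cm_norm_def
    using zero_dual_unit_ball by (intro cSUP_least le) auto
  then have "(cm_norm \<gamma> h)\<^sup>2 \<le> (sqrt C)\<^sup>2" using cm_norm_nonneg[OF h] by (intro power_mono) auto
  then show "(cm_norm \<gamma> h)\<^sup>2 \<le> C" using C by simp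
qed

text \<open>Replacing the competitor \<open>k\<close> by \<open>k - l\<close> absorbs
  \<open>cmv l\<close> into the quadratic term, and \<open>k + l\<close> does the converse. This
  expansion is available although the norm is not yet known to come from an inner product.\<close>

lemma cm_norm_cmv_add:
  assumes u: "u \<in> cm_space \<gamma>" and l: "l \<in> top_dual"
  shows "cmv l + u \<in> cm_space \<gamma>" "(cm_norm \<gamma> (cmv l + u))\<^sup>2 = ip l l + 2 * l u + (cm_norm \<gamma> u)\<^sup>2"
proof -
  have 1: "2 * k (cmv l + u) - ip k k \<le> ip l l + 2 * l u + (cm_norm \<gamma> u)\<^sup>2" if k: "k \<in> top_dual" for k
    using cm_norm_legendre_upper[OF u top_dual_diff[OF k l]] k l
    by (simp add: linear_add[OF top_dual_linear] cmv ip_diff ip_diff2 top_dual_diff ip_commute[of l k])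
  show h: "cmv l + u \<in> cm_space \<gamma>" by (rule cm_norm_legendre_least(1)[OF 1])
  have "2 * k u - ip k k \<le> (cm_norm \<gamma> (cmv l + u))\<^sup>2 - ip l l - 2 * l u" if k: "k \<in> top_dual" for k
    using cm_norm_legendre_upper[OF h top_dual_add[OF k l]] k l
    by (simp add: linear_add[OF top_dual_linear] cmv ip_add ip_add2 top_dual_add ip_commute[of l k])
  from cm_norm_legendre_least(2)[OF this] cm_norm_legendre_least(2)[OF 1]
  show "(cm_norm \<gamma> (cmv l + u))\<^sup>2 = ip l l + 2 * l u + (cm_norm \<gamma> u)\<^sup>2" by simp
qed

lemma cm_space_zero: "0 \<in> cm_space \<gamma>" and cm_norm_zero: "cm_norm \<gamma> 0 = 0"
proof -
  have "2 * l 0 - ip l l \<le> 0" if "l \<in> top_dual" for l :: "'a \<Rightarrow> real"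
    using that ip_nonneg[of l] by (simp add: linear_0[OF top_dual_linear])
  note cm_norm_legendre_least[OF this]
  then show "0 \<in> cm_space \<gamma>" "cm_norm \<gamma> 0 = 0" by auto
qed

lemma cmv_cm_space: "l \<in> top_dual \<Longrightarrow> cmv l \<in> cm_space \<gamma>"
  using cm_norm_cmv_add(1)[OF cm_space_zero] by simp

lemma cm_scale:
  assumes h: "h \<in> cm_space \<gamma>"
  shows "c *\<^sub>R h \<in> cm_space \<gamma>" "cm_norm \<gamma> (c *\<^sub>R h) = \<bar>c\<bar> * cm_norm \<gamma> h"
proof -
  have *: "c *\<^sub>R h \<in> cm_space \<gamma> \<and> (cm_norm \<gamma> (c *\<^sub>R h))\<^sup>2 \<le> (\<bar>c\<bar> * cm_norm \<gamma> h)\<^sup>2" if h: "h \<in> cm_space \<gamma>" for c h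
  proof -
    have "2 * l (c *\<^sub>R h) - ip l l \<le> (\<bar>c\<bar> * cm_norm \<gamma> h)\<^sup>2" if l: "l \<in> top_dual" for l
    proof -
      have "2 * l (c *\<^sub>R h) \<le> 2 * (sqrt (ip l l) * (\<bar>c\<bar> * cm_norm \<gamma> h))"
        using mult_left_mono[OF cm_norm_bound[OF h l], of "\<bar>c\<bar>"] abs_ge_self[of "c * l h"]
        by (simp add: linear_scale[OF top_dual_linear[OF l]] abs_mult mult_ac)
      also have "\<dots> \<le> (sqrt (ip l l))\<^sup>2 + (\<bar>c\<bar> * cm_norm \<gamma> h)\<^sup>2"
        using sum_squares_bound[of "sqrt (ip l l)" "\<bar>c\<bar> * cm_norm \<gamma> h"] by (simp only: mult.assoc)
      finally show ?thesis using ip_nonneg[of l] by simp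
    qed
    from cm_norm_legendre_least[OF this] show ?thesis by blast
  qed
  show h': "c *\<^sub>R h \<in> cm_space \<gamma>" using *[OF h] by blast
  have "cm_norm \<gamma> (c *\<^sub>R h) \<le> \<bar>c\<bar> * cm_norm \<gamma> h"
    by (rule power2_le_imp_le[OF conjunct2[OF *[OF h]]]) (simp add: cm_norm_nonneg[OF h])
  moreover have "\<bar>c\<bar> * cm_norm \<gamma> h \<le> cm_norm \<gamma> (c *\<^sub>R h)"
  proof (cases "c = 0")
    case False
    have "cm_norm \<gamma> ((1 / c) *\<^sub>R (c *\<^sub>R h)) \<le> \<bar>1 / c\<bar> * cm_norm \<gamma> (c *\<^sub>R h)"
      by (rule power2_le_imp_le[OF conjunct2[OF *[OF h']]]) (simp add: cm_norm_nonneg[OF h'])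
    then show ?thesis using False by (simp add: field_simps abs_mult)
  qed (simp add: cm_norm_zero)
  ultimately show "cm_norm \<gamma> (c *\<^sub>R h) = \<bar>c\<bar> * cm_norm \<gamma> h" by simp
qed

lemma cm_add:
  assumes h: "h \<in> cm_space \<gamma>" and k: "k \<in> cm_space \<gamma>"
  shows "h + k \<in> cm_space \<gamma>" "cm_norm \<gamma> (h + k) \<le> cm_norm \<gamma> h + cm_norm \<gamma> k"
proof -
  have le: "l (h + k) \<le> cm_norm \<gamma> h + cm_norm \<gamma> k" if "l \<in> dual_unit_ball \<gamma>" for l
    using that cm_norm_upper[OF h, of l] cm_norm_upper[OF k, of l]
    by (auto simp: dual_unit_ball_iff linear_add[OF top_dual_linear])
  show "h + k \<in> cm_space \<gamma>" unfolding cm_space_def using le by (auto intro!: bdd_aboveI2)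
  show "cm_norm \<gamma> (h + k) \<le> cm_norm \<gamma> h + cm_norm \<gamma> k"
    unfolding cm_norm_def[of \<gamma> "h + k"] using zero_dual_unit_ball by (intro cSUP_least le) auto
qed

lemma cm_minus: "h \<in> cm_space \<gamma> \<Longrightarrow> - h \<in> cm_space \<gamma>" "h \<in> cm_space \<gamma> \<Longrightarrow> cm_norm \<gamma> (- h) = cm_norm \<gamma> h"
  using cm_scale[of h "-1"] by auto

lemma cm_diff:
  assumes h: "h \<in> cm_space \<gamma>" and k: "k \<in> cm_space \<gamma>"
  shows "h - k \<in> cm_space \<gamma>" "cm_norm \<gamma> (h - k) \<le> cm_norm \<gamma> h + cm_norm \<gamma> k"
  using cm_add[OF h cm_minus(1)[OF k]] cm_minus(2)[OF k] by auto

lemma cm_norm_diff_commute: "h \<in> cm_space \<gamma> \<Longrightarrow> k \<in> cm_space \<gamma> \<Longrightarrow> cm_norm \<gamma> (h - k) = cm_norm \<gamma> (k - h)"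
  using cm_minus(2)[OF cm_diff(1), of h k] by simp

lemma cm_sum: "(\<And>i. i \<in> A \<Longrightarrow> h i \<in> cm_space \<gamma>) \<Longrightarrow> (\<Sum>i\<in>A. h i) \<in> cm_space \<gamma>"
  by (induction A rule: infinite_finite_induct) (auto intro: cm_add cm_space_zero)

lemma cm_norm_cmv_diff:
  assumes u: "u \<in> cm_space \<gamma>" and l: "l \<in> top_dual"
  shows "(cm_norm \<gamma> (u - cmv l))\<^sup>2 = (cm_norm \<gamma> u)\<^sup>2 - 2 * l u + ip l l"
proof -
  have "cm_norm \<gamma> (u - cmv l) = cm_norm \<gamma> (cmv l + - u)"
    using cm_norm_diff_commute[OF u cmv_cm_space[OF l]] by simp
  then show ?thesis
    using cm_norm_cmv_add(2)[OF cm_minus(1)[OF u] l] u l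
    by (simp add: cm_minus(2) linear_neg[OF top_dual_linear])
qed

lemma cm_inner_cmv:
  assumes u: "u \<in> cm_space \<gamma>" and l: "l \<in> top_dual"
  shows "cm_inner \<gamma> (cmv l) u = l u"
  using cm_norm_cmv_add(2)[OF u l] cm_norm_cmv_diff[OF u l] cm_norm_diff_commute[OF u cmv_cm_space[OF l]]
  by (simp add: cm_inner_def)

lemma cm_inner_commute: "h \<in> cm_space \<gamma> \<Longrightarrow> k \<in> cm_space \<gamma> \<Longrightarrow> cm_inner \<gamma> h k = cm_inner \<gamma> k h"
  by (simp add: cm_inner_def add.commute cm_norm_diff_commute)

lemma cm_inner_self: "h \<in> cm_space \<gamma> \<Longrightarrow> cm_inner \<gamma> h h = (cm_norm \<gamma> h)\<^sup>2"
  using cm_scale(2)[of h 2] by (simp add: cm_inner_def cm_norm_zero scaleR_2 power_mult_distrib)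

lemma cm_norm_eq_0:
  assumes h: "h \<in> cm_space \<gamma>" "cm_norm \<gamma> h = 0" shows "h = 0"
  by (rule top_dual_eqI) (use cm_norm_bound[OF h(1)] h(2) in \<open>force simp: linear_0[OF top_dual_linear]\<close>)

lemma cm_riesz_eq:
  assumes l: "l \<in> top_dual" shows "cm_riesz \<gamma> l = cmv l"
  unfolding cm_riesz_def
proof (rule the_equality)
  show "cmv l \<in> cm_space \<gamma> \<and> (\<forall>u\<in>cm_space \<gamma>. l u = cm_inner \<gamma> (cmv l) u)"
    using cmv_cm_space[OF l] cm_inner_cmv l by auto
  fix w assume "w \<in> cm_space \<gamma> \<and> (\<forall>u\<in>cm_space \<gamma>. l u = cm_inner \<gamma> w u)"
  then have w: "w \<in> cm_space \<gamma>" and lu: "\<And>u. u \<in> cm_space \<gamma> \<Longrightarrow> l u = cm_inner \<gamma> w u" by auto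
  \<comment> \<open>Uniqueness: \<open>l w\<close> equals both the squared norm of \<open>w\<close>
    and \<open>ip l l\<close>, so the expanded square of the norm of \<open>w - cmv l\<close> is
    0.\<close>
  have 1: "l w = (cm_norm \<gamma> w)\<^sup>2" by (rule trans[OF lu[OF w] cm_inner_self[OF w]])
  have "ip l l = l (cmv l)" by (rule cmv[OF l l, symmetric])
  also have "\<dots> = cm_inner \<gamma> w (cmv l)" by (rule lu[OF cmv_cm_space[OF l]])
  also have "\<dots> = cm_inner \<gamma> (cmv l) w" by (rule cm_inner_commute[OF w cmv_cm_space[OF l]])
  also have "\<dots> = l w" by (rule cm_inner_cmv[OF w l])
  finally have "(cm_norm \<gamma> (w - cmv l))\<^sup>2 = 0"
    using cm_norm_cmv_diff[OF w l] 1 by linarith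
  then have "w - cmv l = 0" using cmv_cm_space[OF l] w by (intro cm_norm_eq_0) (auto intro: cm_diff)
  then show "w = cmv l" by simp
qed

lemma cm_inner_riesz: "l \<in> top_dual \<Longrightarrow> k \<in> top_dual \<Longrightarrow> cm_inner \<gamma> (cm_riesz \<gamma> l) (cm_riesz \<gamma> k) = ip l k"
  by (simp add: cm_riesz_eq cm_inner_cmv cmv_cm_space cmv)

text \<open>The gap in the Legendre supremum at \<open>l\<close> is exactly the squared norm of
  \<open>h - cmv l\<close>.\<close>

lemma cmv_dense:
  assumes h: "h \<in> cm_space \<gamma>" and e: "0 < e"
  obtains l where "l \<in> top_dual" "cm_norm \<gamma> (h - cmv l) < e"
proof -
  have "\<exists>l\<in>top_dual. (cm_norm \<gamma> h)\<^sup>2 - e\<^sup>2 < 2 * l h - ip l l"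
  proof (rule ccontr)
    assume "\<not> ?thesis"
    then have "2 * l h - ip l l \<le> (cm_norm \<gamma> h)\<^sup>2 - e\<^sup>2" if "l \<in> top_dual" for l
      using that by (meson linorder_not_le)
    from cm_norm_legendre_least(2)[OF this] e show False by simp
  qed
  then obtain l where l: "l \<in> top_dual" "(cm_norm \<gamma> h)\<^sup>2 - e\<^sup>2 < 2 * l h - ip l l" by blast
  then have "(cm_norm \<gamma> (h - cmv l))\<^sup>2 < e\<^sup>2" using cm_norm_cmv_diff[OF h l(1)] by simp
  then have "cm_norm \<gamma> (h - cmv l) < e" by (rule power2_less_imp_less) (use e in simp)
  with l(1) show ?thesis by (rule that)
qed

text \<open>Since \<open>cm_inner\<close> is defined by polarization, its linearity is not evident.
  Near a vector \<open>cmv l\<close>, where it is the linear function \<open>l\<close>, the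
  deviation is controlled by \<open>A^2 - B^2 = (A - B) (A + B)\<close>.\<close>

lemma cm_inner_approx:
  assumes h: "h \<in> cm_space \<gamma>" and w: "w \<in> cm_space \<gamma>" and l: "l \<in> top_dual" and e: "e \<le> 1" "cm_norm \<gamma> (h - cmv l) < e"
  shows "\<bar>cm_inner \<gamma> h w - l w\<bar> \<le> e * (cm_norm \<gamma> h + cm_norm \<gamma> w + 1)"
proof -
  let ?N = "cm_norm \<gamma>" and ?R = "cmv l"
  have R: "?R \<in> cm_space \<gamma>" by (rule cmv_cm_space[OF l])
  have D: "?N (h - ?R) < 1" "0 \<le> ?N (h - ?R)" using e cm_norm_nonneg[OF cm_diff(1)[OF h R]] by auto
  have NR: "?N ?R \<le> ?N h + 1"
    using cm_diff(2)[OF h cm_diff(1)[OF h R]] D by simp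
  have sq: "\<bar>(?N (h + x))\<^sup>2 - (?N (?R + x))\<^sup>2\<bar> \<le> e * (2 * ?N h + 2 * ?N w + 1)" if x: "x \<in> cm_space \<gamma>" "?N x = ?N w" for x
  proof -
    have a: "h + x \<in> cm_space \<gamma>" "?R + x \<in> cm_space \<gamma>" using cm_add h R x by auto
    have "?N (h + x) \<le> ?N (h - ?R) + ?N (?R + x)"
      using cm_add(2)[OF cm_diff(1)[OF h R] a(2)] by simp
    moreover have "?N (?R + x) \<le> ?N (?R - h) + ?N (h + x)"
      using cm_add(2)[OF cm_diff(1)[OF R h] a(1)] by simp
    ultimately have 1: "\<bar>?N (h + x) - ?N (?R + x)\<bar> \<le> e"
      using e(2) cm_norm_diff_commute[OF h R] by linarith
    have 2: "?N (h + x) + ?N (?R + x) \<le> 2 * ?N h + 2 * ?N w + 1" "0 \<le> ?N (h + x) + ?N (?R + x)"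
      using cm_add(2)[OF h x(1)] cm_add(2)[OF R x(1)] NR x(2) cm_norm_nonneg[OF a(1)] cm_norm_nonneg[OF a(2)] by auto
    have "\<bar>(?N (h + x))\<^sup>2 - (?N (?R + x))\<^sup>2\<bar> = \<bar>?N (h + x) - ?N (?R + x)\<bar> * \<bar>?N (h + x) + ?N (?R + x)\<bar>"
      unfolding abs_mult[symmetric] by (simp add: power2_eq_square algebra_simps)
    also have "\<dots> \<le> e * (2 * ?N h + 2 * ?N w + 1)"
      using 1 2 by (intro mult_mono) auto
    finally show ?thesis .
  qed
  have aux: "\<bar>(A - B) / 4\<bar> \<le> (D + D) / 4" if "\<bar>A\<bar> \<le> D" "\<bar>B\<bar> \<le> D" for A B D :: real
    using that abs_triangle_ineq4[of A B] by simp
  have "cm_inner \<gamma> h w - cm_inner \<gamma> ?R w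
      = (((?N (h + w))\<^sup>2 - (?N (?R + w))\<^sup>2) - ((?N (h + - w))\<^sup>2 - (?N (?R + - w))\<^sup>2)) / 4"
    by (simp add: cm_inner_def diff_divide_distrib)
  then have e0: "cm_inner \<gamma> h w - l w
      = (((?N (h + w))\<^sup>2 - (?N (?R + w))\<^sup>2) - ((?N (h + - w))\<^sup>2 - (?N (?R + - w))\<^sup>2)) / 4"
    by (simp only: cm_inner_cmv[OF w l])
  have "\<bar>cm_inner \<gamma> h w - l w\<bar> \<le> (e * (2 * ?N h + 2 * ?N w + 1) + e * (2 * ?N h + 2 * ?N w + 1)) / 4"
    unfolding e0 by (rule aux[OF sq[OF w refl] sq[OF cm_minus(1)[OF w] cm_minus(2)[OF w]]])
  also have "\<dots> \<le> e * (?N h + ?N w + 1)"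
    using e(2) D(2) by (simp add: algebra_simps)
  finally show ?thesis .
qed

lemma cm_inner_linear2:
  assumes h: "h \<in> cm_space \<gamma>" and w: "w1 \<in> cm_space \<gamma>" "w2 \<in> cm_space \<gamma>"
  shows "cm_inner \<gamma> h (a *\<^sub>R w1 + b *\<^sub>R w2) = a * cm_inner \<gamma> h w1 + b * cm_inner \<gamma> h w2"
proof -
  let ?N = "cm_norm \<gamma>" and ?w = "a *\<^sub>R w1 + b *\<^sub>R w2"
  define C where "C = (?N h + ?N ?w + 1) + \<bar>a\<bar> * (?N h + ?N w1 + 1) + \<bar>b\<bar> * (?N h + ?N w2 + 1)"
  have W: "?w \<in> cm_space \<gamma>" using w by (intro cm_add cm_scale)
  have "0 \<le> \<bar>a\<bar> * (?N h + ?N w1 + 1)" "0 \<le> \<bar>b\<bar> * (?N h + ?N w2 + 1)"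
    using cm_norm_nonneg[OF h] cm_norm_nonneg[OF w(1)] cm_norm_nonneg[OF w(2)] by (auto intro!: mult_nonneg_nonneg)
  then have C: "C > 0" unfolding C_def using cm_norm_nonneg[OF h] cm_norm_nonneg[OF W] by linarith
  have "\<bar>cm_inner \<gamma> h ?w - (a * cm_inner \<gamma> h w1 + b * cm_inner \<gamma> h w2)\<bar> \<le> 0 + \<epsilon>" if "\<epsilon> > 0" for \<epsilon>
  proof -
    \<comment> \<open>\<open>C\<close> gathers the three approximation errors, so that
      \<open>e * C\<close> bounds the defect of linearity.\<close>
    define e where "e = min 1 (\<epsilon> / C)"
    have e: "0 < e" "e \<le> 1" "e * C \<le> \<epsilon>" using that C by (auto simp: e_def min_def field_simps)
    obtain l where l: "l \<in> top_dual" "?N (h - cmv l) < e" using cmv_dense[OF h e(1)] by blast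
    note A = cm_inner_approx[OF h _ l(1) e(2) l(2)]
    have "l ?w = a * l w1 + b * l w2" using top_dual_linear[OF l(1)] by (simp add: linear_add linear_scale)
    then have "cm_inner \<gamma> h ?w - (a * cm_inner \<gamma> h w1 + b * cm_inner \<gamma> h w2)
       = (cm_inner \<gamma> h ?w - l ?w) - a * (cm_inner \<gamma> h w1 - l w1) - b * (cm_inner \<gamma> h w2 - l w2)"
      by (simp add: algebra_simps)
    also have "\<bar>\<dots>\<bar> \<le> \<bar>cm_inner \<gamma> h ?w - l ?w\<bar> + \<bar>a\<bar> * \<bar>cm_inner \<gamma> h w1 - l w1\<bar> + \<bar>b\<bar> * \<bar>cm_inner \<gamma> h w2 - l w2\<bar>"
      by (simp flip: abs_mult)
    also have "\<dots> \<le> e * (?N h + ?N ?w + 1) + \<bar>a\<bar> * (e * (?N h + ?N w1 + 1)) + \<bar>b\<bar> * (e * (?N h + ?N w2 + 1))"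
      by (intro add_mono mult_left_mono A W w) auto
    also have "\<dots> = e * C" by (simp add: C_def algebra_simps)
    finally show ?thesis using e(3) by simp
  qed
  then have "\<bar>cm_inner \<gamma> h ?w - (a * cm_inner \<gamma> h w1 + b * cm_inner \<gamma> h w2)\<bar> \<le> 0" by (rule field_le_epsilon)
  then show ?thesis by simp
qed

lemma cm_inner_add2: "h \<in> cm_space \<gamma> \<Longrightarrow> w1 \<in> cm_space \<gamma> \<Longrightarrow> w2 \<in> cm_space \<gamma> \<Longrightarrow>
    cm_inner \<gamma> h (w1 + w2) = cm_inner \<gamma> h w1 + cm_inner \<gamma> h w2"
  and cm_inner_diff2: "h \<in> cm_space \<gamma> \<Longrightarrow> w1 \<in> cm_space \<gamma> \<Longrightarrow> w2 \<in> cm_space \<gamma> \<Longrightarrow>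
    cm_inner \<gamma> h (w1 - w2) = cm_inner \<gamma> h w1 - cm_inner \<gamma> h w2"
  and cm_inner_scale2: "h \<in> cm_space \<gamma> \<Longrightarrow> w1 \<in> cm_space \<gamma> \<Longrightarrow>
    cm_inner \<gamma> h (a *\<^sub>R w1) = a * cm_inner \<gamma> h w1"
  using cm_inner_linear2[of h w1 w2 1 1] cm_inner_linear2[of h w1 w2 1 "-1"] cm_inner_linear2[of h w1 0 a 0] cm_space_zero by auto

section \<open>Orthonormal expansions\<close>

lemma cm_inner_sum2:
  assumes h: "h \<in> cm_space \<gamma>" and w: "\<And>i. i \<in> A \<Longrightarrow> w i \<in> cm_space \<gamma>"
  shows "cm_inner \<gamma> h (\<Sum>i\<in>A. c i *\<^sub>R w i) = (\<Sum>i\<in>A. c i * cm_inner \<gamma> h (w i))"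
  using w
proof (induction A rule: infinite_finite_induct)
  case (insert i A)
  then show ?case using h by (simp add: cm_inner_add2 cm_inner_scale2 cm_scale cm_sum)
qed (use cm_inner_scale2[OF h cm_space_zero, of 0] in auto)

text \<open>Pythagoras with arbitrary coefficients; the last sum vanishes for the Fourier
  coefficients, which are therefore optimal.\<close>

lemma cm_norm_sub_sum:
  assumes h: "h \<in> cm_space \<gamma>" and e: "\<And>i. i \<in> F \<Longrightarrow> e i \<in> cm_space \<gamma>"
    and on: "\<And>i j. i \<in> F \<Longrightarrow> j \<in> F \<Longrightarrow> cm_inner \<gamma> (e i) (e j) = (if i = j then 1 else 0)" and F: "finite F"
  shows "(cm_norm \<gamma> (h - (\<Sum>i\<in>F. a i *\<^sub>R e i)))\<^sup>2
    = (cm_norm \<gamma> h)\<^sup>2 - (\<Sum>i\<in>F. (cm_inner \<gamma> h (e i))\<^sup>2) + (\<Sum>i\<in>F. (a i - cm_inner \<gamma> h (e i))\<^sup>2)"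
proof -
  let ?s = "\<Sum>i\<in>F. a i *\<^sub>R e i"
  have s: "?s \<in> cm_space \<gamma>" using e by (intro cm_sum cm_scale)
  have hs: "cm_inner \<gamma> h ?s = (\<Sum>i\<in>F. a i * cm_inner \<gamma> h (e i))" by (rule cm_inner_sum2[OF h e])
  have es: "cm_inner \<gamma> ?s (e j) = a j" if j: "j \<in> F" for j
  proof -
    have "cm_inner \<gamma> ?s (e j) = (\<Sum>i\<in>F. a i * cm_inner \<gamma> (e j) (e i))"
      using cm_inner_commute[OF s e[OF j]] cm_inner_sum2[OF e[OF j] e] by simp
    also have "\<dots> = (\<Sum>i\<in>F. if i = j then a i else 0)" by (intro sum.cong) (auto simp: on j)
    finally show ?thesis using F j by simp
  qed
  have ss: "cm_inner \<gamma> ?s ?s = (\<Sum>i\<in>F. (a i)\<^sup>2)"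
    using cm_inner_sum2[OF s e, where A = F and c = a] by (simp add: es power2_eq_square)
  have d: "h - ?s \<in> cm_space \<gamma>" by (rule cm_diff(1)[OF h s])
  have "(cm_norm \<gamma> (h - ?s))\<^sup>2 = cm_inner \<gamma> (h - ?s) h - cm_inner \<gamma> (h - ?s) ?s"
    using cm_inner_self[OF d] cm_inner_diff2[OF d h s] by simp
  also have "\<dots> = cm_inner \<gamma> h h - 2 * cm_inner \<gamma> h ?s + cm_inner \<gamma> ?s ?s"
    using cm_inner_commute[OF d h] cm_inner_commute[OF d s] cm_inner_diff2[OF h h s] cm_inner_diff2[OF s h s] cm_inner_commute[OF h s]
    by simp
  finally show ?thesis
    unfolding hs ss cm_inner_self[OF h]
    by (simp add: sum_distrib_left power2_diff sum.distrib sum_subtractf algebra_simps)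
qed

text \<open>Partial sums over any finite set that contains the indices of a good approximant
  \<open>w\<close> are at least as close to \<open>h\<close> as \<open>w\<close>, by optimality of
  the Fourier coefficients, and \<open>l\<close> is continuous for the Cameron--Martin norm.\<close>

lemma cm_expansion:
  assumes basis: "cm_orthonormal_basis \<gamma> I e" and h: "h \<in> cm_space \<gamma>" and l: "l \<in> top_dual"
  shows "((\<lambda>i. cm_inner \<gamma> h (e i) * l (e i)) has_sum l h) I"
proof -
  have e: "\<And>i. i \<in> I \<Longrightarrow> e i \<in> cm_space \<gamma>"
    and on: "\<And>i j. i \<in> I \<Longrightarrow> j \<in> I \<Longrightarrow> cm_inner \<gamma> (e i) (e j) = (if i = j then 1 else 0)"
    and dense: "\<And>\<epsilon>. \<epsilon> > 0 \<Longrightarrow> \<exists>w\<in>span (e ` I). cm_norm \<gamma> (h - w) < \<epsilon>"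
    using basis h by (auto simp: cm_orthonormal_basis_def)
  have span: "\<exists>F a. finite F \<and> F \<subseteq> I \<and> w = (\<Sum>i\<in>F. a i *\<^sub>R e i)" if "w \<in> span (e ` I)" for w
    using that
  proof (induction rule: span_induct_alt)
    case base
    show ?case by (intro exI[of _ "{}"]) auto
  next
    case (step c x y)
    then obtain F a i where F: "finite F" "F \<subseteq> I" "y = (\<Sum>i\<in>F. a i *\<^sub>R e i)" "i \<in> I" "x = e i" by auto
    let ?a = "\<lambda>j. (if j \<in> F then a j else 0) + (if j = i then c else 0)"
    have "(\<Sum>j\<in>insert i F. ?a j *\<^sub>R e j) = (\<Sum>j\<in>insert i F. (if j \<in> F then a j else 0) *\<^sub>R e j) + (\<Sum>j\<in>insert i F. (if j = i then c else 0) *\<^sub>R e j)"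
      by (simp add: scaleR_add_left sum.distrib)
    also have "(\<Sum>j\<in>insert i F. (if j = i then c else 0) *\<^sub>R e j) = c *\<^sub>R e i"
      using F by (subst sum.mono_neutral_right[of "insert i F" "{i}"]) auto
    also have "(\<Sum>j\<in>insert i F. (if j \<in> F then a j else 0) *\<^sub>R e j) = y"
      unfolding F(3) using F(1) by (intro sum.mono_neutral_cong_right) auto
    finally show ?case using F by (intro exI[of _ "insert i F"] exI[of _ ?a]) (auto simp: add.commute)
  qed
  let ?c = "\<lambda>i. cm_inner \<gamma> h (e i)"
  have "((\<lambda>F. \<Sum>i\<in>F. ?c i * l (e i)) \<longlongrightarrow> l h) (finite_subsets_at_top I)"
  proof (rule tendstoI)
    fix \<epsilon> :: real assume \<epsilon>: "\<epsilon> > 0"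
    \<comment> \<open>The summand 1 keeps the denominator positive for a null functional
      \<open>l\<close>.\<close>
    define \<delta> where "\<delta> = \<epsilon> / (sqrt (ip l l) + 1)"
    have \<delta>: "\<delta> > 0" "sqrt (ip l l) * \<delta> < \<epsilon>"
      using \<epsilon> ip_nonneg[of l] by (auto simp: \<delta>_def field_simps add_pos_nonneg)
    obtain w where w: "w \<in> span (e ` I)" "cm_norm \<gamma> (h - w) < \<delta>" using dense[OF \<delta>(1)] by blast
    obtain F0 a where F0: "finite F0" "F0 \<subseteq> I" "w = (\<Sum>i\<in>F0. a i *\<^sub>R e i)" using span[OF w(1)] by blast
    show "\<forall>\<^sub>F F in finite_subsets_at_top I. dist (\<Sum>i\<in>F. ?c i * l (e i)) (l h) < \<epsilon>"
      unfolding eventually_finite_subsets_at_top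
    proof (intro exI[of _ F0] conjI allI impI F0)
      fix F assume F: "finite F \<and> F0 \<subseteq> F \<and> F \<subseteq> I"
      let ?s = "\<Sum>i\<in>F. ?c i *\<^sub>R e i"
      have s: "?s \<in> cm_space \<gamma>" using e F by (intro cm_sum cm_scale) auto
      have ws: "w \<in> cm_space \<gamma>" unfolding F0 using e F0 by (intro cm_sum cm_scale) auto
      have "(cm_norm \<gamma> (h - ?s))\<^sup>2 = (cm_norm \<gamma> h)\<^sup>2 - (\<Sum>i\<in>F. (?c i)\<^sup>2)"
        using cm_norm_sub_sum[OF h, of F e ?c] e on F by (auto simp: subset_eq)
      also have "\<dots> \<le> (cm_norm \<gamma> h)\<^sup>2 - (\<Sum>i\<in>F0. (?c i)\<^sup>2) + (\<Sum>i\<in>F0. (a i - ?c i)\<^sup>2)"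
        using sum_mono2[of F F0 "\<lambda>i. (?c i)\<^sup>2"] F sum_nonneg[of F0 "\<lambda>i. (a i - ?c i)\<^sup>2"] by auto
      also have "\<dots> = (cm_norm \<gamma> (h - w))\<^sup>2"
        unfolding F0(3) using cm_norm_sub_sum[OF h, of F0 e a] e on F0 by (auto simp: subset_eq)
      finally have "cm_norm \<gamma> (h - ?s) \<le> cm_norm \<gamma> (h - w)"
        using cm_norm_nonneg[OF cm_diff(1)[OF h ws]] by (rule power2_le_imp_le)
      with w(2) have lt: "cm_norm \<gamma> (h - ?s) \<le> \<delta>" by simp
      have "(\<Sum>i\<in>F. ?c i * l (e i)) = l ?s"
        using top_dual_linear[OF l] by (simp add: linear_sum linear_scale)
      then have "dist (\<Sum>i\<in>F. ?c i * l (e i)) (l h) = \<bar>l (h - ?s)\<bar>"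
        using linear_diff[OF top_dual_linear[OF l], of h ?s] by (simp add: dist_real_def abs_minus_commute)
      also have "\<dots> \<le> sqrt (ip l l) * cm_norm \<gamma> (h - ?s)" by (rule cm_norm_bound[OF cm_diff(1)[OF h s] l])
      also have "\<dots> \<le> sqrt (ip l l) * \<delta>" using lt ip_nonneg[of l] by (intro mult_left_mono) auto
      finally show "dist (\<Sum>i\<in>F. ?c i * l (e i)) (l h) < \<epsilon>" using \<delta>(2) by simp
    qed
  qed
  then show ?thesis by (simp add: has_sum_def)
qed

text \<open>Bessel's inequality by duality: the functional with coefficients \<open>k i h\<close>
  has covariance norm equal to the left-hand side, and its value at \<open>h\<close> is the square
  of that number.\<close>

lemma L2_set_orthon_le:
  assumes o: "orthon d k" and h: "h \<in> cm_space \<gamma>"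
  shows "L2_set (\<lambda>i. k i h) {..<d} \<le> cm_norm \<gamma> h"
proof (cases "L2_set (\<lambda>i. k i h) {..<d} = 0")
  case False
  then have pos: "L2_set (\<lambda>i. k i h) {..<d} > 0" using L2_set_nonneg[of "\<lambda>i. k i h" "{..<d}"] by linarith
  let ?l = "\<lambda>x. \<Sum>i<d. k i h * k i x"
  have l: "?l \<in> top_dual" using o by (intro top_dual_sum top_dual_mult) (auto simp: orthon_top_dual)
  have sq: "(L2_set (\<lambda>i. k i h) {..<d})\<^sup>2 = (\<Sum>i<d. (k i h)\<^sup>2)" by (simp add: L2_set_def sum_nonneg)
  have "?l h \<le> sqrt (ip ?l ?l) * cm_norm \<gamma> h" using cm_norm_bound[OF h l] by simp
  also have "ip ?l ?l = (\<Sum>i<d. (k i h)\<^sup>2)" by (rule ip_orthon_sum_self[OF o])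
  finally have "(L2_set (\<lambda>i. k i h) {..<d})\<^sup>2 \<le> L2_set (\<lambda>i. k i h) {..<d} * cm_norm \<gamma> h"
    unfolding sq by (simp add: L2_set_def power2_eq_square)
  then show ?thesis using pos by (simp add: power2_eq_square)
qed (simp add: cm_norm_nonneg[OF h])

end


section \<open>Test functions\<close>

abbreviation pderivs :: "nat list \<Rightarrow> ((nat \<Rightarrow> real) \<Rightarrow> real) \<Rightarrow> (nat \<Rightarrow> real) \<Rightarrow> real" where
  "pderivs is \<phi> \<equiv> foldr pderiv_at is \<phi>"

lemma upd_Rn: "x \<in> Rn d \<Longrightarrow> i < d \<Longrightarrow> x(i := t) \<in> Rn d"
  by (auto simp: PiE_iff extensional_def)

lemma smooth_Rn_continuous: "smooth_Rn d \<phi> \<Longrightarrow> set is \<subseteq> {..<d} \<Longrightarrow> continuous_on (Rn d) (pderivs is \<phi>)"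
  by (simp add: smooth_Rn_def)

text \<open>\<open>smooth_Rn\<close> gives differentiability only at the coordinate of the point
  itself; moving the point along the line reaches every \<open>s\<close>.\<close>

lemma smooth_Rn_DERIV:
  assumes "smooth_Rn d \<phi>" "set is \<subseteq> {..<d}" "i < d" "x \<in> Rn d"
  shows "((\<lambda>t. pderivs is \<phi> (x(i := t))) has_real_derivative pderivs (i # is) \<phi> (x(i := s))) (at s)"
proof -
  have "(\<lambda>t. pderivs is \<phi> ((x(i := s))(i := t))) differentiable at ((x(i := s)) i)"
    using assms upd_Rn[OF assms(4,3)] unfolding smooth_Rn_def by blast
  then show ?thesis
    by (simp add: pderiv_at_def DERIV_deriv_iff_real_differentiable)
qed

lemma continuous_on_upd: "continuous_on UNIV (\<lambda>t::real. x(i := t))"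
proof (rule continuous_on_coordinatewise_then_product)
  show "continuous_on UNIV (\<lambda>t. (x(i := t)) j)" for j
    by (cases "j = i") auto
qed

text \<open>\<open>K\<close> is closed, so along a coordinate line the function vanishes near every
  point outside \<open>K\<close>, and the derivative vanishes there too.\<close>

lemma pderivs_eq_0:
  assumes K: "compact K" "\<And>x. x \<in> Rn d - K \<Longrightarrow> \<phi> x = 0" and "set is \<subseteq> {..<d}" "x \<in> Rn d - K"
  shows "pderivs is \<phi> x = 0"
  using assms(3,4)
proof (induction "is" arbitrary: x)
  case Nil
  then show ?case using K by simp
next
  case (Cons i "is")
  have "open ((\<lambda>t. x(i := t)) -` (- K))"
    using continuous_on_open_vimage[of UNIV "\<lambda>t. x(i := t)"] continuous_on_upd[of x i] compact_imp_closed[OF K(1)]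
    by (metis Int_UNIV_right open_Compl open_UNIV)
  moreover have "x i \<in> (\<lambda>t. x(i := t)) -` (- K)" using Cons by simp
  ultimately have "\<forall>\<^sub>F t in nhds (x i). t \<in> (\<lambda>t. x(i := t)) -` (- K)" by (rule eventually_nhds_in_open)
  then have "\<forall>\<^sub>F t in nhds (x i). pderivs is \<phi> (x(i := t)) = 0"
    by eventually_elim (use Cons upd_Rn[of x d i] in auto)
  then have "deriv (\<lambda>t. pderivs is \<phi> (x(i := t))) (x i) = deriv (\<lambda>t. 0) (x i)" by (rule deriv_cong_ev) simp
  then show ?case by (simp add: pderiv_at_def[of i "pderivs is \<phi>"])
qed

lemma test_fun_smooth: "test_fun_Rn d \<phi> \<Longrightarrow> smooth_Rn d \<phi>"
  by (simp add: test_fun_Rn_def)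

text \<open>The continuous factor \<open>a\<close> admits unbounded coefficients such as a
  coordinate; compact support keeps the product bounded.\<close>

lemma test_fun_bounded:
  assumes \<phi>: "test_fun_Rn d \<phi>" and "is": "set is \<subseteq> {..<d}" and a: "continuous_on UNIV a"
  obtains B where "0 \<le> B" "\<And>x. x \<in> Rn d \<Longrightarrow> \<bar>a x * pderivs is \<phi> x\<bar> \<le> (B :: real)"
proof -
  obtain K where K: "compact K" "K \<subseteq> Rn d" "\<And>x. x \<in> Rn d - K \<Longrightarrow> \<phi> x = 0"
    using \<phi> by (auto simp: test_fun_Rn_def)
  have "continuous_on K (\<lambda>x. a x * pderivs is \<phi> x)"
    using continuous_on_subset[OF smooth_Rn_continuous[OF test_fun_smooth[OF \<phi>] "is"] K(2)] continuous_on_subset[OF a]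
    by (intro continuous_on_mult) auto
  then have "bounded ((\<lambda>x. a x * pderivs is \<phi> x) ` K)"
    using K(1) compact_continuous_image compact_imp_bounded by blast
  then obtain B where B: "\<And>x. x \<in> K \<Longrightarrow> \<bar>a x * pderivs is \<phi> x\<bar> \<le> B" by (auto simp: bounded_iff)
  show ?thesis
  proof (rule that[of "max B 0"])
    show "\<bar>a x * pderivs is \<phi> x\<bar> \<le> max B 0" if "x \<in> Rn d" for x
    proof (cases "x \<in> K")
      case False
      then show ?thesis using pderivs_eq_0[OF K(1,3) "is"] that by simp
    qed (use B in fastforce)
  qed simp
qed

lemma measurable_PiM_id_restrict: "(\<lambda>x. x) \<in> measurable (PiM {..<d} (\<lambda>_. borel)) (restrict_space (borel :: (nat \<Rightarrow> real) measure) (Rn d))"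
  using measurable_PiM_id[of d] by (intro measurable_restrict_space2) (auto simp: space_PiM)

lemma smooth_Rn_measurable:
  assumes "smooth_Rn d \<phi>" "set is \<subseteq> {..<d}"
  shows "pderivs is \<phi> \<in> borel_measurable (PiM {..<d} (\<lambda>_. borel))"
  using measurable_compose[OF measurable_PiM_id_restrict borel_measurable_continuous_on_restrict[OF smooth_Rn_continuous[OF assms]]] .

section \<open>Translates of test functions\<close>

definition shift_Rn :: "nat \<Rightarrow> (nat \<Rightarrow> real) \<Rightarrow> (nat \<Rightarrow> real) \<Rightarrow> nat \<Rightarrow> real" where
  "shift_Rn d c x = (\<lambda>i\<in>{..<d}. x i + c i)"

lemma shift_Rn_in: "shift_Rn d c x \<in> Rn d"
  by (simp add: shift_Rn_def)

lemma shift_Rn_upd: "i < d \<Longrightarrow> shift_Rn d c (x(i := t)) = (shift_Rn d c x)(i := t + c i)"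
  by (auto simp: shift_Rn_def fun_eq_iff)

lemma continuous_shift_Rn: "continuous_on UNIV (shift_Rn d c)"
  unfolding shift_Rn_def[abs_def] restrict_def
proof (rule continuous_on_coordinatewise_then_product)
  show "continuous_on UNIV (\<lambda>x. if i \<in> {..<d} then x i + c i else undefined)" for i
    by (cases "i < d") (auto intro!: continuous_intros)
qed

lemma pderivs_shift:
  assumes "set is \<subseteq> {..<d}"
  shows "pderivs is (\<lambda>x. \<phi> (shift_Rn d c x)) = (\<lambda>x. pderivs is \<phi> (shift_Rn d c x))"
  using assms
proof (induction "is")
  case (Cons i "is")
  show ?case
  proof
    fix x
    have i: "i < d" using Cons by simp
    have "deriv (\<lambda>t. pderivs is \<phi> ((shift_Rn d c x)(i := t + c i))) (x i) = deriv (\<lambda>t. pderivs is \<phi> ((shift_Rn d c x)(i := t))) (x i + c i)"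
      unfolding deriv_def by (simp only: DERIV_shift[of "\<lambda>t. pderivs is \<phi> ((shift_Rn d c x)(i := t))"])
    then show "pderivs (i # is) (\<lambda>x. \<phi> (shift_Rn d c x)) x = pderivs (i # is) \<phi> (shift_Rn d c x)"
      using Cons i
      by (simp add: pderiv_at_def[of i "pderivs is \<phi>"] pderiv_at_def[of i "\<lambda>x. pderivs is \<phi> (shift_Rn d c x)"] shift_Rn_upd)
         (simp add: shift_Rn_def)
  qed
qed simp

lemma test_fun_shift:
  assumes \<phi>: "test_fun_Rn d \<phi>"
  shows "test_fun_Rn d (\<lambda>x. \<phi> (shift_Rn d c x))"
proof -
  obtain K where K: "compact K" "K \<subseteq> Rn d" "\<And>x. x \<in> Rn d - K \<Longrightarrow> \<phi> x = 0"
    using \<phi> by (auto simp: test_fun_Rn_def)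
  note sm = test_fun_smooth[OF \<phi>]
  have "smooth_Rn d (\<lambda>x. \<phi> (shift_Rn d c x))"
    unfolding smooth_Rn_def
  proof (intro allI impI conjI ballI)
    fix "is" assume "is": "set is \<subseteq> {..<d}"
    show "continuous_on (Rn d) (pderivs is (\<lambda>x. \<phi> (shift_Rn d c x)))"
      unfolding pderivs_shift[OF "is"]
      by (rule continuous_on_compose2[OF smooth_Rn_continuous[OF sm "is"] continuous_on_subset[OF continuous_shift_Rn]])
         (simp_all add: image_subset_iff shift_Rn_in)
    fix i x assume i: "i < d" and "x \<in> Rn d"
    have "((\<lambda>t. pderivs is \<phi> ((shift_Rn d c x)(i := t))) has_real_derivative pderivs (i # is) \<phi> ((shift_Rn d c x)(i := x i + c i))) (at (x i + c i))"
      by (rule smooth_Rn_DERIV[OF sm "is" i shift_Rn_in])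
    then have "((\<lambda>t. pderivs is \<phi> ((shift_Rn d c x)(i := t + c i))) has_real_derivative pderivs (i # is) \<phi> ((shift_Rn d c x)(i := x i + c i))) (at (x i))"
      by (simp only: DERIV_shift[of "\<lambda>t. pderivs is \<phi> ((shift_Rn d c x)(i := t))"])
    then show "(\<lambda>t. pderivs is (\<lambda>x. \<phi> (shift_Rn d c x)) (x(i := t))) differentiable at (x i)"
      unfolding pderivs_shift[OF "is"] shift_Rn_upd[OF i] real_differentiable_def by blast
  qed
  moreover have "compact (shift_Rn d (\<lambda>i. - c i) ` K)"
    by (rule compact_continuous_image[OF continuous_on_subset[OF continuous_shift_Rn] K(1)]) simp
  moreover have "\<phi> (shift_Rn d c x) = 0" if "x \<in> Rn d" "x \<notin> shift_Rn d (\<lambda>i. - c i) ` K" for x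
  proof (rule K(3))
    have "shift_Rn d (\<lambda>i. - c i) (shift_Rn d c x) = x"
      using that(1) by (auto simp: shift_Rn_def fun_eq_iff PiE_iff extensional_def)
    then show "shift_Rn d c x \<in> Rn d - K" using that(2) shift_Rn_in by (metis DiffI imageI)
  qed
  ultimately show ?thesis
    unfolding test_fun_Rn_def
    by (intro conjI exI[of _ "shift_Rn d (\<lambda>i. - c i) ` K"]) (simp_all add: image_subset_iff shift_Rn_in)
qed

section \<open>Directional derivatives\<close>

lemma mvt_real:
  fixes f :: "real \<Rightarrow> real"
  assumes "\<And>s. (f has_real_derivative f' s) (at s)"
  obtains s where "\<bar>s - a\<bar> \<le> \<bar>b - a\<bar>" "f b - f a = (b - a) * f' s"
proof (cases "a < b")
  case True
  then obtain z where "z > a" "z < b" "f b - f a = (b - a) * f' z" using MVT2[of a b f f'] assms by auto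
  then show ?thesis by (intro that[of z]) auto
next
  case False
  show ?thesis
  proof (cases "b < a")
    case True
    then obtain z where "z > b" "z < a" "f a - f b = (a - b) * f' z" using MVT2[of b a f f'] assms by auto
    then show ?thesis by (intro that[of z]) (auto simp: algebra_simps)
  next
    case False
    with \<open>\<not> a < b\<close> show ?thesis by (intro that[of a]) auto
  qed
qed

text \<open>Only partial derivatives are given, so the chain rule is built by switching on one
  coordinate at a time: \<open>X m t\<close> moves the coordinates below \<open>m\<close>, and the
  increment in coordinate \<open>m\<close> is handled by the mean value theorem and joint continuity
  of the partial derivative.\<close>

lemma smooth_Rn_directional_derivative:
  assumes sm: "smooth_Rn d \<phi>" and x: "x \<in> Rn d"
  shows "((\<lambda>t. \<phi> (\<lambda>i\<in>{..<d}. x i + t * w i)) has_real_derivative (\<Sum>i<d. w i * pderiv_at i \<phi> x)) (at 0)"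
proof -
  define X where "X m t = (\<lambda>i\<in>{..<d}. x i + (if i < m then t * w i else 0))" for m t
  have X_in: "X m t \<in> Rn d" for m t by (simp add: X_def)
  have X0: "X m 0 = x" for m using x by (auto simp: X_def fun_eq_iff PiE_iff extensional_def)
  have "((\<lambda>t. \<phi> (X m t)) has_real_derivative (\<Sum>i<m. w i * pderiv_at i \<phi> x)) (at 0)" if "m \<le> d" for m
    using that
  proof (induction m)
    case 0
    have "X 0 t = x" for t using x by (auto simp: X_def fun_eq_iff PiE_iff extensional_def)
    then show ?case by simp
  next
    case (Suc m)
    then have m: "m < d" by simp
    have XS: "X (Suc m) t = (X m t)(m := x m + t * w m)" for t
      using m by (auto simp: X_def fun_eq_iff less_Suc_eq)
    have Xm: "(X m t)(m := x m) = X m t" for t using m by (auto simp: X_def fun_eq_iff)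
    let ?g = "\<lambda>p. pderiv_at m \<phi> ((X m (fst p))(m := snd p))"
    have "\<exists>s. \<bar>s - x m\<bar> \<le> \<bar>t * w m\<bar> \<and> \<phi> (X (Suc m) t) - \<phi> (X m t) = t * w m * ?g (t, s)" for t
    proof -
      have "\<And>s. ((\<lambda>s. \<phi> ((X m t)(m := s))) has_real_derivative ?g (t, s)) (at s)"
        using smooth_Rn_DERIV[OF sm, of "[]" m "X m t"] m X_in by simp
      from mvt_real[of "\<lambda>s. \<phi> ((X m t)(m := s))", OF this, of "x m" "x m + t * w m"]
      show ?thesis by (auto simp: XS Xm)
    qed
    then obtain s where s: "\<And>t. \<bar>s t - x m\<bar> \<le> \<bar>t * w m\<bar>" "\<And>t. \<phi> (X (Suc m) t) - \<phi> (X m t) = t * w m * ?g (t, s t)"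
      by metis
    have cont: "continuous_on UNIV ?g"
    proof (rule continuous_on_compose2[OF smooth_Rn_continuous[OF sm, of "[m]", simplified]])
      show "continuous_on UNIV (\<lambda>p. (X m (fst p))(m := snd p))"
      proof (rule continuous_on_coordinatewise_then_product)
        show "continuous_on UNIV (\<lambda>p. ((X m (fst p))(m := snd p)) i)" for i
        proof -
          consider "i = m" | "i \<noteq> m" "i < d" "i < m" | "i \<noteq> m" "i < d" "\<not> i < m" | "i \<noteq> m" "\<not> i < d" by blast
          then show ?thesis
          proof cases
            case 1 then show ?thesis by (simp add: continuous_on_snd continuous_on_id)
          next
            case 2 then show ?thesis by (simp add: X_def) (intro continuous_intros)
          qed (simp_all add: X_def)
        qed
      qed
    qed (use m in \<open>simp_all add: image_subset_iff upd_Rn X_in\<close>)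
    have s_lim: "(s \<longlongrightarrow> x m) (at 0)"
    proof -
      have "((\<lambda>t. \<bar>t * w m\<bar>) \<longlongrightarrow> \<bar>0 * w m\<bar>) (at 0)" by (intro tendsto_intros)
      then have "((\<lambda>t. s t - x m) \<longlongrightarrow> 0) (at 0)"
        by (intro Lim_null_comparison[of "\<lambda>t. s t - x m" "\<lambda>t. \<bar>t * w m\<bar>"]) (use s(1) in auto)
      then show ?thesis by (simp add: LIM_zero_iff)
    qed
    have "((\<lambda>t. ?g (t, s t)) \<longlongrightarrow> ?g (0, x m)) (at 0)"
    proof (rule isCont_tendsto_compose[of "(0, x m)" ?g])
      show "isCont ?g (0, x m)" using cont by (simp add: continuous_on_eq_continuous_at)
      show "((\<lambda>t. (t, s t)) \<longlongrightarrow> (0, x m)) (at 0)" by (intro tendsto_Pair tendsto_ident_at s_lim)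
    qed
    moreover have "?g (0, x m) = pderiv_at m \<phi> x" by (simp add: X0)
    ultimately have "((\<lambda>t. w m * ?g (t, s t)) \<longlongrightarrow> w m * pderiv_at m \<phi> x) (at 0)"
      by (intro tendsto_mult tendsto_const) simp
    then have lim: "((\<lambda>t. ((\<phi> (X (Suc m) t) - \<phi> (X m t)) - (\<phi> (X (Suc m) 0) - \<phi> (X m 0))) / (t - 0)) \<longlongrightarrow> w m * pderiv_at m \<phi> x) (at 0)"
      by (rule Lim_transform_eventually) (auto simp: eventually_at_filter s(2) X0)
    then have "((\<lambda>t. \<phi> (X (Suc m) t) - \<phi> (X m t)) has_real_derivative w m * pderiv_at m \<phi> x) (at 0)"
      unfolding has_field_derivative_iff .
    from DERIV_add[OF Suc.IH this] Suc.prems show ?case by simp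
  qed
  from this[of d] have "((\<lambda>t. \<phi> (X d t)) has_real_derivative (\<Sum>i<d. w i * pderiv_at i \<phi> x)) (at 0)" by simp
  moreover have "X d t = (\<lambda>i\<in>{..<d}. x i + t * w i)" for t by (auto simp: X_def fun_eq_iff)
  ultimately show ?thesis by simp
qed

context radon_gaussian begin

lemma dir_deriv_cylindrical:
  assumes sm: "smooth_Rn n \<phi>" and l: "\<And>j. j < n \<Longrightarrow> l j \<in> top_dual"
  shows "dir_deriv h (\<lambda>y. \<phi> (tuple_map n l y)) x = (\<Sum>j<n. l j h * pderiv_at j \<phi> (tuple_map n l x))"
proof -
  have "tuple_map n l (x + t *\<^sub>R h) = (\<lambda>i\<in>{..<n}. tuple_map n l x i + t * l i h)" for t
    using l by (auto simp: tuple_map_def fun_eq_iff linear_add linear_scale top_dual_linear)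
  moreover have "tuple_map n l x \<in> Rn n" by (simp add: tuple_map_def)
  ultimately show ?thesis
    unfolding dir_deriv_def using smooth_Rn_directional_derivative[OF sm, of "tuple_map n l x" "\<lambda>i. l i h"]
    by (simp add: DERIV_imp_deriv)
qed

text \<open>For fixed \<open>x\<close> the chain rule turns the basis derivatives into the values at
  \<open>e i\<close> of a single functional, and expanding \<open>v x\<close> in the basis sums the
  series to its value at \<open>v x\<close>. The basis disappears from the equation.\<close>

lemma Lb_cyl_eq:
  assumes basis: "cm_orthonormal_basis \<gamma> I e" and vx: "v x \<in> cm_space \<gamma>"
    and sm: "smooth_Rn n \<phi>" and l: "\<And>j. j < n \<Longrightarrow> l j \<in> top_dual"
  shows "Lb_cyl \<gamma> I e v n l \<phi> x =
    (\<Sum>j<n. \<Sum>k<n. ip (l j) (l k) * pderiv_at j (pderiv_at k \<phi>) (tuple_map n l x))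
    + (\<Sum>j<n. (- l j x + l j (v x)) * pderiv_at j \<phi> (tuple_map n l x))"
proof -
  let ?L = "\<lambda>y. \<Sum>j<n. pderiv_at j \<phi> (tuple_map n l x) * l j y"
  have L: "?L \<in> top_dual" using l by (intro top_dual_sum top_dual_mult) auto
  have "((\<lambda>i. cm_inner \<gamma> (v x) (e i) * ?L (e i)) has_sum ?L (v x)) I"
    by (rule cm_expansion[OF basis vx L])
  then have "(\<Sum>\<^sub>\<infinity>i\<in>I. cm_inner \<gamma> (v x) (e i) * ?L (e i)) = ?L (v x)" by (rule infsumI)
  then have s: "(\<Sum>\<^sub>\<infinity>i\<in>I. cm_inner \<gamma> (v x) (e i) * dir_deriv (e i) (\<lambda>y. \<phi> (tuple_map n l y)) x) = ?L (v x)"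
    by (simp add: dir_deriv_cylindrical[OF sm l] mult.commute)
  have o: "OU_cyl \<gamma> n l \<phi> x = (\<Sum>j<n. \<Sum>k<n. ip (l j) (l k) * pderiv_at j (pderiv_at k \<phi>) (tuple_map n l x))
      - (\<Sum>j<n. l j x * pderiv_at j \<phi> (tuple_map n l x))"
    unfolding OU_cyl_def using l by (intro arg_cong2[where f = "(-)"] sum.cong refl) (simp add: cm_inner_riesz)
  show ?thesis unfolding Lb_cyl_def o s
    by (simp add: ring_distribs left_diff_distrib sum.distrib sum_subtractf sum_negf mult.commute)
qed

lemma Lb_cyl_orthon:
  assumes basis: "cm_orthonormal_basis \<gamma> I e" and vx: "v x \<in> cm_space \<gamma>"
    and sm: "smooth_Rn d \<phi>" and o: "orthon d k"
  shows "Lb_cyl \<gamma> I e v d k \<phi> x =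
    (\<Sum>j<d. pderiv_at j (pderiv_at j \<phi>) (tuple_map d k x))
    + (\<Sum>j<d. (- k j x + k j (v x)) * pderiv_at j \<phi> (tuple_map d k x))"
proof -
  have "(\<Sum>j'<d. ip (k j) (k j') * pderiv_at j (pderiv_at j' \<phi>) (tuple_map d k x)) = pderiv_at j (pderiv_at j \<phi>) (tuple_map d k x)"
    if j: "j < d" for j
  proof -
    have "(\<Sum>j'<d. ip (k j) (k j') * pderiv_at j (pderiv_at j' \<phi>) (tuple_map d k x))
        = (\<Sum>j'<d. if j' = j then pderiv_at j (pderiv_at j' \<phi>) (tuple_map d k x) else 0)"
      using j by (intro sum.cong) (auto simp: orthon_ip[OF o])
    then show ?thesis using j by simp
  qed
  then show ?thesis
    using Lb_cyl_eq[where v = v and x = x and l = k, OF basis vx sm] orthon_top_dual[OF o] by simp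
qed

end


section \<open>Consequences of the finite-dimensional estimate\<close>

definition line1 :: "real \<Rightarrow> nat \<Rightarrow> real" where
  "line1 t = (\<lambda>i\<in>{..<1}. t)"

lemma line1_in: "line1 t \<in> Rn 1" by (simp add: line1_def)

lemma line1_upd: "(line1 s)(0 := t) = line1 t"
  by (auto simp: line1_def fun_eq_iff)

lemma line1_0[simp]: "line1 t 0 = t" by (simp add: line1_def)

lemma line1_eq: "x \<in> Rn 1 \<Longrightarrow> line1 (x 0) = x"
  by (auto simp: line1_def fun_eq_iff PiE_iff extensional_def)

lemma measurable_line1[measurable]: "line1 \<in> measurable borel (PiM {..<1} (\<lambda>_. borel))"
  unfolding line1_def[abs_def] by (rule measurable_restrict) simp

lemma integral_std_gauss_1:
  fixes F :: "_ \<Rightarrow> real"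
  assumes F[measurable]: "F \<in> borel_measurable (PiM {..<1} (\<lambda>_. borel))"
  shows "(\<integral>x. F x \<partial>std_gauss 1) = (\<integral>t. F (line1 t) \<partial>gauss1)"
proof -
  interpret product_prob_space "\<lambda>_::nat. gauss1" by (rule product_prob_space_gauss1)
  have "(\<integral>x. F x \<partial>std_gauss 1) = (\<integral>x. F (line1 (x 0)) \<partial>std_gauss 1)"
    by (rule Bochner_Integration.integral_cong[OF refl]) (metis line1_eq space_std_gauss)
  also have "\<dots> = (\<integral>t. F (line1 t) \<partial>gauss1)"
    unfolding std_gauss_def lessThan_Suc_atMost One_nat_def atMost_0
    by (rule product_integral_singleton) measurable
  finally show ?thesis .
qed

lemma nn_integral_std_gauss_1:
  assumes F[measurable]: "F \<in> borel_measurable (PiM {..<1} (\<lambda>_. borel))"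
  shows "(\<integral>\<^sup>+x. F x \<partial>std_gauss 1) = (\<integral>\<^sup>+t. F (line1 t) \<partial>gauss1)"
proof -
  interpret product_prob_space "\<lambda>_::nat. gauss1" by (rule product_prob_space_gauss1)
  have "(\<integral>\<^sup>+x. F x \<partial>std_gauss 1) = (\<integral>\<^sup>+x. F (line1 (x 0)) \<partial>std_gauss 1)"
    by (rule nn_integral_cong) (metis line1_eq space_std_gauss)
  also have "\<dots> = (\<integral>\<^sup>+t. F (line1 t) \<partial>gauss1)"
    unfolding std_gauss_def lessThan_Suc_atMost One_nat_def atMost_0
    by (rule product_nn_integral_singleton) measurable
  finally show ?thesis .
qed

lemma integral_deriv_compact_support:
  fixes F f :: "real \<Rightarrow> real"
  assumes F: "\<And>t. (F has_real_derivative f t) (at t)" and f: "continuous_on UNIV f"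
    and R: "\<And>t. R \<le> \<bar>t\<bar> \<Longrightarrow> F t = 0 \<and> f t = 0"
  shows "(\<integral>t. f t \<partial>lborel) = 0"
proof -
  have "(\<integral>t. f t \<partial>lborel) = (\<integral>t. indicator {-\<bar>R\<bar>..\<bar>R\<bar>} t *\<^sub>R f t \<partial>lborel)"
    by (rule Bochner_Integration.integral_cong[OF refl]) (use R in \<open>force simp: indicator_def\<close>)
  also have "\<dots> = F \<bar>R\<bar> - F (-\<bar>R\<bar>)"
  proof (rule integral_FTC_atLeastAtMost)
    show "(F has_vector_derivative f x) (at x within {-\<bar>R\<bar>..\<bar>R\<bar>})" for x
      using F by (meson has_field_derivative_at_within has_real_derivative_iff_has_vector_derivative)
  qed (use continuous_on_subset[OF f] in auto)
  also have "\<dots> = 0" using R[of "\<bar>R\<bar>"] R[of "-\<bar>R\<bar>"] by simp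
  finally show ?thesis .
qed

lemma std_normal_density_DERIV:
  "(std_normal_density has_real_derivative - t * std_normal_density t) (at t)"
  unfolding std_normal_density_def[abs_def] by (auto intro!: derivative_eq_intros simp: field_simps)

text \<open>The product of the derivative of \<open>\<phi>\<close>, the power and the Gaussian
  density has compact support, and its derivative is the integrand. The drift \<open>2 m / x\<close>
  is the logarithmic derivative of \<open>x ^ (2 * m)\<close>; for \<open>m = 0\<close> this is the
  invariance of the Gaussian law.\<close>

lemma gauss_ibp:
  assumes \<phi>: "test_fun_Rn 1 \<phi>"
  shows "(\<integral>x. (pderivs [0,0] \<phi> x + (- x 0 + 2 * real m / x 0) * pderivs [0] \<phi> x) * x 0 ^ (2 * m) \<partial>std_gauss 1) = 0"
proof -
  note sm = test_fun_smooth[OF \<phi>]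
  obtain K where K: "compact K" "K \<subseteq> Rn 1" "\<And>x. x \<in> Rn 1 - K \<Longrightarrow> \<phi> x = 0"
    using \<phi> by (auto simp: test_fun_Rn_def)
  have "compact ((\<lambda>x. x 0) ` K)"
    by (rule compact_continuous_image[OF continuous_on_subset[OF continuous_on_product_coordinates] K(1)]) simp
  then obtain R0 where R0: "\<And>x. x \<in> K \<Longrightarrow> \<bar>x 0\<bar> \<le> R0" using compact_imp_bounded by (fastforce simp: bounded_iff)
  have "pderivs is \<phi> (line1 t) = 0" if "R0 + 1 \<le> \<bar>t\<bar>" "set is \<subseteq> {..<1}" for t "is"
    using R0[of "line1 t"] that line1_in by (intro pderivs_eq_0[OF K(1,3)]) auto
  note zero = this
  define D where "D k t = pderivs (replicate k 0) \<phi> (line1 t)" for k t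
  have der: "(D k has_real_derivative D (Suc k) t) (at t)" for k t
  proof -
    have "set (replicate k 0) \<subseteq> {..<1::nat}" by (cases k) auto
    from smooth_Rn_DERIV[OF sm this, of 0 "line1 t" t] line1_in
    show ?thesis unfolding D_def line1_upd by (simp add: D_def[abs_def])
  qed
  have cont: "continuous_on UNIV (D k)" for k
    using der by (meson DERIV_isCont continuous_at_imp_continuous_on)
  define F where "F t = D 1 t * (t ^ (2 * m) * std_normal_density t)" for t
  define f where "f t = D 2 t * (t ^ (2 * m) * std_normal_density t)
      + D 1 t * ((real (2 * m) * t ^ (2 * m - 1)) * std_normal_density t + t ^ (2 * m) * (- t * std_normal_density t))" for t
  have "(\<integral>t. f t \<partial>lborel) = 0"
  proof (rule integral_deriv_compact_support)
    show "(F has_real_derivative f t) (at t)" for t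
      unfolding F_def[abs_def] f_def
      by (rule derivative_eq_intros der std_normal_density_DERIV refl | simp add: numeral_2_eq_2)+
    have "continuous_on UNIV std_normal_density"
      using std_normal_density_DERIV by (meson DERIV_isCont continuous_at_imp_continuous_on)
    then show "continuous_on UNIV f" unfolding f_def by (intro continuous_intros cont)
    show "F t = 0 \<and> f t = 0" if "R0 + 1 \<le> \<bar>t\<bar>" for t
    proof -
      have "D 1 t = 0" "D 2 t = 0" using zero[OF that, of "[0]"] zero[OF that, of "[0,0]"] by (simp_all add: D_def numeral_2_eq_2)
      then show ?thesis by (simp add: F_def f_def)
    qed
  qed
  also have "(\<integral>t. f t \<partial>lborel) = (\<integral>t. std_normal_density t *\<^sub>R ((D 2 t + (- t + 2 * real m / t) * D 1 t) * t ^ (2 * m)) \<partial>lborel)"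
  proof (rule Bochner_Integration.integral_cong[OF refl])
    fix t :: real
    \<comment> \<open>At \<open>t = 0\<close> division gives 0, in agreement with the left side; for
      \<open>m = 0\<close> the truncated exponent \<open>2 * m - 1\<close> is harmless because of
      the factor 0.\<close>
    have "real (2 * m) * t ^ (2 * m - 1) = 2 * real m / t * t ^ (2 * m)"
    proof (cases "m = 0 \<or> t = 0")
      case False
      then have "t ^ (2 * m) = t * t ^ (2 * m - 1)" by (simp flip: power_Suc)
      with False show ?thesis by simp
    qed (auto simp: power_0_left)
    then show "f t = std_normal_density t *\<^sub>R ((D 2 t + (- t + 2 * real m / t) * D 1 t) * t ^ (2 * m))"
      unfolding f_def by (simp add: algebra_simps)
  qed
  also have "\<dots> = (\<integral>t. (D 2 t + (- t + 2 * real m / t) * D 1 t) * t ^ (2 * m) \<partial>gauss1)"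
    using borel_measurable_continuous_onI[OF cont] by (subst integral_density) auto
  also have "\<dots> = (\<integral>x. (pderivs [0,0] \<phi> x + (- x 0 + 2 * real m / x 0) * pderivs [0] \<phi> x) * x 0 ^ (2 * m) \<partial>std_gauss 1)"
  proof -
    have [measurable]: "pderivs [0,0] \<phi> \<in> borel_measurable (PiM {..<1} (\<lambda>_. borel))" "pderivs [0] \<phi> \<in> borel_measurable (PiM {..<1} (\<lambda>_. borel))"
      by (rule smooth_Rn_measurable[OF sm], simp)+
    have [measurable]: "(\<lambda>x. x 0) \<in> borel_measurable (PiM {..<1::nat} (\<lambda>_. borel :: real measure))" by simp
    show ?thesis
      by (subst integral_std_gauss_1, measurable) (simp add: D_def numeral_2_eq_2)
  qed
  finally show ?thesis by simp
qed

text \<open>The one-dimensional test case \<open>g = c x\<^sup>2\<^sup>m\<close>, \<open>u = 2 m / x\<close> of \<open>FD_estimate\<close>.\<close>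

lemma FD_estimate_monomial:
  assumes FD: "FD_estimate \<alpha> C"
  defines "c \<equiv> \<lambda>m. 2 ^ m * fact m / fact (2 * m) :: real"
  shows "\<exists>N\<ge>0. (m = 0 \<longrightarrow> N = 0) \<and>
    (\<integral>\<^sup>+t. ennreal ((c m * t ^ (2 * m)) * ln (c m * t ^ (2 * m) + 1) powr \<alpha>) \<partial>gauss1) \<le> ennreal (C * (1 + N * ln (1 + N) powr \<alpha>))"
proof -
  define g where "g x = c m * x 0 ^ (2 * m)" for x :: "nat \<Rightarrow> real"
  define u where "u x i = 2 * real m / x 0" for x :: "nat \<Rightarrow> real" and i :: nat
  define \<mu>' where "\<mu>' = density (std_gauss 1) (\<lambda>x. ennreal (g x))"
  have c: "c m > 0" by (simp add: c_def)
  have g_nn: "0 \<le> g x" for x using c by (simp add: g_def)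
  have [measurable]: "(\<lambda>x. x 0) \<in> borel_measurable (PiM {..<1::nat} (\<lambda>_. borel :: real measure))" by simp
  have g[measurable]: "g \<in> borel_measurable (PiM {..<1} (\<lambda>_. borel))" unfolding g_def by measurable
  have g_std: "g \<in> borel_measurable (std_gauss 1)" using g by (simp add: measurable_cong_sets[OF sets_std_gauss refl])
  have [measurable]: "(\<lambda>x. x 0) \<in> borel_measurable (std_gauss 1)" by (simp add: measurable_cong_sets[OF sets_std_gauss refl])
  have m3: "(\<lambda>x. \<bar>2 * real m / x 0\<bar>) \<in> borel_measurable (std_gauss 1)" by measurable
  have u[measurable]: "(\<lambda>x. u x i) \<in> borel_measurable (PiM {..<1} (\<lambda>_. borel))" for i unfolding u_def by measurable
  \<comment> \<open>\<open>c m\<close> is the reciprocal of the Gaussian moment of order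
    \<open>2 m\<close>.\<close>
  have mom: "(\<integral>\<^sup>+t. ennreal (c m * t ^ (2 * m)) \<partial>gauss1) = 1"
  proof -
    have i: "integrable lborel (\<lambda>t. std_normal_density t * t ^ (2 * m))" by (rule integrable_std_normal_moment)
    have "(\<integral>\<^sup>+t. ennreal (c m * t ^ (2 * m)) \<partial>gauss1) = (\<integral>\<^sup>+t. ennreal (c m * (std_normal_density t * t ^ (2 * m))) \<partial>lborel)"
      using c by (subst nn_integral_density) (auto simp: ennreal_mult'[symmetric] mult_ac intro!: nn_integral_cong)
    also have "\<dots> = ennreal (c m * (\<integral>t. std_normal_density t * t ^ (2 * m) \<partial>lborel))"
      using c i by (subst nn_integral_eq_integral) auto
    also have "\<dots> = 1" unfolding integral_std_normal_moment_even c_def by simp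
    finally show ?thesis .
  qed
  have prob: "prob_space \<mu>'"
    unfolding \<mu>'_def
  proof (rule prob_spaceI)
    show "emeasure (density (std_gauss 1) (\<lambda>x. ennreal (g x))) (space (density (std_gauss 1) (\<lambda>x. ennreal (g x)))) = 1"
    proof -
      have "emeasure (density (std_gauss 1) (\<lambda>x. ennreal (g x))) (space (density (std_gauss 1) (\<lambda>x. ennreal (g x))))
          = (\<integral>\<^sup>+x. ennreal (g x) * indicator (space (std_gauss 1)) x \<partial>std_gauss 1)"
        unfolding space_density by (rule emeasure_density) (use g_std in \<open>simp_all only: sets.top measurable_compose[OF _ measurable_ennreal]\<close>)
      also have "\<dots> = (\<integral>\<^sup>+x. ennreal (g x) \<partial>std_gauss 1)" by (intro nn_integral_cong) simp
      also have "\<dots> = (\<integral>\<^sup>+t. ennreal (c m * t ^ (2 * m)) \<partial>gauss1)"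
        by (subst nn_integral_std_gauss_1) (measurable, simp add: g_def)
      finally show ?thesis using mom by simp
    qed
  qed
  have L2: "L2_set (u x) {..<1} = \<bar>2 * real m / x 0\<bar>" for x
    by (simp add: L2_set_def u_def lessThan_Suc)
  have int: "integrable \<mu>' (\<lambda>x. L2_set (u x) {..<1})"
    unfolding L2 \<mu>'_def
  proof (subst integrable_real_density)
    have "(\<integral>\<^sup>+x. ennreal (norm (g x * \<bar>2 * real m / x 0\<bar>)) \<partial>std_gauss 1) = (\<integral>\<^sup>+t. ennreal (norm (c m * t ^ (2 * m) * \<bar>2 * real m / t\<bar>)) \<partial>gauss1)"
      by (subst nn_integral_std_gauss_1) (measurable, simp add: g_def)
    \<comment> \<open>One power of \<open>t\<close> cancels against the drift, leaving an absolute
      moment of order \<open>2 m - 1\<close>.\<close>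
    also have "\<dots> \<le> (\<integral>\<^sup>+t. ennreal (c m * (2 * real m) * \<bar>t\<bar> ^ (2 * m - 1)) \<partial>gauss1)"
    proof (intro nn_integral_mono ennreal_leI)
      fix t :: real
      show "norm (c m * t ^ (2 * m) * \<bar>2 * real m / t\<bar>) \<le> c m * (2 * real m) * \<bar>t\<bar> ^ (2 * m - 1)"
      proof (cases "m = 0 \<or> t = 0")
        case False
        then have "\<bar>t\<bar> ^ (2 * m) = \<bar>t\<bar> * \<bar>t\<bar> ^ (2 * m - 1)" by (simp flip: power_Suc)
        with False c show ?thesis by (simp add: abs_mult power_abs)
      qed (use c in \<open>auto intro!: mult_nonneg_nonneg\<close>)
    qed
    also have "\<dots> = (\<integral>\<^sup>+t. ennreal (c m * (2 * real m) * (std_normal_density t * \<bar>t\<bar> ^ (2 * m - 1))) \<partial>lborel)"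
      using c by (subst nn_integral_density) (auto simp: ennreal_mult'[symmetric] mult_ac intro!: nn_integral_cong)
    also have "\<dots> < \<infinity>"
      using c integrable_std_normal_moment_abs[of "2 * m - 1"] by (subst nn_integral_eq_integral) auto
    finally show "integrable (std_gauss 1) (\<lambda>x. g x * \<bar>2 * real m / x 0\<bar>)"
      by (intro integrableI_bounded) measurable
  qed (use g_std g_nn m3 in simp_all)
  have eq: "(\<integral>x. (\<Sum>i<1. pderiv_at i (pderiv_at i \<phi>) x) + (\<Sum>i<1. (- x i + u x i) * pderiv_at i \<phi> x) \<partial>\<mu>') = 0"
    if \<phi>: "test_fun_Rn 1 \<phi>" for \<phi>
  proof -
    have [measurable]: "pderiv_at 0 (pderiv_at 0 \<phi>) \<in> borel_measurable (PiM {..<1} (\<lambda>_. borel))" "pderiv_at 0 \<phi> \<in> borel_measurable (PiM {..<1} (\<lambda>_. borel))"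
      using smooth_Rn_measurable[OF test_fun_smooth[OF \<phi>], of "[0,0]"] smooth_Rn_measurable[OF test_fun_smooth[OF \<phi>], of "[0]"] by auto
    have "(\<integral>x. (\<Sum>i<1. pderiv_at i (pderiv_at i \<phi>) x) + (\<Sum>i<1. (- x i + u x i) * pderiv_at i \<phi> x) \<partial>\<mu>')
      = (\<integral>x. g x *\<^sub>R ((\<Sum>i<1. pderiv_at i (pderiv_at i \<phi>) x) + (\<Sum>i<1. (- x i + u x i) * pderiv_at i \<phi> x)) \<partial>std_gauss 1)"
      unfolding \<mu>'_def
    proof (rule integral_density)
      have "(\<lambda>x. (\<Sum>i<1. pderiv_at i (pderiv_at i \<phi>) x) + (\<Sum>i<1. (- x i + u x i) * pderiv_at i \<phi> x)) \<in> borel_measurable (PiM {..<1} (\<lambda>_. borel))"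
      proof -
        have s: "(\<Sum>i<1. f i) = f 0" for f :: "nat \<Rightarrow> real" by simp
        show ?thesis unfolding s by measurable
      qed
      then show "(\<lambda>x. (\<Sum>i<1. pderiv_at i (pderiv_at i \<phi>) x) + (\<Sum>i<1. (- x i + u x i) * pderiv_at i \<phi> x)) \<in> borel_measurable (std_gauss 1)"
        by (simp only: measurable_cong_sets[OF sets_std_gauss refl])
    qed (use g_nn g_std in simp_all)
    also have "\<dots> = (\<integral>x. c m * ((pderivs [0,0] \<phi> x + (- x 0 + 2 * real m / x 0) * pderivs [0] \<phi> x) * x 0 ^ (2 * m)) \<partial>std_gauss 1)"
      by (intro Bochner_Integration.integral_cong) (auto simp: g_def u_def lessThan_Suc)
    also have "\<dots> = 0" by (simp only: integral_mult_right_zero gauss_ibp[OF \<phi>] mult_zero_right)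
    finally show ?thesis .
  qed
  define N where "N = (\<integral>x. L2_set (u x) {..<1} \<partial>\<mu>')"
  have "(\<integral>\<^sup>+x. ennreal (g x * ln (g x + 1) powr \<alpha>) \<partial>std_gauss 1) \<le> ennreal (C * (1 + N * ln (1 + N) powr \<alpha>))"
    using FD[unfolded FD_estimate_def Let_def, rule_format, of 1 g \<mu>' u] g u prob int eq g_nn
    unfolding N_def \<mu>'_def by simp
  also have "(\<integral>\<^sup>+x. ennreal (g x * ln (g x + 1) powr \<alpha>) \<partial>std_gauss 1) = (\<integral>\<^sup>+t. ennreal ((c m * t ^ (2 * m)) * ln (c m * t ^ (2 * m) + 1) powr \<alpha>) \<partial>gauss1)"
    by (subst nn_integral_std_gauss_1) (measurable, simp add: g_def)
  finally show ?thesis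
  proof (intro exI[of _ N] conjI impI)
    show "0 \<le> N" unfolding N_def by (intro Bochner_Integration.integral_nonneg L2_set_nonneg)
    show "N = 0" if "m = 0" unfolding N_def L2 using that by simp
  qed
qed

text \<open>The case \<open>m = 0\<close>: the Gaussian law itself with drift 0. It shows
  \<open>C > 0\<close> and settles dimension 0 later.\<close>

lemma FD_estimate_ge:
  assumes FD: "FD_estimate \<alpha> C"
  shows "ln 2 powr \<alpha> \<le> C"
proof -
  interpret prob_space gauss1 by (rule prob_space_gauss1)
  have "(\<integral>\<^sup>+t. ennreal (ln 2 powr \<alpha>) \<partial>gauss1) \<le> ennreal C"
    using FD_estimate_monomial[OF FD, of 0] by auto
  then have "ennreal (ln 2 powr \<alpha>) \<le> ennreal C" using emeasure_space_1 by (simp add: nn_integral_const)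
  then show ?thesis by (cases "C \<ge> 0") (auto simp: ennreal_neg not_le)
qed

text \<open>The integral over \<open>[exp (- n), 1]\<close> is \<open>n\<close>.\<close>

lemma nn_integral_inverse_infinite: "(\<integral>\<^sup>+t. ennreal (1 / t) * indicator {0<..1} t \<partial>lborel) = \<infinity>"
proof -
  have le: "ennreal (real n) \<le> (\<integral>\<^sup>+t. ennreal (1 / t) * indicator {0<..1} t \<partial>lborel)" for n
  proof -
    let ?a = "exp (- real n)"
    have i: "integrable lborel (\<lambda>t. indicator {?a..1} t *\<^sub>R (1 / t))"
      by (intro borel_integrable_compact continuous_intros) (auto intro: less_le_trans[OF exp_gt_zero])
    have "real n = ln 1 - ln ?a" by simp
    also have "\<dots> = (\<integral>t. indicator {?a..1} t *\<^sub>R (1 / t) \<partial>lborel)"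
    proof (rule integral_FTC_atLeastAtMost[symmetric])
      show "(ln has_vector_derivative 1 / x) (at x within {?a..1})" if "?a \<le> x" for x
        using less_le_trans[OF exp_gt_zero that] by (auto intro!: derivative_eq_intros simp flip: has_real_derivative_iff_has_vector_derivative)
    qed (auto intro!: continuous_intros dest: less_le_trans[OF exp_gt_zero])
    finally have "ennreal (real n) = (\<integral>\<^sup>+t. ennreal (indicator {?a..1} t *\<^sub>R (1 / t)) \<partial>lborel)"
      using i by (subst nn_integral_eq_integral) (auto simp: indicator_def intro: less_imp_le[OF less_le_trans[OF exp_gt_zero]])
    also have "\<dots> \<le> (\<integral>\<^sup>+t. ennreal (1 / t) * indicator {0<..1} t \<partial>lborel)"
      by (intro nn_integral_mono) (auto simp: indicator_def dest: less_le_trans[OF exp_gt_zero])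
    finally show ?thesis .
  qed
  show ?thesis
  proof (rule ccontr)
    assume "\<not> ?thesis"
    then obtain r where r: "(\<integral>\<^sup>+t. ennreal (1 / t) * indicator {0<..1} t \<partial>lborel) = ennreal r" "0 \<le> r"
      by (cases "\<integral>\<^sup>+t. ennreal (1 / t) * indicator {0<..1} t \<partial>lborel") auto
    obtain n where "r < real n" using reals_Archimedean2 by blast
    with le[of n] r show False by (simp add: ennreal_le_iff2)
  qed
qed

text \<open>Below \<open>-1\<close> the left-hand side is infinite for a density with a zero of high order, so the
  estimate can only hold for exponents for which \<open>N \<mapsto> N * ln (1 + N) powr \<alpha>\<close> is monotone.\<close>

lemma FD_estimate_exponent:
  assumes FD: "FD_estimate \<alpha> C"
  shows "-1 \<le> \<alpha>"
proof (rule ccontr)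
  assume "\<not> ?thesis"
  then have \<alpha>: "\<alpha> < -1" by simp
  \<comment> \<open>This \<open>m\<close> makes \<open>2 m (1 + \<alpha>) \<le> -1\<close>, so that
    \<open>g powr (1 + \<alpha>)\<close> is at least a multiple of \<open>1 / t\<close> on
    \<open>(0, 1]\<close>.\<close>
  obtain m where m: "1 / (-1 - \<alpha>) < real m" using reals_Archimedean2 by blast
  have m2: "2 * real m * (1 + \<alpha>) \<le> -1"
  proof -
    have "1 < real m * (-1 - \<alpha>)" using m \<alpha> by (simp add: field_simps)
    then show ?thesis by (simp add: algebra_simps)
  qed
  have m0: "m > 0" using m \<alpha> by (cases m) (auto simp: field_simps)
  define c where "c = (2 ^ m * fact m / fact (2 * m) :: real)"
  have c: "c > 0" by (simp add: c_def)
  define k where "k = c powr (1 + \<alpha>) * std_normal_density 1"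
  have k: "k > 0" using c by (simp add: k_def normal_density_pos)
  have low: "ennreal k * (ennreal (1 / t) * indicator {0<..1} t) \<le> ennreal (std_normal_density t) * ennreal ((c * t ^ (2 * m)) * ln (c * t ^ (2 * m) + 1) powr \<alpha>)" for t :: real
  proof (cases "t \<in> {0<..1}")
    case True
    then have t: "0 < t" "t \<le> 1" by auto
    define g where "g = c * t ^ (2 * m)"
    have g: "g > 0" using c t by (simp add: g_def)
    have lng: "0 < ln (g + 1)" "ln (g + 1) \<le> g" using g ln_add_one_self_le_self[of g] by (auto simp: add.commute)
    have "1 / t = t powr (-1)" using t by (simp add: powr_minus_divide)
    also have "\<dots> \<le> t powr (2 * real m * (1 + \<alpha>))" using t m2 by (intro powr_mono') auto
    also have "\<dots> = (t ^ (2 * m)) powr (1 + \<alpha>)" using t by (simp add: powr_realpow[symmetric] powr_powr)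
    finally have "c powr (1 + \<alpha>) * (1 / t) \<le> c powr (1 + \<alpha>) * (t ^ (2 * m)) powr (1 + \<alpha>)" by (intro mult_left_mono) auto
    also have "\<dots> = g powr (1 + \<alpha>)" unfolding g_def using c t by (simp add: powr_mult)
    also have "\<dots> = g * g powr \<alpha>" using g by (simp add: powr_add)
    \<comment> \<open>\<open>ln (g + 1) \<le> g\<close>, and a negative exponent reverses the
      order.\<close>
    also have "\<dots> \<le> g * ln (g + 1) powr \<alpha>"
      using g lng \<alpha> by (intro mult_left_mono powr_mono2') auto
    finally have 1: "c powr (1 + \<alpha>) * (1 / t) \<le> g * ln (g + 1) powr \<alpha>" .
    have 2: "std_normal_density 1 \<le> std_normal_density t"
      using t power_le_one[of t 2] by (auto simp: std_normal_density_def intro!: divide_right_mono)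
    have "k * (1 / t) = std_normal_density 1 * (c powr (1 + \<alpha>) * (1 / t))" by (simp add: k_def)
    also have "\<dots> \<le> std_normal_density t * (g * ln (g + 1) powr \<alpha>)"
      using g t by (intro mult_mono[OF 2 1]) auto
    finally have "ennreal (k * (1 / t)) \<le> ennreal (std_normal_density t * (g * ln (g + 1) powr \<alpha>))" by (rule ennreal_leI)
    then show ?thesis using True k t g by (simp add: ennreal_mult'[symmetric] g_def)
  qed simp
  have "\<infinity> = ennreal k * (\<integral>\<^sup>+t. ennreal (1 / t) * indicator {0<..1} t \<partial>lborel)"
    using k by (simp add: nn_integral_inverse_infinite ennreal_mult_top)
  also have "\<dots> = (\<integral>\<^sup>+t. ennreal k * (ennreal (1 / t) * indicator {0<..1} t) \<partial>lborel)"
    by (rule nn_integral_cmult[symmetric]) measurable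
  also have "\<dots> \<le> (\<integral>\<^sup>+t. ennreal (std_normal_density t) * ennreal ((c * t ^ (2 * m)) * ln (c * t ^ (2 * m) + 1) powr \<alpha>) \<partial>lborel)"
    by (intro nn_integral_mono low)
  also have "\<dots> = (\<integral>\<^sup>+t. ennreal ((c * t ^ (2 * m)) * ln (c * t ^ (2 * m) + 1) powr \<alpha>) \<partial>gauss1)"
    by (subst nn_integral_density) auto
  also have "\<dots> < \<infinity>"
    using FD_estimate_monomial[OF FD, of m] unfolding c_def[symmetric] by (auto intro: le_less_trans)
  finally show False by simp
qed

text \<open>For \<open>-1 \<le> \<alpha> < 0\<close>, concavity of the logarithm gives
  \<open>a / b \<le> r\<close> with \<open>r = ln (1 + a) / ln (1 + b) \<le> 1\<close>, and
  \<open>r \<le> r powr (- \<alpha>)\<close> because \<open>- \<alpha> \<le> 1\<close>.\<close>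

lemma log_bound_mono:
  fixes a b \<alpha> :: real
  assumes \<alpha>: "-1 \<le> \<alpha>" and ab: "0 \<le> a" "a \<le> b"
  shows "a * ln (1 + a) powr \<alpha> \<le> b * ln (1 + b) powr \<alpha>"
proof (cases "a = 0")
  case False
  with ab have a: "0 < a" "0 < b" by auto
  have la: "0 < ln (1 + a)" "ln (1 + a) \<le> ln (1 + b)" "0 < ln (1 + b)" using a ab by auto
  show ?thesis
  proof (cases "\<alpha> \<ge> 0")
    case True
    then show ?thesis using a ab la by (intro mult_mono powr_mono2) auto
  next
    case False
    define r where "r = ln (1 + a) / ln (1 + b)"
    have r: "0 < r" "r \<le> 1" using la by (auto simp: r_def)
    have "(1 - a / b) * ln 1 + a / b * ln (1 + b) \<le> ln ((1 - a / b) *\<^sub>R 1 + (a / b) *\<^sub>R (1 + b))"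
      using a ab by (intro concave_onD[OF ln_concave]) auto
    also have "(1 - a / b) *\<^sub>R 1 + (a / b) *\<^sub>R (1 + b) = 1 + a" using a by (simp add: field_simps)
    finally have "a / b \<le> r" using la by (simp add: r_def field_simps)
    also have "r = r powr 1" using r by simp
    also have "\<dots> \<le> r powr (- \<alpha>)" using r \<alpha> by (intro powr_mono') auto
    also have "\<dots> = ln (1 + b) powr \<alpha> / ln (1 + a) powr \<alpha>"
      using la by (simp add: r_def powr_divide powr_minus field_simps)
    finally show ?thesis using la a by (simp add: field_simps)
  qed
qed (use assms in auto)

text \<open>The conditional expectation of \<open>W\<close> given \<open>Y\<close>, as a function on
  the target space: the density of the image of the measure with weight \<open>W\<close> relative to
  the law of \<open>Y\<close>. The changes of measure used require no integrability of
  \<open>\<psi>\<close>.\<close>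

lemma cond_density_nonneg:
  fixes W :: "'a \<Rightarrow> real"
  assumes M: "prob_space M" and Y[measurable]: "Y \<in> measurable M N" and W: "integrable M W" "\<And>x. 0 \<le> W x"
  obtains w where "w \<in> borel_measurable N" "integrable (distr M N Y) w"
    "\<And>\<psi>. \<psi> \<in> borel_measurable N \<Longrightarrow> (\<integral>x. \<psi> (Y x) * W x \<partial>M) = (\<integral>y. \<psi> y * w y \<partial>distr M N Y)"
proof -
  note [measurable] = borel_measurable_integrable[OF W(1)]
  interpret M: prob_space M by fact
  interpret D: prob_space "distr M N Y" by (rule M.prob_space_distr[OF Y])
  let ?D = "distr M N Y" and ?V = "distr (density M (\<lambda>x. ennreal (W x))) N Y"
  have ac: "absolutely_continuous ?D ?V"
    unfolding absolutely_continuous_def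
  proof
    fix A assume A: "A \<in> null_sets ?D"
    then have "A \<in> sets N" by auto
    moreover from A this have "Y -` A \<inter> space M \<in> null_sets M"
      by (auto simp: null_sets_def emeasure_distr)
    then have "Y -` A \<inter> space M \<in> null_sets (density M (\<lambda>x. ennreal (W x)))"
      using absolutely_continuousI_density[of "\<lambda>x. ennreal (W x)" M] by (auto simp: absolutely_continuous_def)
    ultimately show "A \<in> null_sets ?V" by (auto simp: null_sets_def emeasure_distr)
  qed
  have dens: "density ?D (RN_deriv ?D ?V) = ?V" by (rule D.density_RN_deriv[OF ac]) simp
  have fin: "(\<integral>\<^sup>+y. RN_deriv ?D ?V y \<partial>?D) \<noteq> \<infinity>"
  proof -
    have "(\<integral>\<^sup>+y. RN_deriv ?D ?V y \<partial>?D) = emeasure ?V (space ?D)"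
      by (subst (2) dens[symmetric], subst emeasure_density) (auto intro!: nn_integral_cong)
    also have "\<dots> = (\<integral>\<^sup>+x. ennreal (W x) \<partial>M)"
      by (auto simp: emeasure_distr emeasure_density intro!: nn_integral_cong split: split_indicator dest: measurable_space[OF Y])
    also have "\<dots> < \<infinity>" using W by (simp add: nn_integral_eq_integral)
    finally show ?thesis by simp
  qed
  define w where "w y = enn2real (RN_deriv ?D ?V y)" for y
  have [measurable]: "RN_deriv ?D ?V \<in> borel_measurable N" using borel_measurable_RN_deriv[of ?D ?V] by simp
  have w[measurable]: "w \<in> borel_measurable N" unfolding w_def by measurable
  have ae: "AE y in ?D. ennreal (w y) = RN_deriv ?D ?V y"
    using nn_integral_PInf_AE[OF _ fin] unfolding w_def by (auto simp: less_top)
  have int: "integrable ?D w"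
  proof (rule integrableI_nonneg)
    have "(\<integral>\<^sup>+y. ennreal (w y) \<partial>?D) = (\<integral>\<^sup>+y. RN_deriv ?D ?V y \<partial>?D)" by (rule nn_integral_cong_AE[OF ae])
    then show "(\<integral>\<^sup>+y. ennreal (w y) \<partial>?D) < \<infinity>" using fin by (simp add: less_top)
  qed (auto simp: w_def)
  have dw: "density ?D (\<lambda>y. ennreal (w y)) = ?V"
    using dens ae by (subst (asm) density_cong[of _ _ "\<lambda>y. ennreal (w y)"]) (auto elim: AE_mp)
  show ?thesis
  proof (rule that[OF w int])
    fix \<psi> :: "_ \<Rightarrow> real" assume [measurable]: "\<psi> \<in> borel_measurable N"
    have "(\<integral>x. \<psi> (Y x) * W x \<partial>M) = (\<integral>x. \<psi> (Y x) \<partial>density M (\<lambda>x. ennreal (W x)))"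
      using W(2) by (subst integral_density) (auto simp: mult.commute)
    also have "\<dots> = (\<integral>y. \<psi> y \<partial>?V)" by (subst integral_distr) auto
    also have "\<dots> = (\<integral>y. \<psi> y * w y \<partial>?D)"
      unfolding dw[symmetric] by (subst integral_density) (auto simp: w_def mult.commute)
    finally show "(\<integral>x. \<psi> (Y x) * W x \<partial>M) = (\<integral>y. \<psi> y * w y \<partial>?D)" .
  qed
qed

text \<open>A signed \<open>W\<close> is split into its positive and negative parts; boundedness of
  \<open>\<psi>\<close> makes both integrals finite, so that they can be subtracted.\<close>

lemma cond_density:
  fixes W :: "'a \<Rightarrow> real"
  assumes M: "prob_space M" and Y[measurable]: "Y \<in> measurable M N" and W: "integrable M W"
  obtains w where "w \<in> borel_measurable N" "integrable (distr M N Y) w"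
    "\<And>\<psi>. \<psi> \<in> borel_measurable N \<Longrightarrow> (\<And>y. \<bar>\<psi> y\<bar> \<le> (1::real)) \<Longrightarrow> (\<integral>x. \<psi> (Y x) * W x \<partial>M) = (\<integral>y. \<psi> y * w y \<partial>distr M N Y)"
proof -
  note [measurable] = borel_measurable_integrable[OF W]
  have W': "integrable M (\<lambda>x. max 0 (W x))" "integrable M (\<lambda>x. max 0 (- W x))" using W by auto
  obtain p where p: "p \<in> borel_measurable N" "integrable (distr M N Y) p"
    "\<And>\<psi>. \<psi> \<in> borel_measurable N \<Longrightarrow> (\<integral>x. \<psi> (Y x) * max 0 (W x) \<partial>M) = (\<integral>y. \<psi> y * p y \<partial>distr M N Y)"
    using cond_density_nonneg[OF M Y W'(1)] by auto
  obtain q where q: "q \<in> borel_measurable N" "integrable (distr M N Y) q"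
    "\<And>\<psi>. \<psi> \<in> borel_measurable N \<Longrightarrow> (\<integral>x. \<psi> (Y x) * max 0 (- W x) \<partial>M) = (\<integral>y. \<psi> y * q y \<partial>distr M N Y)"
    using cond_density_nonneg[OF M Y W'(2)] by auto
  show ?thesis
  proof (rule that[of "\<lambda>y. p y - q y"])
    fix \<psi> :: "_ \<Rightarrow> real" assume \<psi>[measurable]: "\<psi> \<in> borel_measurable N" and b: "\<And>y. \<bar>\<psi> y\<bar> \<le> 1"
    have bd: "integrable M' (\<lambda>x. f x * g x)" if "f \<in> borel_measurable M'" "\<And>x. \<bar>f x\<bar> \<le> 1" "integrable M' g"
      for f g :: "_ \<Rightarrow> real" and M'
      using that mult_right_mono[of "\<bar>f _\<bar>" 1] by (intro Bochner_Integration.integrable_bound[OF that(3)]) (auto simp: abs_mult)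
    have "(\<integral>x. \<psi> (Y x) * W x \<partial>M) = (\<integral>x. \<psi> (Y x) * max 0 (W x) - \<psi> (Y x) * max 0 (- W x) \<partial>M)"
      by (intro Bochner_Integration.integral_cong) (auto simp: max_def)
    also have "\<dots> = (\<integral>x. \<psi> (Y x) * max 0 (W x) \<partial>M) - (\<integral>x. \<psi> (Y x) * max 0 (- W x) \<partial>M)"
      by (intro Bochner_Integration.integral_diff bd W' b) measurable
    also have "\<dots> = (\<integral>y. \<psi> y * p y \<partial>distr M N Y) - (\<integral>y. \<psi> y * q y \<partial>distr M N Y)"
      by (simp only: p(3)[OF \<psi>] q(3)[OF \<psi>])
    also have "\<dots> = (\<integral>y. \<psi> y * p y - \<psi> y * q y \<partial>distr M N Y)"
      by (intro Bochner_Integration.integral_diff[symmetric] bd p(2) q(2) b) measurable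
    finally show "(\<integral>x. \<psi> (Y x) * W x \<partial>M) = (\<integral>y. \<psi> y * (p y - q y) \<partial>distr M N Y)" by (simp add: right_diff_distrib)
  qed (use p q in auto)
qed

section \<open>Laws of random vectors with a drift\<close>

lemma abs_le_L2_set: "i < d \<Longrightarrow> \<bar>f i\<bar> \<le> L2_set f {..<d}" for i d :: nat
  unfolding L2_set_def by (rule real_le_rsqrt) (auto intro!: member_le_sum)

text \<open>The drift of the law of \<open>Y\<close> is the conditional expectation \<open>u = E[V | Y]\<close>.\<close>

lemma FD_estimate_random_vector:
  assumes FD: "FD_estimate \<alpha> C" and d: "1 \<le> d" and M: "prob_space M"
    and Y: "Y \<in> measurable M (PiM {..<d} (\<lambda>_. borel))"
    and V: "\<And>i. i < d \<Longrightarrow> V i \<in> borel_measurable M" "integrable M (\<lambda>x. L2_set (\<lambda>i. V i x) {..<d})"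
    and N: "(\<integral>x. L2_set (\<lambda>i. V i x) {..<d} \<partial>M) \<le> N"
    and g: "g \<in> borel_measurable (PiM {..<d} (\<lambda>_. borel))" "\<And>x. 0 \<le> g x"
    and law: "distr M (PiM {..<d} (\<lambda>_. borel)) Y = density (std_gauss d) (\<lambda>x. ennreal (g x))"
    and eq: "\<And>\<phi>. test_fun_Rn d \<phi> \<Longrightarrow>
      (\<integral>x. (\<Sum>i<d. pderiv_at i (pderiv_at i \<phi>) (Y x)) + (\<Sum>i<d. (- Y x i + V i x) * pderiv_at i \<phi> (Y x)) \<partial>M) = 0"
  shows "(\<integral>\<^sup>+x. ennreal (g x * ln (g x + 1) powr \<alpha>) \<partial>std_gauss d) \<le> ennreal (C * (1 + N * ln (1 + N) powr \<alpha>))"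
proof -
  interpret M: prob_space M by fact
  let ?P = "PiM {..<d} (\<lambda>_. borel :: real measure)"
  let ?D = "distr M ?P Y"
  note [measurable] = Y V(1)
  interpret D: prob_space ?D by (rule M.prob_space_distr[OF Y])
  have Vint: "integrable M (V i)" if "i < d" for i
  proof (rule Bochner_Integration.integrable_bound[OF V(2)])
    show "AE x in M. norm (V i x) \<le> norm (L2_set (\<lambda>i. V i x) {..<d})"
      using abs_le_L2_set[OF that, of "\<lambda>i. V i x" for x] by (intro AE_I2) (simp add: L2_set_nonneg)
  qed (rule V(1)[OF that])
  define Q where "Q i w \<longleftrightarrow> w \<in> borel_measurable ?P \<and> integrable ?D w \<and>
      (\<forall>\<psi>. \<psi> \<in> borel_measurable ?P \<longrightarrow> (\<forall>y. \<bar>\<psi> y\<bar> \<le> (1::real)) \<longrightarrow> (\<integral>x. \<psi> (Y x) * V i x \<partial>M) = (\<integral>y. \<psi> y * w y \<partial>?D))" for i w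
  have "\<exists>w. Q i w" if "i < d" for i
    by (rule cond_density[OF M Y Vint[OF that]]) (unfold Q_def, blast)
  then obtain w where w0: "\<And>i. i < d \<Longrightarrow> Q i (w i)" by metis
  have w: "\<And>i. i < d \<Longrightarrow> w i \<in> borel_measurable ?P" "\<And>i. i < d \<Longrightarrow> integrable ?D (w i)"
    "\<And>i \<psi>. i < d \<Longrightarrow> \<psi> \<in> borel_measurable ?P \<Longrightarrow> (\<And>y. \<bar>\<psi> y\<bar> \<le> 1) \<Longrightarrow> (\<integral>x. \<psi> (Y x) * V i x \<partial>M) = (\<integral>y. \<psi> y * w i y \<partial>?D)"
    using w0 unfolding Q_def by blast+
  have bd: "integrable M' (\<lambda>x. f x * h x)" if "f \<in> borel_measurable M'" "\<And>x. x \<in> space M' \<Longrightarrow> \<bar>f x\<bar> \<le> B" "integrable M' h"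
    for f h :: "_ \<Rightarrow> real" and M' B
  proof (rule Bochner_Integration.integrable_bound)
    show "integrable M' (\<lambda>x. B * h x)" using that by simp
    show "AE x in M'. norm (f x * h x) \<le> norm (B * h x)"
      using that(2) by (intro AE_I2) (force simp: abs_mult intro: mult_right_mono)
  qed (use that in measurable)
  define u where "u x i = w i x" for x i
  let ?L = "\<lambda>x. L2_set (u x) {..<d}"
  have Lm: "?L \<in> borel_measurable ?P"
  proof -
    have [measurable]: "(\<lambda>x. \<Sum>i<d. (w i x)\<^sup>2) \<in> borel_measurable ?P"
      by (intro borel_measurable_sum borel_measurable_power w) simp
    show ?thesis unfolding L2_set_def u_def by measurable
  qed
  have Lint: "integrable ?D ?L"
  proof (rule Bochner_Integration.integrable_bound)
    show "integrable ?D (\<lambda>x. \<Sum>i<d. \<bar>w i x\<bar>)" using w(2) by (intro Bochner_Integration.integrable_sum integrable_abs) auto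
    show "?L \<in> borel_measurable ?D" using Lm by simp
    show "AE x in ?D. norm (?L x) \<le> norm (\<Sum>i<d. \<bar>w i x\<bar>)"
      using L2_set_le_sum_abs[of "u _" "{..<d}"] by (intro AE_I2) (auto simp: u_def L2_set_nonneg sum_nonneg)
  qed
  \<comment> \<open>The direction of \<open>u\<close>, with value 0 where \<open>u\<close> vanishes,
    by division by zero. Being bounded, it may be tested against the conditional expectation;
    summing over the coordinates and applying Cauchy--Schwarz to \<open>V\<close> bounds the
    \<open>L\<^sup>1\<close> norm of \<open>u\<close> by that of \<open>V\<close>.\<close>
  define \<psi> where "\<psi> i x = w i x / ?L x" for i x
  have \<psi>m: "\<psi> i \<in> borel_measurable ?P" if "i < d" for i unfolding \<psi>_def using w(1)[OF that] Lm by measurable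
  have \<psi>b: "\<bar>\<psi> i x\<bar> \<le> 1" if "i < d" for i x
  proof (cases "?L x = 0")
    case False
    have "\<bar>w i x\<bar> \<le> ?L x" using abs_le_L2_set[OF that, of "u x"] by (simp add: u_def)
    then show ?thesis using False L2_set_nonneg[of "u x" "{..<d}"] by (simp add: \<psi>_def abs_mult divide_le_eq)
  qed (simp add: \<psi>_def)
  have \<psi>L: "L2_set (\<lambda>i. \<psi> i x) {..<d} \<le> 1" for x
  proof (cases "?L x = 0")
    case False
    have "L2_set (\<lambda>i. \<psi> i x) {..<d} = ?L x * (1 / ?L x)"
      unfolding \<psi>_def using L2_set_left_distrib[of "1 / ?L x" "\<lambda>i. w i x" "{..<d}"] L2_set_nonneg[of "u x" "{..<d}"]
      by (simp add: u_def[abs_def])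
    then show ?thesis using False by simp
  qed (simp add: \<psi>_def L2_set_def)
  have Lsum: "?L x = (\<Sum>i<d. \<psi> i x * w i x)" for x
  proof (cases "?L x = 0")
    case False
    have "(\<Sum>i<d. \<psi> i x * w i x) = (\<Sum>i<d. (w i x)\<^sup>2) / ?L x"
      by (simp add: \<psi>_def sum_divide_distrib power2_eq_square)
    also have "(\<Sum>i<d. (w i x)\<^sup>2) = ?L x * ?L x" by (simp add: L2_set_def u_def sum_nonneg)
    finally show ?thesis using False by simp
  qed (simp add: \<psi>_def)
  have "(\<integral>x. ?L x \<partial>?D) = (\<Sum>i<d. \<integral>y. \<psi> i y * w i y \<partial>?D)"
    unfolding Lsum by (intro Bochner_Integration.integral_sum bd[of _ _ 1]) (use \<psi>m \<psi>b w in auto)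
  also have "\<dots> = (\<Sum>i<d. \<integral>x. \<psi> i (Y x) * V i x \<partial>M)"
    by (intro sum.cong refl w(3)[symmetric]) (use \<psi>m \<psi>b in auto)
  also have "\<dots> = (\<integral>x. (\<Sum>i<d. \<psi> i (Y x) * V i x) \<partial>M)"
    by (intro Bochner_Integration.integral_sum[symmetric] bd[of _ _ 1] measurable_compose[OF Y \<psi>m]) (use \<psi>b Vint in auto)
  also have "\<dots> \<le> (\<integral>x. L2_set (\<lambda>i. V i x) {..<d} \<partial>M)"
  proof (rule integral_mono)
    show "integrable M (\<lambda>x. \<Sum>i<d. \<psi> i (Y x) * V i x)"
      by (intro Bochner_Integration.integrable_sum bd[of _ _ 1] measurable_compose[OF Y \<psi>m]) (use \<psi>b Vint in auto)
    fix x
    have "(\<Sum>i<d. \<psi> i (Y x) * V i x) \<le> (\<Sum>i<d. \<bar>\<psi> i (Y x)\<bar> * \<bar>V i x\<bar>)" by (intro sum_mono) (simp flip: abs_mult)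
    also have "\<dots> \<le> L2_set (\<lambda>i. \<psi> i (Y x)) {..<d} * L2_set (\<lambda>i. V i x) {..<d}" by (rule L2_set_mult_ineq)
    also have "\<dots> \<le> 1 * L2_set (\<lambda>i. V i x) {..<d}" using \<psi>L by (intro mult_right_mono) (auto simp: L2_set_nonneg)
    finally show "(\<Sum>i<d. \<psi> i (Y x) * V i x) \<le> L2_set (\<lambda>i. V i x) {..<d}" by simp
  qed (rule V(2))
  finally have N': "(\<integral>x. ?L x \<partial>?D) \<le> N" using N by simp
  have eq': "(\<integral>x. (\<Sum>i<d. pderiv_at i (pderiv_at i \<phi>) x) + (\<Sum>i<d. (- x i + u x i) * pderiv_at i \<phi> x) \<partial>?D) = 0"
    if \<phi>: "test_fun_Rn d \<phi>" for \<phi>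
  proof -
    note sm = test_fun_smooth[OF \<phi>]
    have m2: "pderiv_at i (pderiv_at i \<phi>) \<in> borel_measurable ?P" if "i < d" for i
      using smooth_Rn_measurable[OF sm, of "[i,i]"] that by simp
    have m1: "pderiv_at i \<phi> \<in> borel_measurable ?P" if "i < d" for i
      using smooth_Rn_measurable[OF sm, of "[i]"] that by simp
    define A where "A x = (\<Sum>i<d. pderiv_at i (pderiv_at i \<phi>) x + (- x i) * pderiv_at i \<phi> x)" for x
    have Am: "A \<in> borel_measurable ?P"
      unfolding A_def[abs_def] by (intro borel_measurable_sum borel_measurable_add borel_measurable_times borel_measurable_uminus m1 m2) auto
    have Dint: "integrable M' (\<lambda>x. A (Z x))" if "prob_space M'" "Z \<in> measurable M' ?P" for M' :: "'z measure" and Z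
    proof -
      interpret M': prob_space M' by fact
      have Zs: "Z x \<in> Rn d" if "x \<in> space M'" for x using measurable_space[OF \<open>Z \<in> measurable M' ?P\<close> that] by (simp add: space_PiM)
      show ?thesis unfolding A_def
      proof (intro Bochner_Integration.integrable_sum Bochner_Integration.integrable_add)
        fix i assume i: "i \<in> {..<d}"
        obtain B where B: "\<And>x. x \<in> Rn d \<Longrightarrow> \<bar>1 * pderivs [i,i] \<phi> x\<bar> \<le> B"
          using test_fun_bounded[OF \<phi>, of "[i,i]" "\<lambda>_. 1"] i by (metis continuous_on_const empty_set empty_subsetI insert_subset lessThan_iff list.simps(15))
        show "integrable M' (\<lambda>x. pderiv_at i (pderiv_at i \<phi>) (Z x))"
          by (rule M'.integrable_const_bound[where B = B]) (use B Zs i in \<open>auto intro!: measurable_compose[OF that(2) m2]\<close>)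
        obtain B' where B': "\<And>x. x \<in> Rn d \<Longrightarrow> \<bar>(- x i) * pderivs [i] \<phi> x\<bar> \<le> B'"
          using test_fun_bounded[OF \<phi>, of "[i]" "\<lambda>x. - x i"] i
          by (metis continuous_on_minus continuous_on_product_coordinates empty_set empty_subsetI insert_subset lessThan_iff list.simps(15))
        show "integrable M' (\<lambda>x. (- Z x i) * pderiv_at i \<phi> (Z x))"
        proof (rule M'.integrable_const_bound[where B = B'])
          show "AE x in M'. norm ((- Z x i) * pderiv_at i \<phi> (Z x)) \<le> B'" using B' Zs by (intro AE_I2) auto
          show "(\<lambda>x. (- Z x i) * pderiv_at i \<phi> (Z x)) \<in> borel_measurable M'"
            using i by (intro borel_measurable_times borel_measurable_uminus measurable_compose[OF that(2) m1] measurable_compose[OF that(2) measurable_component_singleton]) auto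
        qed
      qed
    qed
    have b1: "\<exists>B>0. \<forall>x\<in>Rn d. \<bar>pderiv_at i \<phi> x\<bar> \<le> B" if i: "i < d" for i
    proof -
      obtain B where "0 \<le> B" "\<And>x. x \<in> Rn d \<Longrightarrow> \<bar>1 * pderivs [i] \<phi> x\<bar> \<le> B"
        using test_fun_bounded[OF \<phi>, of "[i]" "\<lambda>_. 1"] i by (metis continuous_on_const empty_set empty_subsetI insert_subset lessThan_iff list.simps(15))
      then show ?thesis by (intro exI[of _ "B + 1"]) fastforce
    qed
    then obtain B where B: "\<And>i. i < d \<Longrightarrow> 0 < B i" "\<And>i x. i < d \<Longrightarrow> x \<in> Rn d \<Longrightarrow> \<bar>pderiv_at i \<phi> x\<bar> \<le> B i" by metis
    have Ys: "Y x \<in> Rn d" if "x \<in> space M" for x using measurable_space[OF Y that] by (simp add: space_PiM)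
    have i1: "integrable ?D (\<lambda>x. pderiv_at i \<phi> x * w i x)" if i: "i < d" for i
      by (rule bd[of _ _ "B i"]) (use m1 B w i in \<open>auto simp: space_PiM\<close>)
    have i2: "integrable M (\<lambda>x. pderiv_at i \<phi> (Y x) * V i x)" if i: "i < d" for i
      by (rule bd[of _ _ "B i"]) (use B Vint i Ys in \<open>auto intro!: measurable_compose[OF Y m1]\<close>)
    have e: "(\<integral>x. pderiv_at i \<phi> x * w i x \<partial>?D) = (\<integral>x. pderiv_at i \<phi> (Y x) * V i x \<partial>M)" if i: "i < d" for i
    proof -
      \<comment> \<open>The truncation makes the bound 1 hold for all arguments, also off the
        carrier, where nothing is known about \<open>\<phi>\<close>; on the carrier it changes
        nothing.\<close>
      define \<theta> where "\<theta> x = max (-1) (min 1 (pderiv_at i \<phi> x / B i))" for x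
      have \<theta>m: "\<theta> \<in> borel_measurable ?P" unfolding \<theta>_def using m1[OF i] by measurable
      have \<theta>b: "\<bar>\<theta> x\<bar> \<le> 1" for x by (auto simp: \<theta>_def)
      have \<theta>e: "pderiv_at i \<phi> x = B i * \<theta> x" if "x \<in> Rn d" for x
      proof -
        have "\<bar>pderiv_at i \<phi> x / B i\<bar> \<le> 1" using B(1)[OF i] B(2)[OF i that] by (simp add: divide_le_eq)
        then have "\<theta> x = pderiv_at i \<phi> x / B i" unfolding \<theta>_def by linarith
        then show ?thesis using B(1)[OF i] by simp
      qed
      have "(\<integral>x. pderiv_at i \<phi> x * w i x \<partial>?D) = (\<integral>x. B i * (\<theta> x * w i x) \<partial>?D)"
        by (intro Bochner_Integration.integral_cong) (auto simp: space_PiM \<theta>e)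
      also have "\<dots> = (\<integral>x. B i * (\<theta> (Y x) * V i x) \<partial>M)" using w(3)[OF i \<theta>m \<theta>b] by simp
      also have "\<dots> = (\<integral>x. pderiv_at i \<phi> (Y x) * V i x \<partial>M)"
        by (intro Bochner_Integration.integral_cong) (auto simp: Ys \<theta>e)
      finally show ?thesis .
    qed
    have "(\<integral>x. (\<Sum>i<d. pderiv_at i (pderiv_at i \<phi>) x) + (\<Sum>i<d. (- x i + u x i) * pderiv_at i \<phi> x) \<partial>?D)
        = (\<integral>x. A x + (\<Sum>i<d. pderiv_at i \<phi> x * w i x) \<partial>?D)"
      by (intro Bochner_Integration.integral_cong refl) (simp add: A_def u_def algebra_simps sum.distrib sum_subtractf)
    also have "\<dots> = (\<integral>x. A x \<partial>?D) + (\<Sum>i<d. \<integral>x. pderiv_at i \<phi> x * w i x \<partial>?D)"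
      using Dint[OF D.prob_space_axioms, of "\<lambda>x. x"] i1
      by (subst Bochner_Integration.integral_add) (auto simp: Bochner_Integration.integral_sum)
    also have "\<dots> = (\<integral>x. A (Y x) \<partial>M) + (\<Sum>i<d. \<integral>x. pderiv_at i \<phi> (Y x) * V i x \<partial>M)"
      using Am e by (simp add: integral_distr)
    also have "\<dots> = (\<integral>x. A (Y x) + (\<Sum>i<d. pderiv_at i \<phi> (Y x) * V i x) \<partial>M)"
      using Dint[OF M Y] i2 by (subst Bochner_Integration.integral_add) (auto simp: Bochner_Integration.integral_sum)
    also have "\<dots> = (\<integral>x. (\<Sum>i<d. pderiv_at i (pderiv_at i \<phi>) (Y x)) + (\<Sum>i<d. (- Y x i + V i x) * pderiv_at i \<phi> (Y x)) \<partial>M)"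
      by (intro Bochner_Integration.integral_cong refl) (simp add: A_def algebra_simps sum.distrib sum_subtractf)
    also have "\<dots> = 0" by (rule eq[OF \<phi>])
    finally show ?thesis .
  qed
  let ?N = "\<integral>x. ?L x \<partial>?D"
  have "(\<integral>\<^sup>+x. ennreal (g x * ln (g x + 1) powr \<alpha>) \<partial>std_gauss d) \<le> ennreal (C * (1 + ?N * ln (1 + ?N) powr \<alpha>))"
    using FD[unfolded FD_estimate_def Let_def, rule_format, OF d _ _ law] g D.prob_space_axioms w(1) Lint eq'
    by (simp add: u_def measurable_cong_sets[OF sets_std_gauss refl])
  \<comment> \<open>Passing from the norm of \<open>u\<close> to its bound \<open>N\<close> is
    monotonicity, which rests on the lower bound for the exponent.\<close>
  also have "\<dots> \<le> ennreal (C * (1 + N * ln (1 + N) powr \<alpha>))"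
  proof (intro ennreal_leI mult_left_mono add_left_mono log_bound_mono[OF FD_estimate_exponent[OF FD] _ N'])
    show "0 \<le> ?N" by (intro Bochner_Integration.integral_nonneg) (simp add: L2_set_nonneg)
    show "0 \<le> C" using FD_estimate_ge[OF FD] by (smt (verit) powr_ge_zero)
  qed
  finally show ?thesis .
qed


section \<open>Smoothing and cylindrical sets\<close>

lemma std_gauss_component: "i < d \<Longrightarrow> (\<lambda>z. z i) \<in> borel_measurable (std_gauss d)"
  by (simp add: measurable_cong_sets[OF sets_std_gauss refl])

text \<open>The normal law with mean \<open>a\<close> and deviation \<open>\<epsilon>\<close>,
  written with a density relative to \<open>gauss1\<close> instead of Lebesgue measure, since the
  reference measure of the estimate is Gaussian.\<close>

lemma gauss1_affine:
  assumes e: "0 < \<epsilon>" and B[measurable]: "B \<in> sets borel"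
  shows "emeasure gauss1 ((\<lambda>t. a + \<epsilon> * t) -` B) =
    (\<integral>\<^sup>+t. ennreal (normal_density a \<epsilon> t / std_normal_density t) * indicator B t \<partial>gauss1)"
proof -
  have dens: "\<epsilon> * normal_density a \<epsilon> (a + \<epsilon> * t) = std_normal_density t" for t
    using e by (simp add: normal_density_def real_sqrt_mult field_simps power_mult_distrib)
  have pos: "std_normal_density t > 0" for t by (rule normal_density_pos) simp
  have "(\<integral>\<^sup>+t. ennreal (normal_density a \<epsilon> t / std_normal_density t) * indicator B t \<partial>gauss1)
      = (\<integral>\<^sup>+t. ennreal (normal_density a \<epsilon> t) * indicator B t \<partial>lborel)"
  proof (subst nn_integral_density)
    show "(\<integral>\<^sup>+t. ennreal (std_normal_density t) * (ennreal (normal_density a \<epsilon> t / std_normal_density t) * indicator B t) \<partial>lborel)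
      = (\<integral>\<^sup>+t. ennreal (normal_density a \<epsilon> t) * indicator B t \<partial>lborel)"
    proof (rule nn_integral_cong)
      fix t
      have "ennreal (std_normal_density t) * ennreal (normal_density a \<epsilon> t / std_normal_density t) = ennreal (normal_density a \<epsilon> t)"
        using pos[of t] by (simp add: ennreal_mult'[symmetric])
      then show "ennreal (std_normal_density t) * (ennreal (normal_density a \<epsilon> t / std_normal_density t) * indicator B t)
          = ennreal (normal_density a \<epsilon> t) * indicator B t"
        by (simp add: mult.assoc[symmetric])
    qed
  qed measurable
  also have "\<dots> = ennreal \<bar>\<epsilon>\<bar> * (\<integral>\<^sup>+t. ennreal (normal_density a \<epsilon> (a + \<epsilon> * t)) * indicator B (a + \<epsilon> * t) \<partial>lborel)"
    using e by (intro nn_integral_real_affine) auto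
  also have "\<dots> = (\<integral>\<^sup>+t. ennreal \<epsilon> * (ennreal (normal_density a \<epsilon> (a + \<epsilon> * t)) * indicator B (a + \<epsilon> * t)) \<partial>lborel)"
    using e by (subst nn_integral_cmult) auto
  also have "\<dots> = (\<integral>\<^sup>+t. ennreal (std_normal_density t) * indicator ((\<lambda>t. a + \<epsilon> * t) -` B) t \<partial>lborel)"
    using e by (intro nn_integral_cong) (auto simp: mult.assoc[symmetric] ennreal_mult'[symmetric] dens indicator_def)
  also have "\<dots> = emeasure gauss1 ((\<lambda>t. a + \<epsilon> * t) -` B)"
    using measurable_sets[of "\<lambda>t. a + \<epsilon> * t" borel borel B] B by (subst emeasure_density) auto
  finally show ?thesis by simp
qed

lemma measurable_shift_Rn:
  assumes "P \<in> measurable M (PiM {..<d} (\<lambda>_. borel))"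
  shows "(\<lambda>p. shift_Rn d (\<lambda>i. \<epsilon> * snd p i) (P (fst p))) \<in> measurable (M \<Otimes>\<^sub>M std_gauss d) (PiM {..<d} (\<lambda>_. borel))"
  unfolding shift_Rn_def
proof (rule measurable_restrict)
  fix i assume "i \<in> {..<d}"
  then have i: "i < d" by simp
  have [measurable]: "(\<lambda>x. P x i) \<in> borel_measurable M"
    using measurable_compose[OF assms measurable_component_singleton[of i]] i by simp
  note [measurable] = std_gauss_component[OF i]
  show "(\<lambda>p. P (fst p) i + \<epsilon> * snd p i) \<in> borel_measurable (M \<Otimes>\<^sub>M std_gauss d)" by measurable
qed

text \<open>Boxes factorize, so the image measure has the product of the one-dimensional densities
  relative to \<open>std_gauss d\<close>.\<close>

lemma std_gauss_shift_scale:
  assumes e: "0 < \<epsilon>"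
  shows "absolutely_continuous (std_gauss d) (distr (std_gauss d) (PiM {..<d} (\<lambda>_. borel)) (\<lambda>z. shift_Rn d (\<lambda>i. \<epsilon> * z i) a))"
proof -
  interpret product_prob_space "\<lambda>_::nat. gauss1" by (rule product_prob_space_gauss1)
  let ?P = "PiM {..<d} (\<lambda>_. borel :: real measure)"
  define q where "q i t = ennreal (normal_density (a i) \<epsilon> t / std_normal_density t)" for i t
  have q[measurable]: "q i \<in> borel_measurable borel" for i unfolding q_def by measurable
  let ?Q = "\<lambda>z. \<Prod>i<d. q i (z i)"
  have Q: "?Q \<in> borel_measurable (std_gauss d)"
    by (intro borel_measurable_prod_ennreal measurable_compose[OF std_gauss_component q]) simp
  have sh: "(\<lambda>z. shift_Rn d (\<lambda>i. \<epsilon> * z i) a) \<in> measurable (std_gauss d) ?P"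
    unfolding shift_Rn_def
  proof (rule measurable_restrict)
    fix i assume "i \<in> {..<d}"
    then have [measurable]: "(\<lambda>z. z i) \<in> borel_measurable (std_gauss d)" by (intro std_gauss_component) simp
    show "(\<lambda>z. a i + \<epsilon> * z i) \<in> borel_measurable (std_gauss d)" by measurable
  qed
  have "distr (std_gauss d) ?P (\<lambda>z. shift_Rn d (\<lambda>i. \<epsilon> * z i) a) = density (std_gauss d) ?Q"
  proof (rule measure_eqI_PiM_finite[where A = "\<lambda>_. Rn d"])
    fix B assume "\<And>i. i \<in> {..<d} \<Longrightarrow> B i \<in> sets (borel :: real measure)"
    then have B: "\<And>i. i < d \<Longrightarrow> B i \<in> sets borel" by simp
    have Bs: "Pi\<^sub>E {..<d} B \<in> sets ?P" using B by (intro sets_PiM_I_finite) auto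
    have vB: "(\<lambda>t. a i + \<epsilon> * t) -` B i \<in> sets borel" if "i < d" for i
      using measurable_sets[of "\<lambda>t. a i + \<epsilon> * t" borel borel "B i"] B[OF that] by simp
    have "emeasure (distr (std_gauss d) ?P (\<lambda>z. shift_Rn d (\<lambda>i. \<epsilon> * z i) a)) (Pi\<^sub>E {..<d} B)
        = emeasure (std_gauss d) ((\<lambda>z. shift_Rn d (\<lambda>i. \<epsilon> * z i) a) -` Pi\<^sub>E {..<d} B \<inter> Rn d)"
      using Bs sh by (simp add: emeasure_distr)
    also have "(\<lambda>z. shift_Rn d (\<lambda>i. \<epsilon> * z i) a) -` Pi\<^sub>E {..<d} B \<inter> Rn d = Pi\<^sub>E {..<d} (\<lambda>i. (\<lambda>t. a i + \<epsilon> * t) -` B i)"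
      by (auto simp: shift_Rn_def PiE_iff extensional_def)
    also have "emeasure (std_gauss d) \<dots> = (\<Prod>i<d. emeasure gauss1 ((\<lambda>t. a i + \<epsilon> * t) -` B i))"
      unfolding std_gauss_def using vB by (intro emeasure_PiM) auto
    also have "\<dots> = (\<Prod>i<d. \<integral>\<^sup>+t. q i t * indicator (B i) t \<partial>gauss1)"
      unfolding q_def using e B by (intro prod.cong refl gauss1_affine) auto
    also have "\<dots> = (\<integral>\<^sup>+z. (\<Prod>i<d. q i (z i) * indicator (B i) (z i)) \<partial>std_gauss d)"
      unfolding std_gauss_def
    proof (rule product_nn_integral_prod[symmetric])
      show "(\<lambda>t. q i t * indicator (B i) t) \<in> borel_measurable gauss1" if "i \<in> {..<d}" for i
      proof -
        note [measurable] = B[of i]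
        show ?thesis using that by (simp add: borel_measurable_times_ennreal borel_measurable_indicator B)
      qed
    qed simp
    also have "\<dots> = (\<integral>\<^sup>+z. ?Q z * indicator (Pi\<^sub>E {..<d} B) z \<partial>std_gauss d)"
    proof (rule nn_integral_cong)
      fix z assume z: "z \<in> space (std_gauss d)"
      have "(\<Prod>i<d. indicator (B i) (z i)) = (indicator (Pi\<^sub>E {..<d} B) z :: ennreal)"
        using z by (auto simp: indicator_def PiE_iff)
      then show "(\<Prod>i<d. q i (z i) * indicator (B i) (z i)) = ?Q z * indicator (Pi\<^sub>E {..<d} B) z"
        by (simp add: prod.distrib)
    qed
    also have "\<dots> = emeasure (density (std_gauss d) ?Q) (Pi\<^sub>E {..<d} B)"
      using Bs Q by (simp add: emeasure_density)
    finally show "emeasure (distr (std_gauss d) ?P (\<lambda>z. shift_Rn d (\<lambda>i. \<epsilon> * z i) a)) (Pi\<^sub>E {..<d} B)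
        = emeasure (density (std_gauss d) ?Q) (Pi\<^sub>E {..<d} B)" .
  next
    show "range (\<lambda>_. Rn d) \<subseteq> prod_algebra {..<d} (\<lambda>_. borel :: real measure)"
      using prod_algebraI_finite[of "{..<d}" "\<lambda>_. UNIV" "\<lambda>_. borel :: real measure"] by auto
    show "emeasure (distr (std_gauss d) ?P (\<lambda>z. shift_Rn d (\<lambda>i. \<epsilon> * z i) a)) (Rn d) \<noteq> \<infinity>"
      using prob_space.finite_measure[OF prob_space.prob_space_distr[OF prob_space_std_gauss sh]]
      by (rule finite_measure.emeasure_finite[unfolded infinity_ennreal_def[symmetric]])
  qed (auto simp: space_PiM)
  then show ?thesis using absolutely_continuousI_density[OF Q] by simp
qed

lemma std_gauss_real_density:
  assumes D: "prob_space D" "sets D = sets (PiM {..<d} (\<lambda>_. borel))" and ac: "absolutely_continuous (std_gauss d) D"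
  obtains g where "g \<in> borel_measurable (PiM {..<d} (\<lambda>_. borel))" "\<And>x. 0 \<le> g x"
    "D = density (std_gauss d) (\<lambda>x. ennreal (g x))"
proof -
  interpret G: prob_space "std_gauss d" by (rule prob_space_std_gauss)
  interpret D: prob_space D by fact
  let ?r = "RN_deriv (std_gauss d) D"
  have sets: "sets D = sets (std_gauss d)" using D(2) by simp
  have "AE x in std_gauss d. ?r x \<noteq> \<infinity>"
    by (rule G.RN_deriv_finite[OF D.sigma_finite_measure_axioms ac sets])
  then have ae: "AE x in std_gauss d. ?r x = ennreal (enn2real (?r x))" by eventually_elim (simp add: less_top)
  have r: "?r \<in> borel_measurable (std_gauss d)" by (rule borel_measurable_RN_deriv)
  show ?thesis
  proof (rule that[of "\<lambda>x. enn2real (?r x)"])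
    show "(\<lambda>x. enn2real (?r x)) \<in> borel_measurable (PiM {..<d} (\<lambda>_. borel))"
      using borel_measurable_enn2real[OF r] by (simp only: measurable_cong_sets[OF sets_std_gauss refl])
    show "D = density (std_gauss d) (\<lambda>x. ennreal (enn2real (?r x)))"
      using density_cong[OF r _ ae] r G.density_RN_deriv[OF ac sets] by simp
  qed simp
qed

text \<open>For each fixed value of \<open>P\<close> the law of the sum is absolutely continuous,
  and Fubini carries this over to the mixture; nothing is assumed about the law of
  \<open>P\<close>.\<close>

lemma smoothing_density:
  assumes M: "prob_space M" and P: "P \<in> measurable M (PiM {..<d} (\<lambda>_. borel))" and e: "0 < \<epsilon>"
  obtains g where "g \<in> borel_measurable (PiM {..<d} (\<lambda>_. borel))" "\<And>x. 0 \<le> g x"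
    "distr (M \<Otimes>\<^sub>M std_gauss d) (PiM {..<d} (\<lambda>_. borel)) (\<lambda>p. shift_Rn d (\<lambda>i. \<epsilon> * snd p i) (P (fst p)))
      = density (std_gauss d) (\<lambda>x. ennreal (g x))"
proof -
  interpret M: prob_space M by fact
  interpret G: prob_space "std_gauss d" by (rule prob_space_std_gauss)
  interpret pair_prob_space M "std_gauss d" ..
  let ?P = "PiM {..<d} (\<lambda>_. borel :: real measure)"
  let ?Y = "\<lambda>p. shift_Rn d (\<lambda>i. \<epsilon> * snd p i) (P (fst p))"
  let ?D = "distr (M \<Otimes>\<^sub>M std_gauss d) ?P ?Y"
  note Y = measurable_shift_Rn[OF P, of \<epsilon>]
  interpret D: prob_space ?D by (rule prob_space_distr[OF Y])
  have ac: "absolutely_continuous (std_gauss d) ?D"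
    unfolding absolutely_continuous_def
  proof
    fix A assume A: "A \<in> null_sets (std_gauss d)"
    then have As[measurable]: "A \<in> sets ?P" by auto
    have z: "(\<integral>\<^sup>+z. indicator A (?Y (x, z)) \<partial>std_gauss d) = 0" if x: "x \<in> space M" for x
    proof -
      have m: "(\<lambda>z. shift_Rn d (\<lambda>i. \<epsilon> * z i) (P x)) \<in> measurable (std_gauss d) ?P"
        using measurable_compose[OF measurable_Pair1'[OF x] Y] by simp
      have "A \<in> null_sets (distr (std_gauss d) ?P (\<lambda>z. shift_Rn d (\<lambda>i. \<epsilon> * z i) (P x)))"
        using std_gauss_shift_scale[OF e, of d "P x"] A by (auto simp: absolutely_continuous_def)
      then have "0 = (\<integral>\<^sup>+y. indicator A y \<partial>distr (std_gauss d) ?P (\<lambda>z. shift_Rn d (\<lambda>i. \<epsilon> * z i) (P x)))"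
        by (simp add: null_sets_def)
      also have "\<dots> = (\<integral>\<^sup>+z. indicator A (?Y (x, z)) \<partial>std_gauss d)"
        by (subst nn_integral_distr[OF m]) auto
      finally show ?thesis by simp
    qed
    have m: "(\<lambda>p. indicator A (?Y p) :: ennreal) \<in> borel_measurable (M \<Otimes>\<^sub>M std_gauss d)"
      by (rule measurable_compose[OF Y]) simp
    have "emeasure ?D A = (\<integral>\<^sup>+y. indicator A y \<partial>?D)" using As by simp
    also have "\<dots> = (\<integral>\<^sup>+p. indicator A (?Y p) \<partial>(M \<Otimes>\<^sub>M std_gauss d))"
      using As by (subst nn_integral_distr[OF Y]) auto
    also have "\<dots> = (\<integral>\<^sup>+x. \<integral>\<^sup>+z. indicator A (?Y (x, z)) \<partial>std_gauss d \<partial>M)"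
      by (rule G.nn_integral_fst[symmetric, OF m])
    also have "\<dots> = (\<integral>\<^sup>+x. 0 \<partial>M)" by (rule nn_integral_cong) (rule z)
    finally show "A \<in> null_sets ?D" using As by (auto simp: null_sets_def)
  qed
  show ?thesis
    by (rule std_gauss_real_density[OF D.prob_space_axioms _ ac]) (simp, rule that)
qed

text \<open>Fatou's lemma: on \<open>A\<close> the indicators of \<open>Y n \<in> B\<close> are
  eventually 1. It serves both for noise shrinking to 0 with \<open>B\<close> open and for laws that
  escape to infinity.\<close>

lemma emeasure_le_of_eventually_mem:
  assumes M: "prob_space M" and G: "prob_space G" and A: "A \<in> sets M" and B: "B \<in> sets N"
    and Y: "\<And>n. Y n \<in> measurable (M \<Otimes>\<^sub>M G) N"
    and ev: "\<And>p. fst p \<in> A \<Longrightarrow> \<forall>\<^sub>F n in sequentially. Y n p \<in> B"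
    and le: "\<And>n. emeasure (distr (M \<Otimes>\<^sub>M G) N (Y n)) B \<le> \<delta>"
  shows "emeasure M A \<le> \<delta>"
proof -
  interpret G: prob_space G by fact
  have "emeasure M A = (\<integral>\<^sup>+x. indicator A x \<partial>distr (M \<Otimes>\<^sub>M G) M fst)"
    unfolding G.distr_pair_fst using A by simp
  also have "\<dots> = (\<integral>\<^sup>+p. indicator A (fst p) \<partial>(M \<Otimes>\<^sub>M G))"
    by (rule nn_integral_distr) (use A in simp_all)
  also have "\<dots> \<le> (\<integral>\<^sup>+p. liminf (\<lambda>n. indicator B (Y n p)) \<partial>(M \<Otimes>\<^sub>M G))"
  proof (rule nn_integral_mono)
    fix p
    show "indicator A (fst p) \<le> liminf (\<lambda>n. indicator B (Y n p) :: ennreal)"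
    proof (cases "fst p \<in> A")
      case True
      have "\<forall>\<^sub>F n in sequentially. 1 \<le> (indicator B (Y n p) :: ennreal)"
        using ev[OF True] by eventually_elim simp
      then show ?thesis using True by (simp add: Liminf_bounded)
    qed simp
  qed
  also have "\<dots> \<le> liminf (\<lambda>n. \<integral>\<^sup>+p. indicator B (Y n p) \<partial>(M \<Otimes>\<^sub>M G))"
    by (rule nn_integral_liminf) (rule measurable_compose[OF Y], use B in simp)
  also have "\<dots> \<le> \<delta>"
  proof (rule Liminf_le[OF sequentially_bot always_eventually], rule allI)
    fix n
    have "(\<integral>\<^sup>+p. indicator B (Y n p) \<partial>(M \<Otimes>\<^sub>M G)) = (\<integral>\<^sup>+y. indicator B y \<partial>distr (M \<Otimes>\<^sub>M G) N (Y n))"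
      by (rule nn_integral_distr[OF Y, symmetric]) (use B in simp)
    then show "(\<integral>\<^sup>+p. indicator B (Y n p) \<partial>(M \<Otimes>\<^sub>M G)) \<le> \<delta>" using B le[of n] by simp
  qed
  finally show ?thesis .
qed

text \<open>The de la Vallee Poussin criterion in quantitative form. The bound \<open>\<eta>\<close>
  is fixed before the measure and the density, so it serves all dimensions at once.\<close>

lemma entropy_uniform_integrability:
  fixes \<beta> K \<delta> :: real
  assumes \<beta>: "0 < \<beta>" and \<delta>: "0 < \<delta>"
  obtains \<eta> where "0 < \<eta>" "\<And>(M :: 'a measure) g B. g \<in> borel_measurable M \<Longrightarrow> (\<And>x. 0 \<le> g x) \<Longrightarrow>
      (\<integral>\<^sup>+x. ennreal (g x * ln (g x + 1) powr \<beta>) \<partial>M) \<le> ennreal K \<Longrightarrow> B \<in> sets M \<Longrightarrow> emeasure M B \<le> ennreal \<eta> \<Longrightarrow>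
      emeasure (density M (\<lambda>x. ennreal (g x))) B \<le> ennreal \<delta>"
proof -
  define K' where "K' = max K 0"
  \<comment> \<open>Where \<open>g > R\<close> the logarithmic factor is at least \<open>A\<close>,
    and that part of the mass is at most \<open>K' / A \<le> \<delta> / 2\<close>; the summand 1
    makes \<open>A\<close> positive even for \<open>K' = 0\<close>. On \<open>B\<close> the part
    with \<open>g \<le> R\<close> contributes at most
    \<open>R \<eta> = \<delta> / 2\<close>.\<close>
  define A where "A = 2 * K' / \<delta> + 1"
  define R where "R = exp (A powr (1 / \<beta>)) - 1"
  have A: "A \<ge> 1" using \<delta> by (simp add: A_def K'_def)
  then have R: "R > 0" by (simp add: R_def)
  have lnR: "ln (R + 1) powr \<beta> = A" using A \<beta> by (simp add: R_def powr_powr)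
  define \<eta> where "\<eta> = \<delta> / (2 * R)"
  show ?thesis
  proof (rule that[of \<eta>])
    show "0 < \<eta>" using R \<delta> by (simp add: \<eta>_def)
    fix M :: "'a measure" and g B
    assume g[measurable]: "g \<in> borel_measurable M" and nn: "\<And>x. 0 \<le> g x"
      and ent: "(\<integral>\<^sup>+x. ennreal (g x * ln (g x + 1) powr \<beta>) \<partial>M) \<le> ennreal K"
      and B[measurable]: "B \<in> sets M" and small: "emeasure M B \<le> ennreal \<eta>"
    have pt: "ennreal (g x) * indicator B x \<le> ennreal R * indicator B x + ennreal (1 / A) * ennreal (g x * ln (g x + 1) powr \<beta>)" for x
    proof -
      have "g x \<le> R + 1 / A * (g x * ln (g x + 1) powr \<beta>)"
      proof (cases "g x \<le> R")
        case True
        have "0 \<le> 1 / A * (g x * ln (g x + 1) powr \<beta>)" using A nn[of x] by simp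
        with True show ?thesis by linarith
      next
        case False
        then have "A \<le> ln (g x + 1) powr \<beta>"
          unfolding lnR[symmetric] using R \<beta> by (intro powr_mono2) auto
        then have "g x * A \<le> g x * ln (g x + 1) powr \<beta>" by (rule mult_left_mono) (rule nn)
        then have "g x \<le> 1 / A * (g x * ln (g x + 1) powr \<beta>)" using A by (simp add: field_simps)
        then show ?thesis using R by linarith
      qed
      moreover have "0 \<le> 1 / A * (g x * ln (g x + 1) powr \<beta>)" using A nn[of x] by simp
      ultimately show ?thesis
        using R A nn[of x] by (auto simp: indicator_def ennreal_mult'[symmetric] simp flip: ennreal_plus intro!: ennreal_leI)
    qed
    have "emeasure (density M (\<lambda>x. ennreal (g x))) B = (\<integral>\<^sup>+x. ennreal (g x) * indicator B x \<partial>M)"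
      by (rule emeasure_density) auto
    also have "\<dots> \<le> (\<integral>\<^sup>+x. ennreal R * indicator B x + ennreal (1 / A) * ennreal (g x * ln (g x + 1) powr \<beta>) \<partial>M)"
      by (intro nn_integral_mono pt)
    also have "\<dots> = ennreal R * emeasure M B + ennreal (1 / A) * (\<integral>\<^sup>+x. ennreal (g x * ln (g x + 1) powr \<beta>) \<partial>M)"
      by (subst nn_integral_add) (auto simp: nn_integral_cmult nn_integral_cmult_indicator)
    also have "\<dots> \<le> ennreal R * ennreal \<eta> + ennreal (1 / A) * ennreal K'"
    proof (intro add_mono mult_left_mono small)
      show "(\<integral>\<^sup>+x. ennreal (g x * ln (g x + 1) powr \<beta>) \<partial>M) \<le> ennreal K'"
        using ent by (rule order_trans) (simp add: K'_def ennreal_leI)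
    qed auto
    also have "\<dots> = ennreal (R * \<eta> + 1 / A * K')"
    proof -
      have "0 \<le> K'" "0 \<le> R * \<eta>" using R \<delta> by (auto simp: K'_def \<eta>_def)
      then show ?thesis using R A by (simp add: ennreal_mult'[symmetric] ennreal_plus[symmetric] del: ennreal_plus)
    qed
    also have "\<dots> \<le> ennreal \<delta>"
    proof (rule ennreal_leI)
      have "1 / A * K' \<le> \<delta> / 2" using A \<delta> by (simp add: A_def K'_def field_simps)
      moreover have "R * \<eta> = \<delta> / 2" using R by (simp add: \<eta>_def)
      ultimately show "R * \<eta> + 1 / A * K' \<le> \<delta>" by linarith
    qed
    finally show "emeasure (density M (\<lambda>x. ennreal (g x))) B \<le> ennreal \<delta>" .
  qed
qed

section \<open>Cylindrical open sets\<close>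

definition determined :: "('a \<Rightarrow> real) set \<Rightarrow> 'a set \<Rightarrow> bool" where
  "determined L W \<longleftrightarrow> (\<forall>x y. (\<forall>l\<in>L. l x = l y) \<longrightarrow> x \<in> W \<longrightarrow> y \<in> W)"

lemma determinedD: "determined L W \<Longrightarrow> (\<And>l. l \<in> L \<Longrightarrow> l x = l y) \<Longrightarrow> x \<in> W \<Longrightarrow> y \<in> W"
  unfolding determined_def by blast

text \<open>Openness refers to \<open>X\<close>; the finitely many functionals are existentially
  quantified, so that finite unions and intersections only have to collect them.\<close>

definition cyl_open :: "'a::locally_convex_space set \<Rightarrow> bool" where
  "cyl_open W \<longleftrightarrow> open W \<and> (\<exists>L. finite L \<and> L \<subseteq> top_dual \<and> determined L W)"

lemma cyl_open_UN:
  assumes "finite F" "\<And>i. i \<in> F \<Longrightarrow> cyl_open (W i)"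
  shows "cyl_open (\<Union>i\<in>F. W i)"
proof -
  obtain L where L: "\<And>i. i \<in> F \<Longrightarrow> finite (L i) \<and> L i \<subseteq> top_dual \<and> determined (L i) (W i)"
    using assms(2) unfolding cyl_open_def by metis
  have "determined (\<Union>(L ` F)) (\<Union>i\<in>F. W i)"
    unfolding determined_def
  proof (intro allI impI)
    fix x y assume eq: "\<forall>l\<in>\<Union>(L ` F). l x = l y" and "x \<in> (\<Union>i\<in>F. W i)"
    then obtain i where i: "i \<in> F" "x \<in> W i" by blast
    have "y \<in> W i" by (rule determinedD[OF _ _ i(2)]) (use L[OF i(1)] eq i(1) in blast)+
    then show "y \<in> (\<Union>i\<in>F. W i)" using i(1) by blast
  qed
  moreover have "open (\<Union>i\<in>F. W i)" using assms(2) by (auto simp: cyl_open_def)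
  moreover have "finite (\<Union>(L ` F))" "\<Union>(L ` F) \<subseteq> top_dual" using L assms(1) by auto
  ultimately show ?thesis unfolding cyl_open_def by blast
qed

lemma cyl_open_INT:
  assumes "finite F" "\<And>i. i \<in> F \<Longrightarrow> cyl_open (W i)"
  shows "cyl_open (\<Inter>i\<in>F. W i)"
proof -
  obtain L where L: "\<And>i. i \<in> F \<Longrightarrow> finite (L i) \<and> L i \<subseteq> top_dual \<and> determined (L i) (W i)"
    using assms(2) unfolding cyl_open_def by metis
  have "determined (\<Union>(L ` F)) (\<Inter>i\<in>F. W i)"
    unfolding determined_def
  proof (intro allI impI INT_I)
    fix x y i assume eq: "\<forall>l\<in>\<Union>(L ` F). l x = l y" and x: "x \<in> (\<Inter>i\<in>F. W i)" and i: "i \<in> F"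
    have "x \<in> W i" using x i by blast
    then show "y \<in> W i" by (rule determinedD[rotated 2]) (use L[OF i] eq i in blast)+
  qed
  moreover have "open (\<Inter>i\<in>F. W i)" using assms by (intro open_INT) (auto simp: cyl_open_def)
  moreover have "finite (\<Union>(L ` F))" "\<Union>(L ` F) \<subseteq> top_dual" using L assms(1) by auto
  ultimately show ?thesis unfolding cyl_open_def by blast
qed

lemma cyl_open_halfspace:
  assumes l: "l \<in> top_dual" shows "cyl_open {x. l x < c}" "cyl_open {x. c < l x}"
proof -
  have "open {x. l x < c}" "open {x. c < l x}"
    by (intro open_Collect_less top_dual_continuous[OF l] continuous_on_const)+
  then show "cyl_open {x. l x < c}" "cyl_open {x. c < l x}"
    unfolding cyl_open_def using l by (auto intro!: exI[of _ "{l}"] simp: determined_def)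
qed

text \<open>The classical two-stage separation of compact sets in a Hausdorff space, started from
  disjoint half-spaces. Each stage keeps the opposite neighbourhood along, because a finite
  intersection on one side is paired with a finite union on the other.\<close>

lemma separate_compact_cyl:
  fixes S K :: "'a::locally_convex_space set"
  assumes S: "compact S" and K: "compact K" and disj: "S \<inter> K = {}"
  obtains W where "cyl_open W" "S \<subseteq> W" "W \<inter> K = {}"
proof -
  have 1: "\<exists>W W'. cyl_open W \<and> cyl_open W' \<and> x \<in> W \<and> K \<subseteq> W' \<and> W \<inter> W' = {}" if x: "x \<in> S" for x
  proof -
    have "\<exists>W W'. cyl_open W \<and> cyl_open W' \<and> x \<in> W \<and> y \<in> W' \<and> W \<inter> W' = {}" if y: "y \<in> K" for y
    proof -
      have "x \<noteq> y" using x y disj by auto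
      then obtain l where l: "l \<in> top_dual" "l x < l y" by (rule top_dual_separates)
      obtain c where "l x < c" "c < l y" using dense[OF l(2)] by blast
      then show ?thesis
        by (intro exI[of _ "{z. l z < c}"] exI[of _ "{z. c < l z}"])
           (use cyl_open_halfspace[OF l(1)] in auto)
    qed
    then obtain A B where AB: "\<And>y. y \<in> K \<Longrightarrow> cyl_open (A y) \<and> cyl_open (B y) \<and> x \<in> A y \<and> y \<in> B y \<and> A y \<inter> B y = {}"
      by metis
    have oB: "\<And>y. y \<in> K \<Longrightarrow> open (B y)" and cB: "K \<subseteq> (\<Union>y\<in>K. B y)"
      using AB unfolding cyl_open_def by blast+
    obtain F where F: "F \<subseteq> K" "finite F" "K \<subseteq> (\<Union>y\<in>F. B y)"
      by (rule compactE_image[OF K oB cB])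
    have "cyl_open (\<Inter>y\<in>F. A y)" "cyl_open (\<Union>y\<in>F. B y)"
      using F AB by (auto intro!: cyl_open_INT cyl_open_UN)
    moreover have "(\<Inter>y\<in>F. A y) \<inter> (\<Union>y\<in>F. B y) = {}" "x \<in> (\<Inter>y\<in>F. A y)" using AB F by fastforce+
    ultimately show ?thesis using F(3) by blast
  qed
  then obtain A B where AB: "\<And>x. x \<in> S \<Longrightarrow> cyl_open (A x) \<and> cyl_open (B x) \<and> x \<in> A x \<and> K \<subseteq> B x \<and> A x \<inter> B x = {}"
    by metis
  have oA: "\<And>x. x \<in> S \<Longrightarrow> open (A x)" and cA: "S \<subseteq> (\<Union>x\<in>S. A x)"
    using AB unfolding cyl_open_def by blast+
  obtain F where F: "F \<subseteq> S" "finite F" "S \<subseteq> (\<Union>x\<in>F. A x)"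
    by (rule compactE_image[OF S oA cA])
  show ?thesis
  proof (rule that)
    show "cyl_open (\<Union>x\<in>F. A x)" using F AB by (intro cyl_open_UN) auto
    show "S \<subseteq> (\<Union>x\<in>F. A x)" by (rule F(3))
    show "(\<Union>x\<in>F. A x) \<inter> K = {}" using AB F by blast
  qed
qed


section \<open>Absolute continuity\<close>

lemma std_gauss_abs_moment:
  assumes i: "i < d"
  shows "integrable (std_gauss d) (\<lambda>z. \<bar>z i\<bar>)" "(\<integral>z. \<bar>z i\<bar> \<partial>std_gauss d) \<le> 1"
proof -
  interpret product_prob_space "\<lambda>_::nat. gauss1" by (rule product_prob_space_gauss1)
  have d: "distr (std_gauss d) gauss1 (\<lambda>z. z i) = gauss1"
    unfolding std_gauss_def using i by (intro distr_PiM_component prob_space_gauss1) auto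
  have m: "(\<lambda>z. z i) \<in> measurable (std_gauss d) gauss1"
    using std_gauss_component[OF i] by (simp cong: measurable_cong_sets)
  have i2: "integrable gauss1 (\<lambda>t. t\<^sup>2)" using integrable_std_normal_distribution_moment[of 2] .
  have e2: "(\<integral>t. t\<^sup>2 \<partial>gauss1) = 1" using std_normal_distribution_even_moments(1)[of 1] by simp
  have le: "\<bar>t\<bar> \<le> (1 + t\<^sup>2) / 2" for t :: real
    using zero_le_power2[of "\<bar>t\<bar> - 1"] by (simp add: power2_eq_square algebra_simps)
  have i1: "integrable gauss1 (\<lambda>t. \<bar>t\<bar>)"
    using integrable_std_normal_distribution_moment[of 1] by simp
  have "(\<integral>t. \<bar>t\<bar> \<partial>gauss1) \<le> (\<integral>t. (1 + t\<^sup>2) / 2 \<partial>gauss1)"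
    by (rule integral_mono) (use i1 i2 le in auto)
  also have "\<dots> = 1" using i2 e2 prob_space.prob_space[OF prob_space_gauss1] by simp
  finally have e1: "(\<integral>t. \<bar>t\<bar> \<partial>gauss1) \<le> 1" .
  have i1': "integrable (distr (std_gauss d) gauss1 (\<lambda>z. z i)) (\<lambda>t. \<bar>t\<bar>)" unfolding d by (rule i1)
  show "integrable (std_gauss d) (\<lambda>z. \<bar>z i\<bar>)" by (rule integrable_distr[OF m i1'])
  have "(\<integral>z. \<bar>z i\<bar> \<partial>std_gauss d) = (\<integral>t. \<bar>t\<bar> \<partial>distr (std_gauss d) gauss1 (\<lambda>z. z i))"
    by (rule integral_distr[OF m, symmetric]) simp
  then show "(\<integral>z. \<bar>z i\<bar> \<partial>std_gauss d) \<le> 1" using e1 unfolding d by simp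
qed

context radon_gaussian begin

text \<open>A continuous map back into \<open>X\<close>, possible because the vectors
  \<open>cmv (k i)\<close> lie in \<open>X\<close>. Functionals whose residual vanishes at
  \<open>x\<close> cannot tell \<open>x\<close> from \<open>embed d k (tuple_map d k x)\<close>, so
  sets and functions that depend on them can be read off from the coordinates.\<close>

definition embed :: "nat \<Rightarrow> (nat \<Rightarrow> 'a \<Rightarrow> real) \<Rightarrow> (nat \<Rightarrow> real) \<Rightarrow> 'a" where
  "embed d k z = (\<Sum>i<d. z i *\<^sub>R cmv (k i))"

lemma continuous_embed: "continuous_on UNIV (embed d k)"
proof -
  have "continuous_on UNIV (\<lambda>z. \<Sum>i<n. z i *\<^sub>R cmv (k i))" for n
  proof (induction n)
    case (Suc n)
    have "continuous_on UNIV (\<lambda>z. z n *\<^sub>R cmv (k n))" by (intro continuous_intros continuous_on_product_coordinates)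
    then show ?case using Suc by (simp add: continuous_on_add)
  qed simp
  then show ?thesis by (simp add: embed_def[abs_def])
qed

lemma embed_tuple_map:
  assumes o: "orthon d k" and l: "l \<in> top_dual" and r: "residual d k l x = 0"
  shows "l (embed d k (tuple_map d k x)) = l x"
proof -
  have "l (embed d k (tuple_map d k x)) = (\<Sum>i<d. tuple_map d k x i * l (cmv (k i)))"
    using top_dual_linear[OF l] by (simp add: embed_def linear_sum linear_scale)
  also have "\<dots> = (\<Sum>i<d. ip l (k i) * k i x)"
    using o l by (intro sum.cong) (auto simp: tuple_map_def cmv orthon_top_dual)
  finally show ?thesis using r by (simp add: residual_def)
qed

text \<open>\<open>l\<close> is Lipschitz for the Cameron--Martin norm with constant
  \<open>sqrt (ip l l)\<close>, so its half-spaces are open in that norm.\<close>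

lemma cm_borel_top_dual:
  assumes l: "l \<in> top_dual" shows "l \<in> borel_measurable (cm_borel \<gamma>)"
proof -
  have sub: "{U. cm_open \<gamma> U} \<subseteq> Pow (cm_space \<gamma>)" by (auto simp: cm_open_def)
  have "{h \<in> cm_space \<gamma>. a < l h} \<in> sets (cm_borel \<gamma>)" for a
  proof -
    have "cm_open \<gamma> {h \<in> cm_space \<gamma>. a < l h}"
      unfolding cm_open_def
    proof (intro conjI ballI)
      fix h assume "h \<in> {h \<in> cm_space \<gamma>. a < l h}"
      then have h: "h \<in> cm_space \<gamma>" "a < l h" by auto
      define \<epsilon> where "\<epsilon> = (l h - a) / (sqrt (ip l l) + 1)"
      have s: "0 \<le> sqrt (ip l l)" using ip_nonneg by simp
      have \<epsilon>0: "0 < \<epsilon>" unfolding \<epsilon>_def by (rule divide_pos_pos) (use h s in linarith)+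
      have "sqrt (ip l l) + 1 \<noteq> 0" using s by linarith
      then have "(sqrt (ip l l) + 1) * \<epsilon> = l h - a" by (simp add: \<epsilon>_def)
      then have \<epsilon>: "0 < \<epsilon>" "sqrt (ip l l) * \<epsilon> < l h - a" using \<epsilon>0 by (auto simp: distrib_right)
      show "\<exists>\<epsilon>>0. \<forall>k\<in>cm_space \<gamma>. cm_norm \<gamma> (k - h) < \<epsilon> \<longrightarrow> k \<in> {h \<in> cm_space \<gamma>. a < l h}"
      proof (intro exI[of _ \<epsilon>] conjI ballI impI \<epsilon>(1))
        fix k assume k: "k \<in> cm_space \<gamma>" "cm_norm \<gamma> (k - h) < \<epsilon>"
        have "\<bar>l (k - h)\<bar> \<le> sqrt (ip l l) * cm_norm \<gamma> (k - h)" by (rule cm_norm_bound[OF cm_diff(1)[OF k(1) h(1)] l])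
        also have "\<dots> \<le> sqrt (ip l l) * \<epsilon>" using k(2) s by (intro mult_left_mono) auto
        finally have "\<bar>l k - l h\<bar> < l h - a" using \<epsilon>(2) linear_diff[OF top_dual_linear[OF l], of k h] by simp
        then show "k \<in> {h \<in> cm_space \<gamma>. a < l h}" using k(1) by simp
      qed
    qed auto
    then show ?thesis unfolding cm_borel_def using sub by (simp add: sets_measure_of)
  qed
  moreover have "space (cm_borel \<gamma>) = cm_space \<gamma>" unfolding cm_borel_def using sub by (rule space_measure_of)
  ultimately show ?thesis by (simp add: borel_measurable_iff_greater)
qed

end

section \<open>The stationary measure\<close>

locale ou_stationary = radon_gaussian \<gamma> for \<gamma> :: "'a::locally_convex_space measure" +
  fixes \<mu> :: "'a measure" and v :: "'a \<Rightarrow> 'a" and I :: "nat set" and e :: "nat \<Rightarrow> 'a"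
  assumes basis: "cm_orthonormal_basis \<gamma> I e"
    and v_measurable: "v \<in> measurable borel (cm_borel \<gamma>)"
    and radon_mu: "radon_prob \<mu>"
    and v_integrable: "integrable \<mu> (\<lambda>x. cm_norm \<gamma> (v x))"
    and stationary: "Lb_stationary \<gamma> I e v \<mu>"
begin

sublocale M: prob_space \<mu> using radon_mu by (simp add: radon_prob_def)

lemma sets_mu[measurable_cong, simp]: "sets \<mu> = sets borel"
  using radon_mu by (simp add: radon_prob_def)

lemma space_mu[simp]: "space \<mu> = UNIV"
  using sets_eq_imp_space_eq[OF sets_mu] by simp

lemma v_cm: "v x \<in> cm_space \<gamma>"
proof -
  have "{U. cm_open \<gamma> U} \<subseteq> Pow (cm_space \<gamma>)" by (auto simp: cm_open_def)
  then have "space (cm_borel \<gamma>) = cm_space \<gamma>" unfolding cm_borel_def by (rule space_measure_of)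
  then show ?thesis using measurable_space[OF v_measurable, of x] by simp
qed

lemma top_dual_mu: "l \<in> top_dual \<Longrightarrow> l \<in> borel_measurable \<mu>"
  using top_dual_borel[of l] by (simp add: measurable_cong_sets[OF sets_mu refl])

lemma top_dual_v_measurable: "l \<in> top_dual \<Longrightarrow> (\<lambda>x. l (v x)) \<in> borel_measurable \<mu>"
  using measurable_compose[OF v_measurable cm_borel_top_dual] by (simp add: measurable_cong_sets[OF sets_mu refl])

abbreviation drift_norm :: real where
  "drift_norm \<equiv> \<integral>x. cm_norm \<gamma> (v x) \<partial>\<mu>"

lemma drift_norm_nonneg: "0 \<le> drift_norm"
  by (intro Bochner_Integration.integral_nonneg cm_norm_nonneg v_cm)

lemma tuple_map_mu: "(\<And>i. i < d \<Longrightarrow> k i \<in> top_dual) \<Longrightarrow> tuple_map d k \<in> measurable \<mu> (PiM {..<d} (\<lambda>_. borel))"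
  by (rule tuple_map_measurable) (auto intro: top_dual_mu)

lemma stationary_orthon:
  assumes o: "orthon d k" and \<phi>: "test_fun_Rn d \<phi>"
  shows "(\<integral>x. (\<Sum>j<d. pderiv_at j (pderiv_at j \<phi>) (tuple_map d k x))
      + (\<Sum>j<d. (- k j x + k j (v x)) * pderiv_at j \<phi> (tuple_map d k x)) \<partial>\<mu>) = 0"
proof -
  have "(\<integral>x. Lb_cyl \<gamma> I e v d k \<phi> x \<partial>\<mu>) = 0"
    using stationary \<phi> orthon_top_dual[OF o] by (simp add: Lb_stationary_def)
  then show ?thesis by (simp add: Lb_cyl_orthon[where v = v, OF basis v_cm test_fun_smooth[OF \<phi>] o])
qed

lemma stationary_orthon_shift:
  assumes o: "orthon d k" and \<phi>: "test_fun_Rn d \<phi>"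
  shows "(\<integral>x. (\<Sum>j<d. pderiv_at j (pderiv_at j \<phi>) (shift_Rn d c (tuple_map d k x)))
      + (\<Sum>j<d. (- k j x + k j (v x)) * pderiv_at j \<phi> (shift_Rn d c (tuple_map d k x))) \<partial>\<mu>) = 0"
proof -
  have 1: "pderiv_at j (\<lambda>x. \<phi> (shift_Rn d c x)) = (\<lambda>x. pderiv_at j \<phi> (shift_Rn d c x))"
    "pderiv_at j (\<lambda>x. pderiv_at j \<phi> (shift_Rn d c x)) = (\<lambda>x. pderiv_at j (pderiv_at j \<phi>) (shift_Rn d c x))" if "j < d" for j
    using pderivs_shift[of "[j]" d \<phi> c] pderivs_shift[of "[j]" d "pderiv_at j \<phi>" c] that by auto
  show ?thesis using stationary_orthon[OF o test_fun_shift[OF \<phi>, of c]] by (simp add: 1 cong: sum.cong_simp)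
qed

text \<open>Translating the test function moves the drift by the translation vector, so the law of
  \<open>P + \<epsilon> z\<close>, with \<open>z\<close> an independent Gaussian vector, solves an equation with drift of nearly the same norm.\<close>

lemma smoothed_entropy:
  assumes FD: "FD_estimate \<beta> C" and o: "orthon d k" and d: "1 \<le> d" and \<epsilon>: "0 < \<epsilon>" "\<epsilon> * d \<le> 1"
  obtains g where "g \<in> borel_measurable (PiM {..<d} (\<lambda>_. borel))" "\<And>x. 0 \<le> g x"
    "distr (\<mu> \<Otimes>\<^sub>M std_gauss d) (PiM {..<d} (\<lambda>_. borel)) (\<lambda>p. shift_Rn d (\<lambda>i. \<epsilon> * snd p i) (tuple_map d k (fst p)))
      = density (std_gauss d) (\<lambda>x. ennreal (g x))"
    "(\<integral>\<^sup>+x. ennreal (g x * ln (g x + 1) powr \<beta>) \<partial>std_gauss d)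
      \<le> ennreal (C * (1 + (drift_norm + 1) * ln (1 + (drift_norm + 1)) powr \<beta>))"
proof -
  interpret G: prob_space "std_gauss d" by (rule prob_space_std_gauss)
  interpret PP: pair_prob_space \<mu> "std_gauss d" ..
  let ?P = "PiM {..<d} (\<lambda>_. borel :: real measure)" and ?M = "\<mu> \<Otimes>\<^sub>M std_gauss d"
  have P: "tuple_map d k \<in> measurable \<mu> ?P" by (rule tuple_map_mu) (rule orthon_top_dual[OF o])
  define Y where "Y p = shift_Rn d (\<lambda>i. \<epsilon> * snd p i) (tuple_map d k (fst p))" for p
  have Ym: "Y \<in> measurable ?M ?P" unfolding Y_def[abs_def] by (rule measurable_shift_Rn[OF P])
  define V where "V i p = k i (v (fst p)) + \<epsilon> * snd p i" for i p
  obtain g where g: "g \<in> borel_measurable ?P" "\<And>x. 0 \<le> g x" "distr ?M ?P Y = density (std_gauss d) (\<lambda>x. ennreal (g x))"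
    unfolding Y_def by (rule smoothing_density[OF M.prob_space_axioms P \<epsilon>(1)]) blast
  have Vm: "V i \<in> borel_measurable ?M" if i: "i < d" for i
  proof -
    note [measurable] = std_gauss_component[OF i] top_dual_v_measurable[OF orthon_top_dual[OF o i]]
    show ?thesis unfolding V_def by measurable
  qed
  \<comment> \<open>The noise adds at most \<open>\<epsilon> d \<le> 1\<close> to the expected drift
    norm; this is the 1 in \<open>drift_norm + 1\<close>.\<close>
  define B where "B p = cm_norm \<gamma> (v (fst p)) + \<epsilon> * (\<Sum>i<d. \<bar>snd p i\<bar>)" for p :: "'a \<times> (nat \<Rightarrow> real)"
  have VB: "L2_set (\<lambda>i. V i p) {..<d} \<le> B p" for p
  proof -
    have "L2_set (\<lambda>i. V i p) {..<d} \<le> L2_set (\<lambda>i. k i (v (fst p))) {..<d} + L2_set (\<lambda>i. \<epsilon> * snd p i) {..<d}"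
      unfolding V_def by (rule L2_set_triangle_ineq)
    also have "L2_set (\<lambda>i. k i (v (fst p))) {..<d} \<le> cm_norm \<gamma> (v (fst p))" by (rule L2_set_orthon_le[OF o v_cm])
    also have "L2_set (\<lambda>i. \<epsilon> * snd p i) {..<d} \<le> (\<Sum>i<d. \<bar>\<epsilon> * snd p i\<bar>)" by (rule L2_set_le_sum_abs)
    also have "\<dots> = \<epsilon> * (\<Sum>i<d. \<bar>snd p i\<bar>)" using \<epsilon>(1) by (simp add: abs_mult sum_distrib_left)
    finally show ?thesis by (simp add: B_def)
  qed
  have fst_int: "integrable ?M (\<lambda>p. f (fst p))" "(\<integral>p. f (fst p) \<partial>?M) = (\<integral>x. f x \<partial>\<mu>)" if f: "integrable \<mu> f" for f :: "_ \<Rightarrow> real"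
  proof -
    have d: "distr ?M \<mu> fst = \<mu>" by (rule G.distr_pair_fst)
    show "integrable ?M (\<lambda>p. f (fst p))" using f by (intro integrable_distr[of fst ?M \<mu> f]) (simp_all add: d)
    show "(\<integral>p. f (fst p) \<partial>?M) = (\<integral>x. f x \<partial>\<mu>)"
      using integral_distr[of fst ?M \<mu> f] borel_measurable_integrable[OF f] by (simp add: d)
  qed
  have snd_int: "integrable ?M (\<lambda>p. f (snd p))" "(\<integral>p. f (snd p) \<partial>?M) = (\<integral>x. f x \<partial>std_gauss d)" if f: "integrable (std_gauss d) f" for f :: "_ \<Rightarrow> real"
  proof -
    have m: "(\<lambda>p. f (snd p)) \<in> borel_measurable ?M" using borel_measurable_integrable[OF f] by measurable
    have "distr ?M (std_gauss d) snd = std_gauss d"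
    proof (rule measure_eqI)
      fix A assume "A \<in> sets (distr ?M (std_gauss d) snd)"
      then have A: "A \<in> sets (std_gauss d)" by simp
      have "snd -` A \<inter> space ?M = space \<mu> \<times> A" using sets.sets_into_space[OF A] by (auto simp: space_pair_measure)
      then show "emeasure (distr ?M (std_gauss d) snd) A = emeasure (std_gauss d) A"
        using A M.emeasure_space_1 G.emeasure_pair_measure_Times[OF sets.top A, of \<mu>]
        by (simp add: emeasure_distr del: space_mu)
    qed simp
    note d = this
    show "integrable ?M (\<lambda>p. f (snd p))" using f by (intro integrable_distr[of snd ?M "std_gauss d" f]) (simp_all add: d)
    show "(\<integral>p. f (snd p) \<partial>?M) = (\<integral>x. f x \<partial>std_gauss d)"
      using integral_distr[of snd ?M "std_gauss d" f] borel_measurable_integrable[OF f] by (simp add: d)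
  qed
  have z_int: "integrable ?M (\<lambda>p. \<bar>snd p i\<bar>)" "(\<integral>p. \<bar>snd p i\<bar> \<partial>?M) \<le> 1" if "i < d" for i
    using snd_int[OF std_gauss_abs_moment(1)[OF that]] std_gauss_abs_moment(2)[OF that] by auto
  have Bint: "integrable ?M B"
    unfolding B_def using z_int(1) fst_int(1)[OF v_integrable]
    by (intro Bochner_Integration.integrable_add integrable_mult_right Bochner_Integration.integrable_sum) auto
  have Bval: "(\<integral>p. B p \<partial>?M) \<le> drift_norm + 1"
  proof -
    have "(\<integral>p. B p \<partial>?M) = (\<integral>p. cm_norm \<gamma> (v (fst p)) \<partial>?M) + (\<integral>p. \<epsilon> * (\<Sum>i<d. \<bar>snd p i\<bar>) \<partial>?M)"
      unfolding B_def using z_int(1) fst_int(1)[OF v_integrable]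
      by (intro Bochner_Integration.integral_add integrable_mult_right Bochner_Integration.integrable_sum) auto
    also have "(\<integral>p. \<epsilon> * (\<Sum>i<d. \<bar>snd p i\<bar>) \<partial>?M) = \<epsilon> * (\<Sum>i<d. \<integral>p. \<bar>snd p i\<bar> \<partial>?M)"
      using z_int(1) by (subst integral_mult_right_zero, subst Bochner_Integration.integral_sum) auto
    also have "\<dots> \<le> \<epsilon> * (\<Sum>i<d. 1)" using \<epsilon>(1) z_int(2) by (intro mult_left_mono sum_mono) auto
    also have "\<dots> \<le> 1" using \<epsilon>(2) by simp
    finally show ?thesis by (simp add: fst_int(2)[OF v_integrable])
  qed
  have Lm: "(\<lambda>p. L2_set (\<lambda>i. V i p) {..<d}) \<in> borel_measurable ?M"
  proof -
    have [measurable]: "(\<lambda>p. \<Sum>i<d. (V i p)\<^sup>2) \<in> borel_measurable ?M"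
      by (intro borel_measurable_sum borel_measurable_power Vm) simp
    show ?thesis unfolding L2_set_def by measurable
  qed
  have Lint: "integrable ?M (\<lambda>p. L2_set (\<lambda>i. V i p) {..<d})"
  proof (rule Bochner_Integration.integrable_bound[OF Bint Lm])
    show "AE p in ?M. norm (L2_set (\<lambda>i. V i p) {..<d}) \<le> norm (B p)"
      using VB by (intro AE_I2) (auto simp: L2_set_nonneg intro: order_trans[OF _ abs_ge_self])
  qed
  have Lval: "(\<integral>p. L2_set (\<lambda>i. V i p) {..<d} \<partial>?M) \<le> drift_norm + 1"
    using integral_mono[OF Lint Bint VB] Bval by simp
  have eq: "(\<integral>p. (\<Sum>i<d. pderiv_at i (pderiv_at i \<phi>) (Y p)) + (\<Sum>i<d. (- Y p i + V i p) * pderiv_at i \<phi> (Y p)) \<partial>?M) = 0"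
    if \<phi>: "test_fun_Rn d \<phi>" for \<phi>
  proof -
    define F where "F x z = (\<Sum>i<d. pderiv_at i (pderiv_at i \<phi>) (Y (x, z))) + (\<Sum>i<d. (- Y (x, z) i + V i (x, z)) * pderiv_at i \<phi> (Y (x, z)))" for x z
    \<comment> \<open>For a fixed noise value \<open>z\<close> the term \<open>\<epsilon> z\<close>
      cancels in \<open>- Y + V\<close>, and what remains is the equation for \<open>\<mu>\<close>
      with a translated test function.\<close>
    have "(\<integral>x. F x z \<partial>\<mu>) = 0" for z
    proof -
      have "(- Y (x, z) i + V i (x, z)) = - k i x + k i (v x)" if "i < d" for i x
        using that by (simp add: Y_def V_def shift_Rn_def tuple_map_def)
      then have "F x z = (\<Sum>j<d. pderiv_at j (pderiv_at j \<phi>) (shift_Rn d (\<lambda>i. \<epsilon> * z i) (tuple_map d k x)))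
          + (\<Sum>j<d. (- k j x + k j (v x)) * pderiv_at j \<phi> (shift_Rn d (\<lambda>i. \<epsilon> * z i) (tuple_map d k x)))" for x
        unfolding F_def by (intro arg_cong2[where f = "(+)"] sum.cong refl) (simp_all add: Y_def)
      then show ?thesis using stationary_orthon_shift[OF o \<phi>] by simp
    qed
    note inner = this
    have "integral\<^sup>L ?M (case_prod F) = 0"
    \<comment> \<open>If the integrand is not integrable, its Bochner integral is 0 by
      convention.\<close>
    proof (cases "integrable ?M (case_prod F)")
      case True
      show ?thesis using PP.integral_snd[OF True] by (simp add: inner)
    qed (rule not_integrable_integral_eq)
    then show ?thesis by (simp add: F_def case_prod_unfold)
  qed
  show ?thesis
    by (rule that[OF g(1,2) g(3)[unfolded Y_def[abs_def]]], rule FD_estimate_random_vector[OF FD d PP.prob_space_axioms Ym Vm Lint Lval g(1,2,3) eq])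
qed

text \<open>The entropy bound of the smoothed laws involves only \<open>C\<close>,
  \<open>\<beta>\<close> and \<open>drift_norm\<close>, so one \<open>\<eta>\<close> serves every
  dimension, every family \<open>k\<close> and every noise level. Openness of \<open>U\<close>
  passes the smallness to the limit of vanishing noise.\<close>

lemma cyl_open_small:
  assumes FD: "FD_estimate \<beta> C" and \<beta>: "0 < \<beta>" and \<delta>: "0 < \<delta>"
  obtains \<eta> where "0 < \<eta>" "\<And>d k U. 1 \<le> d \<Longrightarrow> orthon d k \<Longrightarrow> open U \<Longrightarrow>
      emeasure (std_gauss d) (U \<inter> Rn d) \<le> ennreal \<eta> \<Longrightarrow> emeasure \<mu> {x. tuple_map d k x \<in> U} \<le> ennreal \<delta>"
proof -
  define K where "K = C * (1 + (drift_norm + 1) * ln (1 + (drift_norm + 1)) powr \<beta>)"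
  obtain \<eta> where \<eta>: "0 < \<eta>" "\<And>(M :: (nat \<Rightarrow> real) measure) g B. g \<in> borel_measurable M \<Longrightarrow> (\<And>x. 0 \<le> g x) \<Longrightarrow>
      (\<integral>\<^sup>+x. ennreal (g x * ln (g x + 1) powr \<beta>) \<partial>M) \<le> ennreal K \<Longrightarrow> B \<in> sets M \<Longrightarrow> emeasure M B \<le> ennreal \<eta> \<Longrightarrow>
      emeasure (density M (\<lambda>x. ennreal (g x))) B \<le> ennreal \<delta>"
    by (rule entropy_uniform_integrability[OF \<beta> \<delta>]) blast
  show ?thesis
  proof (rule that[OF \<eta>(1)])
    fix d k and U :: "(nat \<Rightarrow> real) set"
    assume d: "1 \<le> d" and o: "orthon d k" and U: "open U" and small: "emeasure (std_gauss d) (U \<inter> Rn d) \<le> ennreal \<eta>"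
    interpret G: prob_space "std_gauss d" by (rule prob_space_std_gauss)
    interpret PP: pair_prob_space \<mu> "std_gauss d" ..
    let ?P = "PiM {..<d} (\<lambda>_. borel :: real measure)" and ?M = "\<mu> \<Otimes>\<^sub>M std_gauss d"
    have P: "tuple_map d k \<in> measurable \<mu> ?P" by (rule tuple_map_mu) (rule orthon_top_dual[OF o])
    have UR: "U \<inter> Rn d \<in> sets ?P"
      using measurable_sets[OF measurable_PiM_id[of d] borel_open[OF U]] by (simp add: space_PiM vimage_def)
    \<comment> \<open>The factor \<open>1 / d\<close> keeps the noise within the budget
      \<open>\<epsilon> d \<le> 1\<close>.\<close>
    define \<epsilon> where "\<epsilon> n = 1 / (real d * real (Suc n))" for n
    have \<epsilon>: "0 < \<epsilon> n" "\<epsilon> n * d \<le> 1" for n using d by (auto simp: \<epsilon>_def)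
    have \<epsilon>0: "\<epsilon> \<longlonglongrightarrow> 0"
    proof -
      have "\<epsilon> = (\<lambda>n. 1 / real d * inverse (real (Suc n)))" by (rule ext) (simp add: \<epsilon>_def field_simps del: of_nat_Suc)
      then show ?thesis
        using tendsto_mult[OF tendsto_const[of "1 / real d"] LIMSEQ_inverse_real_of_nat] by (simp only: mult_zero_right)
    qed
    define Y where "Y n p = shift_Rn d (\<lambda>i. \<epsilon> n * snd p i) (tuple_map d k (fst p))" for n p
    have Ym: "Y n \<in> measurable ?M ?P" for n unfolding Y_def[abs_def] by (rule measurable_shift_Rn[OF P])
    have Yin: "Y n p \<in> Rn d" for n p by (simp add: Y_def shift_Rn_in)
    have each: "emeasure (distr ?M ?P (Y n)) (U \<inter> Rn d) \<le> ennreal \<delta>" for n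
    proof -
      obtain g where g: "g \<in> borel_measurable ?P" "\<And>x. 0 \<le> g x"
        "distr ?M ?P (Y n) = density (std_gauss d) (\<lambda>x. ennreal (g x))"
        "(\<integral>\<^sup>+x. ennreal (g x * ln (g x + 1) powr \<beta>) \<partial>std_gauss d) \<le> ennreal K"
        unfolding Y_def K_def by (rule smoothed_entropy[OF FD o d \<epsilon>]) blast
      show ?thesis
        unfolding g(3)
      proof (rule \<eta>(2)[OF _ g(2) g(4) _ small])
        show "g \<in> borel_measurable (std_gauss d)" using g(1) by (simp only: measurable_cong_sets[OF sets_std_gauss refl])
        show "U \<inter> Rn d \<in> sets (std_gauss d)" using UR by (simp only: sets_std_gauss)
      qed
    qed
    have PU: "{x. tuple_map d k x \<in> U} \<in> sets \<mu>"
    proof -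
      have "tuple_map d k x \<in> Rn d" for x by (simp add: tuple_map_def)
      then have "{x. tuple_map d k x \<in> U} = tuple_map d k -` (U \<inter> Rn d) \<inter> space \<mu>"
        by (simp only: set_eq_iff vimage_eq Int_iff mem_Collect_eq space_mu UNIV_I simp_thms)
      then show ?thesis using measurable_sets[OF P UR] by simp
    qed
    have ev: "\<forall>\<^sub>F n in sequentially. Y n p \<in> U \<inter> Rn d" if "fst p \<in> {x. tuple_map d k x \<in> U}" for p
    proof -
      have "continuous_on UNIV (\<lambda>t. shift_Rn d (\<lambda>i. t * snd p i) (tuple_map d k (fst p)))"
        unfolding shift_Rn_def restrict_def
      proof (rule continuous_on_coordinatewise_then_product)
        show "continuous_on UNIV (\<lambda>t. if i \<in> {..<d} then tuple_map d k (fst p) i + t * snd p i else undefined)" for i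
          by (cases "i < d") (auto intro!: continuous_intros)
      qed
      then have "isCont (\<lambda>t. shift_Rn d (\<lambda>i. t * snd p i) (tuple_map d k (fst p))) 0"
        by (simp only: continuous_on_eq_continuous_at[OF open_UNIV] UNIV_I)
      from isCont_tendsto_compose[OF this \<epsilon>0]
      have "(\<lambda>n. Y n p) \<longlonglongrightarrow> shift_Rn d (\<lambda>i. 0 * snd p i) (tuple_map d k (fst p))"
        unfolding Y_def .
      also have "shift_Rn d (\<lambda>i. 0 * snd p i) (tuple_map d k (fst p)) = tuple_map d k (fst p)"
        by (rule ext) (simp add: shift_Rn_def tuple_map_def)
      finally have "\<forall>\<^sub>F n in sequentially. Y n p \<in> U" using U that by (auto dest: topological_tendstoD)
      then show ?thesis by eventually_elim (simp add: Yin)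
    qed
    show "emeasure \<mu> {x. tuple_map d k x \<in> U} \<le> ennreal \<delta>"
      by (rule emeasure_le_of_eventually_mem[OF M.prob_space_axioms G.prob_space_axioms PU UR Ym ev each])
  qed
qed

text \<open>A functional that vanishes \<open>\<gamma>\<close>-almost everywhere satisfies \<open>\<integral> l \<phi>'(l) d\<mu> = 0\<close>; hence
  \<open>n l + z\<close> with Gaussian noise \<open>z\<close> solves the one-dimensional equation with zero drift for every \<open>n\<close>,
  and the resulting entropy bound prevents its law from escaping to infinity.\<close>

lemma null_functional_mu:
  assumes FD: "FD_estimate \<beta> C" and \<beta>: "0 < \<beta>" and l: "l \<in> top_dual" and null: "ip l l = 0"
  shows "AE x in \<mu>. l x = 0"
proof -
  interpret G: prob_space "std_gauss 1" by (rule prob_space_std_gauss)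
  interpret PP: pair_prob_space \<mu> "std_gauss 1" ..
  let ?P = "PiM {..<1} (\<lambda>_. borel :: real measure)" and ?M = "\<mu> \<Otimes>\<^sub>M std_gauss 1"
  \<comment> \<open>A null functional vanishes on the Cameron--Martin space, so the drift drops out
    of its equation.\<close>
  have lv: "l (v x) = 0" for x using cm_norm_bound[OF v_cm l, of x] null by simp
  have comp[measurable]: "(\<lambda>z. z 0) \<in> borel_measurable (std_gauss 1)" by (rule std_gauss_component) simp
  define P where "P n x = line1 (real n * l x)" for n x
  have Pm: "P n \<in> measurable \<mu> ?P" for n
    unfolding P_def by (rule measurable_compose[OF borel_measurable_times[OF borel_measurable_const top_dual_mu[OF l]] measurable_line1])
  define Y where "Y n p = shift_Rn 1 (\<lambda>i. 1 * snd p i) (P n (fst p))" for n p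
  have Ym: "Y n \<in> measurable ?M ?P" for n unfolding Y_def[abs_def] by (rule measurable_shift_Rn[OF Pm])
  have Y0: "Y n p 0 = real n * l (fst p) + snd p 0" for n p by (simp add: Y_def P_def shift_Rn_def)
  have Yin: "Y n p \<in> Rn 1" for n p unfolding Y_def by (rule shift_Rn_in)
  have ent: "\<exists>g. g \<in> borel_measurable ?P \<and> (\<forall>x. 0 \<le> g x) \<and> distr ?M ?P (Y n) = density (std_gauss 1) (\<lambda>x. ennreal (g x)) \<and>
      (\<integral>\<^sup>+x. ennreal (g x * ln (g x + 1) powr \<beta>) \<partial>std_gauss 1) \<le> ennreal C" for n
  proof -
    obtain g where g: "g \<in> borel_measurable ?P" "\<And>x. 0 \<le> g x" "distr ?M ?P (Y n) = density (std_gauss 1) (\<lambda>x. ennreal (g x))"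
      unfolding Y_def by (rule smoothing_density[OF M.prob_space_axioms Pm zero_less_one]) blast
    have eq: "(\<integral>p. (\<Sum>i<1. pderiv_at i (pderiv_at i \<phi>) (Y n p)) + (\<Sum>i<1. (- Y n p i + 0) * pderiv_at i \<phi> (Y n p)) \<partial>?M) = 0"
      if \<phi>: "test_fun_Rn 1 \<phi>" for \<phi>
    proof -
      define D1 where "D1 p = pderivs [0] \<phi> (Y n p)" for p
      define D2 where "D2 p = pderivs [0,0] \<phi> (Y n p)" for p
      note sm = test_fun_smooth[OF \<phi>]
      have s1: "set [0] \<subseteq> {..<1::nat}" "set [0,0] \<subseteq> {..<1::nat}" by auto
      have D1m[measurable]: "D1 \<in> borel_measurable ?M" unfolding D1_def by (rule measurable_compose[OF Ym smooth_Rn_measurable[OF sm s1(1)]])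
      have D2m[measurable]: "D2 \<in> borel_measurable ?M" unfolding D2_def by (rule measurable_compose[OF Ym smooth_Rn_measurable[OF sm s1(2)]])
      obtain B1 where B1: "0 \<le> B1" "\<And>x. x \<in> Rn 1 \<Longrightarrow> \<bar>1 * pderivs [0] \<phi> x\<bar> \<le> B1"
        by (rule test_fun_bounded[OF \<phi> s1(1) continuous_on_const[of UNIV "1::real"]]) blast
      obtain B2 where B2: "0 \<le> B2" "\<And>x. x \<in> Rn 1 \<Longrightarrow> \<bar>1 * pderivs [0,0] \<phi> x\<bar> \<le> B2"
        by (rule test_fun_bounded[OF \<phi> s1(2) continuous_on_const[of UNIV "1::real"]]) blast
      obtain B3 where B3: "0 \<le> B3" "\<And>x. x \<in> Rn 1 \<Longrightarrow> \<bar>x 0 * pderivs [0] \<phi> x\<bar> \<le> B3"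
        by (rule test_fun_bounded[OF \<phi> s1(1) continuous_on_product_coordinates[of 0]]) blast
      have zm: "(\<lambda>p. snd p 0) \<in> borel_measurable ?M" by measurable
      have zint: "integrable ?M (\<lambda>p. \<bar>snd p 0\<bar>)"
      proof (rule integrableI_bounded)
        have "(\<integral>\<^sup>+p. ennreal (norm \<bar>snd p 0\<bar>) \<partial>?M) = (\<integral>\<^sup>+x. \<integral>\<^sup>+z. ennreal \<bar>z 0\<bar> \<partial>std_gauss 1 \<partial>\<mu>)"
          using zm by (subst G.nn_integral_fst[symmetric]) auto
        also have "\<dots> = (\<integral>\<^sup>+z. ennreal \<bar>z 0\<bar> \<partial>std_gauss 1)" using M.emeasure_space_1 by simp
        also have "\<dots> < \<infinity>" using std_gauss_abs_moment(1)[of 0 1] by (subst nn_integral_eq_integral) auto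
        finally show "(\<integral>\<^sup>+p. ennreal (norm \<bar>snd p 0\<bar>) \<partial>?M) < \<infinity>" .
      qed (use zm in measurable)
      have iD2: "integrable ?M D2"
      proof (rule PP.integrable_const_bound[where B = B2])
        show "AE p in ?M. norm (D2 p) \<le> B2" using B2(2)[OF Yin] by (intro AE_I2) (simp add: D2_def)
      qed (rule D2m)
      have izD1: "integrable ?M (\<lambda>p. snd p 0 * D1 p)"
      proof (rule Bochner_Integration.integrable_bound)
        show "integrable ?M (\<lambda>p. B1 * \<bar>snd p 0\<bar>)" using zint by simp
        have "\<bar>snd p 0 * D1 p\<bar> \<le> B1 * \<bar>snd p 0\<bar>" for p
          using mult_right_mono[OF B1(2)[OF Yin[of n p]], of "\<bar>snd p 0\<bar>"] by (simp add: D1_def abs_mult mult.commute)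
        then show "AE p in ?M. norm (snd p 0 * D1 p) \<le> norm (B1 * \<bar>snd p 0\<bar>)"
          using B1(1) by (intro AE_I2) simp
      qed (use zm in measurable)
      have iY: "integrable ?M (\<lambda>p. Y n p 0 * D1 p)"
      proof (rule PP.integrable_const_bound[where B = B3])
        show "AE p in ?M. norm (Y n p 0 * D1 p) \<le> B3" using B3(2)[OF Yin] by (intro AE_I2) (simp add: D1_def)
        have "(\<lambda>p. Y n p 0) \<in> borel_measurable ?M" by (rule measurable_compose[OF Ym]) simp
        then show "(\<lambda>p. Y n p 0 * D1 p) \<in> borel_measurable ?M" by measurable
      qed
      have iF1: "integrable ?M (\<lambda>(x, z). D2 (x, z) + - z 0 * D1 (x, z))"
        using Bochner_Integration.integrable_diff[OF iD2 izD1] by (simp add: case_prod_unfold)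
      \<comment> \<open>\<open>l\<close> is not known to be \<open>\<mu>\<close>-integrable; the
        product is written as the difference of an integrable Gaussian term and a term bounded by
        compact support.\<close>
      have iF2: "integrable ?M (\<lambda>(x, z). (- (real n * l x)) * D1 (x, z))"
      proof -
        have "(\<lambda>(x, z). (- (real n * l x)) * D1 (x, z)) = (\<lambda>p. snd p 0 * D1 p - Y n p 0 * D1 p)"
          by (auto simp: fun_eq_iff Y0 algebra_simps)
        then show ?thesis using Bochner_Integration.integrable_diff[OF izD1 iY] by simp
      qed
      \<comment> \<open>These terms vanish by Gaussian integration by parts in \<open>z\<close>, for
        the test function translated by \<open>n l x\<close>.\<close>
      have F1: "integral\<^sup>L ?M (\<lambda>(x, z). D2 (x, z) + - z 0 * D1 (x, z)) = 0"
      proof -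
        have "(\<integral>z. D2 (x, z) + - z 0 * D1 (x, z) \<partial>std_gauss 1) = 0" for x
        proof -
          let ?c = "\<lambda>i::nat. real n * l x"
          have sh: "Y n (x, z) = shift_Rn 1 ?c z" for z
            by (auto simp: Y_def P_def shift_Rn_def line1_def fun_eq_iff)
          have "(\<integral>z. (pderivs [0,0] (\<lambda>z. \<phi> (shift_Rn 1 ?c z)) z + (- z 0 + 2 * real 0 / z 0) * pderivs [0] (\<lambda>z. \<phi> (shift_Rn 1 ?c z)) z) * z 0 ^ (2 * 0) \<partial>std_gauss 1) = 0"
            by (rule gauss_ibp[OF test_fun_shift[OF \<phi>]])
          then show ?thesis unfolding pderivs_shift[OF s1(1)] pderivs_shift[OF s1(2)] D1_def D2_def sh by simp
        qed
        then show ?thesis using PP.integral_fst[OF iF1] by simp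
      qed
      \<comment> \<open>The remaining term vanishes by stationarity, applied to the functional
        \<open>n l\<close> and the test function translated by \<open>z\<close>: the second-order
        term has coefficient 0 and there is no drift.\<close>
      have F2: "integral\<^sup>L ?M (\<lambda>(x, z). (- (real n * l x)) * D1 (x, z)) = 0"
      proof -
        have "(\<integral>x. (- (real n * l x)) * D1 (x, z) \<partial>\<mu>) = 0" for z
        proof -
          let ?l = "\<lambda>j x. real n * l x" and ?c = "\<lambda>i. 1 * z i"
          have lt: "?l j \<in> top_dual" for j :: nat by (rule top_dual_mult[OF l])
          have t: "tuple_map (Suc 0) ?l x = P n x" for x by (simp add: tuple_map_def P_def line1_def)
          have "(\<integral>x. Lb_cyl \<gamma> I e v 1 ?l (\<lambda>y. \<phi> (shift_Rn 1 ?c y)) x \<partial>\<mu>) = 0"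
            using stationary test_fun_shift[OF \<phi>, of ?c] lt by (simp add: Lb_stationary_def)
          moreover have "Lb_cyl \<gamma> I e v 1 ?l (\<lambda>y. \<phi> (shift_Rn 1 ?c y)) x = (- (real n * l x)) * D1 (x, z)" for x
            using Lb_cyl_eq[where v = v and x = x and l = ?l and n = 1 and \<phi> = "\<lambda>y. \<phi> (shift_Rn 1 ?c y)", OF basis v_cm test_fun_smooth[OF test_fun_shift[OF \<phi>]] lt]
              fun_cong[OF pderivs_shift[OF s1(1), of \<phi> ?c], of "P n x"] null lv
            by (simp add: t ip_mult ip_mult2 D1_def Y_def)
          ultimately show ?thesis by simp
        qed
        then show ?thesis using PP.integral_snd[OF iF2] by simp
      qed
      have "(\<integral>p. (\<Sum>i<1. pderiv_at i (pderiv_at i \<phi>) (Y n p)) + (\<Sum>i<1. (- Y n p i + 0) * pderiv_at i \<phi> (Y n p)) \<partial>?M)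
          = (\<integral>p. (case p of (x, z) \<Rightarrow> D2 (x, z) + - z 0 * D1 (x, z)) + (case p of (x, z) \<Rightarrow> (- (real n * l x)) * D1 (x, z)) \<partial>?M)"
        by (intro Bochner_Integration.integral_cong refl) (auto simp: D1_def D2_def Y0 algebra_simps)
      also have "\<dots> = 0" by (simp only: Bochner_Integration.integral_add[OF iF1 iF2] F1 F2 add_0_left)
      finally show ?thesis .
    qed
    have z: "L2_set (\<lambda>i. 0) {..<Suc 0} = 0" by (simp add: L2_set_def)
    have "(\<integral>\<^sup>+x. ennreal (g x * ln (g x + 1) powr \<beta>) \<partial>std_gauss 1) \<le> ennreal (C * (1 + 0 * ln (1 + 0) powr \<beta>))"
      by (rule FD_estimate_random_vector[OF FD order_refl PP.prob_space_axioms Ym, of "\<lambda>i p. 0", OF _ _ _ g eq]) (simp_all add: z)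
    then show ?thesis using g by (intro exI[of _ g]) simp
  qed
  have small: "emeasure \<mu> {x. l x \<noteq> 0} \<le> ennreal \<delta>" if \<delta>: "0 < \<delta>" for \<delta>
  proof -
    obtain \<eta> where \<eta>: "0 < \<eta>" "\<And>(M :: (nat \<Rightarrow> real) measure) g B. g \<in> borel_measurable M \<Longrightarrow> (\<And>x. 0 \<le> g x) \<Longrightarrow>
        (\<integral>\<^sup>+x. ennreal (g x * ln (g x + 1) powr \<beta>) \<partial>M) \<le> ennreal C \<Longrightarrow> B \<in> sets M \<Longrightarrow> emeasure M B \<le> ennreal \<eta> \<Longrightarrow>
        emeasure (density M (\<lambda>x. ennreal (g x))) B \<le> ennreal \<delta>"
      by (rule entropy_uniform_integrability[OF \<beta> \<delta>]) blast
    \<comment> \<open>Markov's inequality with first absolute moment at most 1 gives the tail bound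
      \<open>1 / R = \<eta>\<close>.\<close>
    define R where "R = 1 / \<eta>"
    have R: "0 < R" using \<eta>(1) by (simp add: R_def)
    define B where "B = {y \<in> space (std_gauss 1). R < \<bar>y 0\<bar>}"
    have Bs: "B \<in> sets (std_gauss 1)" unfolding B_def by measurable
    have Bsmall: "emeasure (std_gauss 1) B \<le> ennreal \<eta>"
    proof -
      have "ennreal R * emeasure (std_gauss 1) B = (\<integral>\<^sup>+y. ennreal R * indicator B y \<partial>std_gauss 1)"
        using Bs by (simp add: nn_integral_cmult_indicator)
      also have "\<dots> \<le> (\<integral>\<^sup>+y. ennreal \<bar>y 0\<bar> \<partial>std_gauss 1)"
        by (intro nn_integral_mono) (auto simp: B_def indicator_def intro: ennreal_leI)
      also have "\<dots> \<le> 1" using std_gauss_abs_moment[of 0 1] by (subst nn_integral_eq_integral) (auto simp: ennreal_le_1)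
      finally have "ennreal R * ennreal (measure (std_gauss 1) B) \<le> ennreal 1"
        unfolding G.emeasure_eq_measure ennreal_1 .
      then have "R * measure (std_gauss 1) B \<le> 1" using R by (simp add: ennreal_mult'[symmetric] ennreal_le_1)
      then have "measure (std_gauss 1) B \<le> \<eta>" using \<eta>(1) by (simp add: R_def field_simps)
      then show ?thesis unfolding G.emeasure_eq_measure by (rule ennreal_leI)
    qed
    have BP: "B \<in> sets ?P" using Bs by (simp only: sets_std_gauss)
    have each: "emeasure (distr ?M ?P (Y n)) B \<le> ennreal \<delta>" for n
    proof -
      obtain g where g: "g \<in> borel_measurable ?P" "\<And>x. 0 \<le> g x" "distr ?M ?P (Y n) = density (std_gauss 1) (\<lambda>x. ennreal (g x))"
        "(\<integral>\<^sup>+x. ennreal (g x * ln (g x + 1) powr \<beta>) \<partial>std_gauss 1) \<le> ennreal C" using ent[of n] by blast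
      show ?thesis
        unfolding g(3) by (rule \<eta>(2)[OF _ g(2) g(4) Bs Bsmall]) (use g(1) in \<open>simp only: measurable_cong_sets[OF sets_std_gauss refl]\<close>)
    qed
    have ev: "\<forall>\<^sub>F n in sequentially. Y n p \<in> B" if "fst p \<in> {x. l x \<noteq> 0}" for p
    proof -
      have pos: "0 < \<bar>l (fst p)\<bar>" using that by simp
      obtain n0 :: nat where n0: "R + \<bar>snd p 0\<bar> < real n0 * \<bar>l (fst p)\<bar>" using ex_less_of_nat_mult[OF pos] by blast
      show ?thesis
      proof (rule eventually_sequentiallyI[of n0])
        fix n assume "n0 \<le> n"
        then have "real n0 * \<bar>l (fst p)\<bar> \<le> real n * \<bar>l (fst p)\<bar>" by (intro mult_right_mono) auto
        with n0 have "R < \<bar>real n * l (fst p)\<bar> - \<bar>snd p 0\<bar>" by (simp add: abs_mult)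
        then have "R < \<bar>Y n p 0\<bar>" unfolding Y0 by linarith
        then show "Y n p \<in> B" using Yin[of n p] by (simp add: B_def)
      qed
    qed
    have ls: "{x. l x \<noteq> 0} \<in> sets \<mu>"
      using top_dual_mu[OF l] measurable_sets[of l \<mu> borel "- {0}"] by (simp add: vimage_def)
    show ?thesis
      by (rule emeasure_le_of_eventually_mem[OF M.prob_space_axioms G.prob_space_axioms ls BP Ym ev each])
  qed
  have "emeasure \<mu> {x. l x \<noteq> 0} \<le> 0"
    by (rule ennreal_le_epsilon) (simp only: small add_0_left)
  then have 0: "emeasure \<mu> {x. l x \<noteq> 0} = 0" by simp
  have "{x. l x \<noteq> 0} \<in> sets \<mu>"
    using top_dual_mu[OF l] measurable_sets[of l \<mu> borel "- {0}"] by (simp add: vimage_def)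
  then show ?thesis by (intro AE_I[OF _ 0]) auto
qed

text \<open>Up to sets null for both measures, \<open>W\<close> is the preimage of an open set
  \<open>U\<close> of coordinates. For \<open>\<gamma>\<close> this is the vanishing variance of the
  residuals, for \<open>\<mu>\<close> it is \<open>null_functional_mu\<close>.\<close>

lemma cyl_open_measure_small:
  assumes FD: "FD_estimate \<beta> C" and \<beta>: "0 < \<beta>" and \<delta>: "0 < \<delta>"
  obtains \<eta> where "0 < \<eta>" "\<And>W. cyl_open W \<Longrightarrow> emeasure \<gamma> W < ennreal \<eta> \<Longrightarrow> emeasure \<mu> W \<le> ennreal \<delta>"
proof -
  obtain \<eta> where \<eta>: "0 < \<eta>" "\<And>d k U. 1 \<le> d \<Longrightarrow> orthon d k \<Longrightarrow> open U \<Longrightarrow>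
      emeasure (std_gauss d) (U \<inter> Rn d) \<le> ennreal \<eta> \<Longrightarrow> emeasure \<mu> {x. tuple_map d k x \<in> U} \<le> ennreal \<delta>"
    by (rule cyl_open_small[OF FD \<beta> \<delta>]) blast
  show ?thesis
  \<comment> \<open>The 1 settles dimension 0, where \<open>W\<close> has
    \<open>\<gamma>\<close>-measure 0 or 1; measure below 1 then leaves a set that is also
    \<open>\<mu>\<close>-null.\<close>
  proof (rule that[of "min \<eta> 1"])
    show "0 < min \<eta> 1" using \<eta>(1) by simp
    fix W :: "'a set" assume W: "cyl_open W" and small: "emeasure \<gamma> W < ennreal (min \<eta> 1)"
    obtain L where L: "finite L" "L \<subseteq> top_dual" "determined L W" and Wo: "open W"
      using W by (auto simp: cyl_open_def)
    obtain d k where o: "orthon d k" and res: "\<And>l. l \<in> L \<Longrightarrow> ip (residual d k l) (residual d k l) = 0"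
      using gram_schmidt[OF L(1,2), of 0 "\<lambda>_ _. 0"] by (auto simp: orthon_def)
    let ?em = "\<lambda>x. embed d k (tuple_map d k x)"
    have iff: "x \<in> W \<longleftrightarrow> ?em x \<in> W" if "\<forall>l\<in>L. residual d k l x = 0" for x
    proof -
      have "l (?em x) = l x" if "l \<in> L" for l
        using embed_tuple_map[OF o, of l x] that L(2) \<open>\<forall>l\<in>L. residual d k l x = 0\<close> by blast
      then show ?thesis using determinedD[OF L(3), of x "?em x"] determinedD[OF L(3), of "?em x" x] by metis
    qed
    have rt: "residual d k l \<in> top_dual" if "l \<in> L" for l using residual_top_dual[OF o] that L(2) by blast
    have aeg: "AE x in \<gamma>. x \<in> W \<longleftrightarrow> ?em x \<in> W"
    proof -
      have "AE x in \<gamma>. \<forall>l\<in>L. residual d k l x = 0"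
        using L(1) by (intro AE_finite_allI ip_eq_0_AE rt res)
      then show ?thesis by eventually_elim (rule iff)
    qed
    have aem: "AE x in \<mu>. x \<in> W \<longleftrightarrow> ?em x \<in> W"
    proof -
      have "AE x in \<mu>. \<forall>l\<in>L. residual d k l x = 0"
        using L(1) by (intro AE_finite_allI null_functional_mu[OF FD \<beta>] rt res)
      then show ?thesis by eventually_elim (rule iff)
    qed
    define U where "U = embed d k -` W"
    have U: "open U" unfolding U_def using continuous_embed Wo by (simp add: continuous_on_open_vimage[of UNIV])
    have UR: "U \<inter> Rn d \<in> sets (PiM {..<d} (\<lambda>_. borel))"
      using measurable_sets[OF measurable_PiM_id[of d] borel_open[OF U]] by (simp add: space_PiM vimage_def)
    have Pg: "tuple_map d k \<in> measurable \<gamma> (PiM {..<d} (\<lambda>_. borel))"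
      by (rule tuple_map_measurable) (auto intro: top_dual_measurable orthon_top_dual[OF o])
    have Pm: "tuple_map d k \<in> measurable \<mu> (PiM {..<d} (\<lambda>_. borel))"
      by (rule tuple_map_mu) (rule orthon_top_dual[OF o])
    have "tuple_map d k x \<in> Rn d" for x by (simp add: tuple_map_def)
    then have set_eq: "{x. ?em x \<in> W} = tuple_map d k -` (U \<inter> Rn d)"
      by (simp only: U_def set_eq_iff mem_Collect_eq vimage_eq Int_iff simp_thms)
    have eg: "emeasure \<gamma> W = emeasure \<gamma> {x. ?em x \<in> W}"
    proof (rule emeasure_eq_AE)
      show "{x. ?em x \<in> W} \<in> sets \<gamma>" unfolding set_eq using measurable_sets[OF Pg UR] by simp
      show "AE x in \<gamma>. x \<in> W \<longleftrightarrow> x \<in> {x. ?em x \<in> W}" using aeg by (simp only: mem_Collect_eq)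
    qed (use Wo in simp)
    have em: "emeasure \<mu> W = emeasure \<mu> {x. ?em x \<in> W}"
    proof (rule emeasure_eq_AE)
      show "{x. ?em x \<in> W} \<in> sets \<mu>" unfolding set_eq using measurable_sets[OF Pm UR] by simp
      show "AE x in \<mu>. x \<in> W \<longleftrightarrow> x \<in> {x. ?em x \<in> W}" using aem by (simp only: mem_Collect_eq)
    qed (use Wo in simp)
    show "emeasure \<mu> W \<le> ennreal \<delta>"
    proof (cases "d = 0")
      case True
      then have e0: "?em x = 0" for x by (simp add: embed_def)
      show ?thesis
      proof (cases "0 \<in> W")
        case True
        then have "emeasure \<gamma> W = 1" using eg e0 emeasure_space_1 by simp
        moreover have "ennreal (min \<eta> 1) \<le> 1" using ennreal_leI[of "min \<eta> 1" 1] by simp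
        ultimately show ?thesis using small by (metis linorder_not_le)
      next
        case False
        then show ?thesis using em e0 by simp
      qed
    next
      case False
      then have d: "1 \<le> d" by simp
      have "emeasure (std_gauss d) (U \<inter> Rn d) = emeasure \<gamma> W"
        unfolding orthon_law[OF o, symmetric] eg set_eq using Pg UR by (simp add: emeasure_distr)
      then have "emeasure (std_gauss d) (U \<inter> Rn d) \<le> ennreal \<eta>"
        using less_imp_le[OF less_le_trans[OF small ennreal_leI[OF min.cobounded1]]] by simp
      from \<eta>(2)[OF d o U this] show ?thesis unfolding em by (simp add: U_def)
    qed
  qed
qed

theorem absolutely_continuous_mu:
  assumes FD: "FD_estimate \<beta> C" and \<beta>: "0 < \<beta>"
  shows "absolutely_continuous \<gamma> \<mu>"
  unfolding absolutely_continuous_def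
proof
  fix A assume A: "A \<in> null_sets \<gamma>"
  then have As: "A \<in> sets borel" "emeasure \<gamma> A = 0" by (auto simp: null_sets_def)
  have "emeasure \<mu> A = 0"
  proof (rule ccontr)
    assume "emeasure \<mu> A \<noteq> 0"
    then have pos: "measure \<mu> A > 0" by (simp add: M.emeasure_eq_measure zero_less_measure_iff)
    then obtain S where S: "compact S" "S \<subseteq> A" "measure \<mu> (A - S) < measure \<mu> A"
      using radon_mu[unfolded radon_prob_def, THEN conjunct2, THEN conjunct2, rule_format, OF As(1) pos] by blast
    have Sb: "S \<in> sets borel" using S(1) by (simp add: borel_closed compact_imp_closed)
    have "measure \<mu> A = measure \<mu> S + measure \<mu> (A - S)"
      using M.finite_measure_Diff[of A S] S(2) As(1) Sb by simp
    with S(3) have mS: "measure \<mu> S > 0" by simp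
    \<comment> \<open>With half the mass of \<open>S\<close> as tolerance, a cylindrical open set
      that contains \<open>S\<close> and has \<open>\<gamma>\<close>-measure below
      \<open>\<eta>\<close> is a contradiction.\<close>
    then have \<delta>: "0 < measure \<mu> S / 2" by simp
    obtain \<eta> where \<eta>: "0 < \<eta>" "\<And>W. cyl_open W \<Longrightarrow> emeasure \<gamma> W < ennreal \<eta> \<Longrightarrow> emeasure \<mu> W \<le> ennreal (measure \<mu> S / 2)"
      by (rule cyl_open_measure_small[OF FD \<beta> \<delta>]) blast
    have "UNIV - S \<in> sets borel" using Sb by auto
    then obtain K where K: "compact K" "K \<subseteq> UNIV - S" "measure \<gamma> ((UNIV - S) - K) < \<eta>"
      using radon_gamma[unfolded radon_prob_def, THEN conjunct2, THEN conjunct2, rule_format, OF _ \<eta>(1)] by blast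
    have Kb: "K \<in> sets borel" using K(1) by (simp add: borel_closed compact_imp_closed)
    obtain W where W: "cyl_open W" "S \<subseteq> W" "W \<inter> K = {}"
      by (rule separate_compact_cyl[OF S(1) K(1)]) (use K(2) in blast)
    have Wb: "W \<in> sets borel" using W(1) by (simp add: cyl_open_def)
    have Ds: "(UNIV - S) - K \<in> sets \<gamma>" "A \<in> sets \<gamma>" using As(1) Sb Kb by (simp_all add: sets.Diff)
    \<comment> \<open>Off \<open>A\<close> the set \<open>W\<close> avoids both \<open>S\<close> and
      \<open>K\<close>, so it lies in the small remainder.\<close>
    have "W \<subseteq> A \<union> ((UNIV - S) - K)" using S(2) W(3) by blast
    then have "emeasure \<gamma> W \<le> emeasure \<gamma> (A \<union> ((UNIV - S) - K))"
      using Ds by (intro emeasure_mono sets.Un)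
    also have "\<dots> \<le> emeasure \<gamma> A + emeasure \<gamma> ((UNIV - S) - K)"
      by (rule emeasure_subadditive[OF Ds(2,1)])
    also have "\<dots> = ennreal (measure \<gamma> ((UNIV - S) - K))" unfolding As(2) by (simp add: emeasure_eq_measure)
    also have "\<dots> < ennreal \<eta>" using K(3) by (simp add: ennreal_less_iff)
    finally have "emeasure \<mu> W \<le> ennreal (measure \<mu> S / 2)" by (rule \<eta>(2)[OF W(1)])
    moreover have "emeasure \<mu> S \<le> emeasure \<mu> W" by (rule emeasure_mono) (use W(2) Wb in simp_all)
    ultimately have "ennreal (measure \<mu> S) \<le> ennreal (measure \<mu> S / 2)" by (simp add: M.emeasure_eq_measure)
    then show False using mS by (simp add: ennreal_le_iff2)
  qed
  then show "A \<in> null_sets \<mu>" using As by (auto simp: null_sets_def)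
qed

end


section \<open>The entropy bound\<close>

text \<open>\<open>G\<close> is Borel on \<open>X\<close> and depends on finitely many functionals,
  but no Borel function of their values is provided; composition with \<open>embed\<close> supplies
  a function of coordinates later.\<close>

definition cyl_fun :: "('a::locally_convex_space \<Rightarrow> real) set \<Rightarrow> ('a \<Rightarrow> real) \<Rightarrow> bool" where
  "cyl_fun L G \<longleftrightarrow> finite L \<and> L \<subseteq> top_dual \<and> G \<in> borel_measurable borel \<and>
     (\<forall>x y. (\<forall>l\<in>L. l x = l y) \<longrightarrow> G x = G y)"

lemma cyl_fun_add:
  assumes "cyl_fun L G" "cyl_fun L' G'" shows "cyl_fun (L \<union> L') (\<lambda>x. G x + G' x)"
proof -
  have "G x + G' x = G y + G' y" if "\<forall>l\<in>L \<union> L'. l x = l y" for x y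
  proof -
    have "G x = G y" "G' x = G' y" using assms that unfolding cyl_fun_def by blast+
    then show ?thesis by simp
  qed
  then show ?thesis using assms unfolding cyl_fun_def by auto
qed

context radon_gaussian begin

text \<open>Compact sets inside \<open>A\<close> and inside its complement are separated by a
  cylindrical open set, which then differs from \<open>A\<close> only on the two small remainders.
  This replaces the generation of Borel sets by functionals, which can fail in
  \<open>X\<close>.\<close>

lemma cyl_fun_approx_indicator:
  fixes \<epsilon> :: real
  assumes A: "A \<in> sets borel" and \<epsilon>: "0 < \<epsilon>"
  obtains L W where "cyl_fun L (indicator W)" "W \<in> sets borel" "(\<integral>x. \<bar>indicator A x - indicator W x\<bar> \<partial>\<gamma>) < \<epsilon>"
proof -
  note rad = radon_gamma[unfolded radon_prob_def, THEN conjunct2, THEN conjunct2, rule_format]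
  have Ac: "UNIV - A \<in> sets borel" using A by auto
  have e2: "0 < \<epsilon> / 2" using \<epsilon> by simp
  obtain S where S: "compact S" "S \<subseteq> A" "measure \<gamma> (A - S) < \<epsilon> / 2" using rad[OF A e2] by blast
  obtain K where K: "compact K" "K \<subseteq> UNIV - A" "measure \<gamma> ((UNIV - A) - K) < \<epsilon> / 2" using rad[OF Ac e2] by blast
  have b: "S \<in> sets borel" "K \<in> sets borel" using S(1) K(1) by (simp_all add: borel_closed compact_imp_closed)
  have "S \<inter> K = {}" using S(2) K(2) by blast
  then obtain W where W: "cyl_open W" "S \<subseteq> W" "W \<inter> K = {}" by (rule separate_compact_cyl[OF S(1) K(1)])
  then obtain L where L: "finite L" "L \<subseteq> top_dual" "determined L W" and Wo: "open W" by (auto simp: cyl_open_def)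
  have Wb: "W \<in> sets borel" using Wo by simp
  have cyl: "cyl_fun L (indicator W)"
    unfolding cyl_fun_def
  proof (intro conjI L allI impI)
    show "indicator W \<in> borel_measurable borel" using Wb by simp
    fix x y :: 'a assume "\<forall>l\<in>L. l x = l y"
    then have eq: "l x = l y" if "l \<in> L" for l using that by blast
    have "x \<in> W \<longleftrightarrow> y \<in> W" using determinedD[OF L(3), of x y] determinedD[OF L(3), of y x] eq by metis
    then show "(indicator W x :: real) = indicator W y" by (simp add: indicator_def)
  qed
  have ds: "A - S \<in> sets \<gamma>" "(UNIV - A) - K \<in> sets \<gamma>" using A Ac b by (simp_all add: sets.Diff)
  have As: "A \<in> sets \<gamma>" "W \<in> sets \<gamma>" using A Wb by simp_all
  have int: "integrable \<gamma> (indicator B :: 'a \<Rightarrow> real)" if "B \<in> sets \<gamma>" for B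
    using that by (intro integrable_real_indicator) (simp_all add: emeasure_eq_measure)
  have "(\<integral>x. \<bar>indicator A x - indicator W x\<bar> \<partial>\<gamma>) \<le> (\<integral>x. (indicator (A - S) x :: real) + indicator ((UNIV - A) - K) x \<partial>\<gamma>)"
  proof (rule integral_mono)
    show "integrable \<gamma> (\<lambda>x. \<bar>indicator A x - indicator W x\<bar> :: real)"
      by (intro integrable_abs Bochner_Integration.integrable_diff int As)
    show "integrable \<gamma> (\<lambda>x. indicator (A - S) x + indicator ((UNIV - A) - K) x :: real)"
      by (intro Bochner_Integration.integrable_add int ds)
    show "\<bar>indicator A x - indicator W x\<bar> \<le> (indicator (A - S) x + indicator ((UNIV - A) - K) x :: real)" for x
    proof -
      have "x \<in> W \<Longrightarrow> x \<notin> K" "x \<in> S \<Longrightarrow> x \<in> W" using W by auto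
      then show ?thesis by (cases "x \<in> A"; cases "x \<in> W") (auto simp: indicator_def)
    qed
  qed
  also have "\<dots> = measure \<gamma> (A - S) + measure \<gamma> ((UNIV - A) - K)"
    using ds by (subst Bochner_Integration.integral_add[OF int int]) simp_all
  also have "\<dots> < \<epsilon>" using S(3) K(3) by simp
  finally show ?thesis by (rule that[OF cyl Wb])
qed

lemma cyl_fun_approx:
  assumes f: "integrable \<gamma> (f :: 'a \<Rightarrow> real)" and \<epsilon>: "0 < \<epsilon>"
  shows "\<exists>L G. cyl_fun L G \<and> integrable \<gamma> G \<and> (\<integral>x. \<bar>f x - G x\<bar> \<partial>\<gamma>) < \<epsilon>"
  using f \<epsilon>
proof (induction arbitrary: \<epsilon> rule: integrable_induct)
  case (base A c)
  have A: "A \<in> sets borel" using base by simp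
  \<comment> \<open>The summand 1 covers \<open>c = 0\<close>.\<close>
  have "0 < \<epsilon> / (\<bar>c\<bar> + 1)" using base by (simp add: add_nonneg_pos)
  then obtain L W where W: "cyl_fun L (indicator W)" "W \<in> sets borel" "(\<integral>x. \<bar>indicator A x - indicator W x\<bar> \<partial>\<gamma>) < \<epsilon> / (\<bar>c\<bar> + 1)"
    by (rule cyl_fun_approx_indicator[OF A])
  have L: "finite L" "L \<subseteq> top_dual" "\<And>x y. (\<forall>l\<in>L. l x = l y) \<Longrightarrow> (indicator W x :: real) = indicator W y"
    using W(1) unfolding cyl_fun_def by blast+
  have "cyl_fun L (\<lambda>x. indicator W x *\<^sub>R c)"
    unfolding cyl_fun_def
  proof (intro conjI L allI impI)
    show "(\<lambda>x. indicator W x *\<^sub>R c) \<in> borel_measurable borel" using W(2) by simp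
    show "indicator W x *\<^sub>R c = indicator W y *\<^sub>R c" if "\<forall>l\<in>L. l x = l y" for x y using L(3)[OF that] by simp
  qed
  moreover have "integrable \<gamma> (\<lambda>x. indicator W x *\<^sub>R c)"
    using W(2) by (intro integrable_scaleR_left integrable_real_indicator) (simp_all add: emeasure_eq_measure)
  moreover have "(\<integral>x. \<bar>indicator A x *\<^sub>R c - indicator W x *\<^sub>R c\<bar> \<partial>\<gamma>) < \<epsilon>"
  proof -
    have "(\<integral>x. \<bar>indicator A x *\<^sub>R c - indicator W x *\<^sub>R c\<bar> \<partial>\<gamma>) = (\<integral>x. \<bar>c\<bar> * \<bar>indicator A x - indicator W x\<bar> \<partial>\<gamma>)"
      by (intro Bochner_Integration.integral_cong refl) (simp add: indicator_def)
    also have "\<dots> = \<bar>c\<bar> * (\<integral>x. \<bar>indicator A x - indicator W x\<bar> \<partial>\<gamma>)" by simp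
    also have "\<dots> \<le> \<bar>c\<bar> * (\<epsilon> / (\<bar>c\<bar> + 1))" using W(3) by (intro mult_left_mono) auto
    also have "\<dots> < (\<bar>c\<bar> + 1) * (\<epsilon> / (\<bar>c\<bar> + 1))" using \<open>0 < \<epsilon> / (\<bar>c\<bar> + 1)\<close> by (intro mult_strict_right_mono) auto
    also have "\<dots> = \<epsilon>" by (simp add: add_nonneg_pos less_imp_neq[symmetric])
    finally show ?thesis .
  qed
  ultimately show ?case by blast
next
  case (add f g)
  have e: "0 < \<epsilon> / 2" using add by simp
  obtain L G where G: "cyl_fun L G" "integrable \<gamma> G" "(\<integral>x. \<bar>f x - G x\<bar> \<partial>\<gamma>) < \<epsilon> / 2" using add.IH(1)[OF e] by blast
  obtain L' G' where G': "cyl_fun L' G'" "integrable \<gamma> G'" "(\<integral>x. \<bar>g x - G' x\<bar> \<partial>\<gamma>) < \<epsilon> / 2" using add.IH(2)[OF e] by blast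
  have "(\<integral>x. \<bar>f x + g x - (G x + G' x)\<bar> \<partial>\<gamma>) \<le> (\<integral>x. \<bar>f x - G x\<bar> + \<bar>g x - G' x\<bar> \<partial>\<gamma>)"
    by (rule integral_mono) (use add G G' in auto)
  also have "\<dots> = (\<integral>x. \<bar>f x - G x\<bar> \<partial>\<gamma>) + (\<integral>x. \<bar>g x - G' x\<bar> \<partial>\<gamma>)"
    by (rule Bochner_Integration.integral_add) (use add G G' in auto)
  also have "\<dots> < \<epsilon>" using G(3) G'(3) by simp
  finally show ?case using cyl_fun_add[OF G(1) G'(1)] Bochner_Integration.integrable_add[OF G(2) G'(2)] by blast
next
  case (lim f s)
  have e: "0 < \<epsilon> / 2" using lim by simp
  have "(\<lambda>i. \<integral>x. \<bar>f x - s i x\<bar> \<partial>\<gamma>) \<longlonglongrightarrow> (\<integral>x. 0 \<partial>\<gamma>)"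
  \<comment> \<open>The simple functions satisfy \<open>|s i| \<le> 2 |f|\<close>, hence the
    dominating function \<open>3 |f|\<close>.\<close>
  proof (rule integral_dominated_convergence[where w = "\<lambda>x. 3 * \<bar>f x\<bar>"])
    show "(\<lambda>x. \<bar>f x - s i x\<bar>) \<in> borel_measurable \<gamma>" for i
      by (intro borel_measurable_abs borel_measurable_diff borel_measurable_integrable lim)
    show "integrable \<gamma> (\<lambda>x. 3 * \<bar>f x\<bar>)" using lim by simp
    show "AE x in \<gamma>. (\<lambda>i. \<bar>f x - s i x\<bar>) \<longlonglongrightarrow> 0"
    proof (rule AE_I2)
      fix x assume "x \<in> space \<gamma>"
      then have "(\<lambda>i. \<bar>f x - s i x\<bar>) \<longlonglongrightarrow> \<bar>f x - f x\<bar>" using lim by (intro tendsto_intros) auto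
      then show "(\<lambda>i. \<bar>f x - s i x\<bar>) \<longlonglongrightarrow> 0" by simp
    qed
    show "AE x in \<gamma>. norm \<bar>f x - s i x\<bar> \<le> 3 * \<bar>f x\<bar>" for i
    proof (rule AE_I2)
      fix x assume "x \<in> space \<gamma>"
      then have "\<bar>s i x\<bar> \<le> 2 * \<bar>f x\<bar>" using lim by (metis real_norm_def)
      then show "norm \<bar>f x - s i x\<bar> \<le> 3 * \<bar>f x\<bar>" by simp
    qed
  qed simp
  then have "\<forall>\<^sub>F i in sequentially. (\<integral>x. \<bar>f x - s i x\<bar> \<partial>\<gamma>) < \<epsilon> / 2"
    using e by (intro order_tendstoD) auto
  then obtain i where i: "(\<integral>x. \<bar>f x - s i x\<bar> \<partial>\<gamma>) < \<epsilon> / 2" by (auto simp: eventually_sequentially)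
  obtain L G where G: "cyl_fun L G" "integrable \<gamma> G" "(\<integral>x. \<bar>s i x - G x\<bar> \<partial>\<gamma>) < \<epsilon> / 2" using lim.IH[OF e] by blast
  have si: "integrable \<gamma> (s i)" using lim by blast
  have "(\<integral>x. \<bar>f x - G x\<bar> \<partial>\<gamma>) \<le> (\<integral>x. \<bar>f x - s i x\<bar> + \<bar>s i x - G x\<bar> \<partial>\<gamma>)"
    by (rule integral_mono) (use lim.hyps si G in auto)
  also have "\<dots> = (\<integral>x. \<bar>f x - s i x\<bar> \<partial>\<gamma>) + (\<integral>x. \<bar>s i x - G x\<bar> \<partial>\<gamma>)"
    by (rule Bochner_Integration.integral_add) (use lim.hyps si G in auto)
  also have "\<dots> < \<epsilon>" using i G(3) by simp
  finally show ?case using G(1,2) by blast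
qed

end

section \<open>Projections of the stationary measure\<close>

context ou_stationary begin

text \<open>Absolute continuity passes to the projected law without noise, so the drift norm is not
  enlarged and the constant is already the one of the theorem.\<close>

lemma projected_density:
  assumes FD: "FD_estimate \<alpha> C" and ac: "absolutely_continuous \<gamma> \<mu>" and o: "orthon d k"
  obtains g where "g \<in> borel_measurable (PiM {..<d} (\<lambda>_. borel))" "\<And>z. 0 \<le> g z"
    "distr \<mu> (PiM {..<d} (\<lambda>_. borel)) (tuple_map d k) = density (std_gauss d) (\<lambda>z. ennreal (g z))"
    "(\<integral>\<^sup>+z. ennreal (g z * ln (g z + 1) powr \<alpha>) \<partial>std_gauss d) \<le> ennreal (C * (1 + drift_norm * ln (1 + drift_norm) powr \<alpha>))"
proof -
  let ?P = "PiM {..<d} (\<lambda>_. borel :: real measure)" and ?T = "tuple_map d k"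
  interpret G: prob_space "std_gauss d" by (rule prob_space_std_gauss)
  have Pm: "?T \<in> measurable \<mu> ?P" by (rule tuple_map_mu) (rule orthon_top_dual[OF o])
  have Pg: "?T \<in> measurable \<gamma> ?P"
    by (rule tuple_map_measurable) (rule top_dual_measurable[OF orthon_top_dual[OF o]])
  interpret D: prob_space "distr \<mu> ?P ?T" by (rule M.prob_space_distr[OF Pm])
  have acd: "absolutely_continuous (std_gauss d) (distr \<mu> ?P ?T)"
    unfolding absolutely_continuous_def
  proof
    fix A assume A: "A \<in> null_sets (std_gauss d)"
    then have As: "A \<in> sets ?P" by auto
    have "emeasure \<gamma> (?T -` A \<inter> space \<gamma>) = 0"
      using A As Pg unfolding orthon_law[OF o, symmetric] by (simp add: null_sets_def emeasure_distr)
    then have "?T -` A \<inter> space \<gamma> \<in> null_sets \<gamma>" using measurable_sets[OF Pg As] by (simp only: null_sets_def mem_Collect_eq conj_absorb simp_thms)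
    then have "?T -` A \<inter> space \<gamma> \<in> null_sets \<mu>" using ac unfolding absolutely_continuous_def by blast
    then show "A \<in> null_sets (distr \<mu> ?P ?T)" using As Pm by (simp add: null_sets_def emeasure_distr)
  qed
  obtain g where g: "g \<in> borel_measurable ?P" "\<And>z. 0 \<le> g z"
    and law: "distr \<mu> ?P ?T = density (std_gauss d) (\<lambda>z. ennreal (g z))"
    by (rule std_gauss_real_density[OF D.prob_space_axioms _ acd]) (simp, blast)
  have bound: "(\<integral>\<^sup>+z. ennreal (g z * ln (g z + 1) powr \<alpha>) \<partial>std_gauss d) \<le> ennreal (C * (1 + drift_norm * ln (1 + drift_norm) powr \<alpha>))"
  proof (cases "d = 0")
    \<comment> \<open>Dimension 0 lies outside \<open>FD_estimate\<close>: the density is 1 at the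
      only point, and the bound follows from \<open>ln 2 powr \<alpha> \<le> C\<close>.\<close>
    case True
    let ?u = "\<lambda>_. undefined :: real"
    have sp: "space (std_gauss d) = {?u}" using True by (simp add: PiE_empty_domain)
    have const: "(\<integral>\<^sup>+z. F z \<partial>std_gauss d) = F ?u" for F :: "_ \<Rightarrow> ennreal"
    proof -
      have "(\<integral>\<^sup>+z. F z \<partial>std_gauss d) = (\<integral>\<^sup>+z. F ?u \<partial>std_gauss d)" by (rule nn_integral_cong) (simp only: sp singleton_iff)
      then show ?thesis using G.emeasure_space_1 by simp
    qed
    have "1 = emeasure (density (std_gauss d) (\<lambda>z. ennreal (g z))) (space (std_gauss d))"
      using D.emeasure_space_1 unfolding law by simp
    also have "\<dots> = (\<integral>\<^sup>+z. ennreal (g z) * indicator (space (std_gauss d)) z \<partial>std_gauss d)"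
      by (rule emeasure_density[OF _ sets.top]) (use g(1) in \<open>simp add: measurable_cong_sets[OF sets_std_gauss refl]\<close>)
    also have "\<dots> = ennreal (g ?u)" unfolding const by (simp add: sp del: space_std_gauss)
    finally have g1: "g ?u = 1" using g(2)[of ?u] by simp
    have "ln 2 powr \<alpha> \<le> C * 1" using FD_estimate_ge[OF FD] by simp
    also have "\<dots> \<le> C * (1 + drift_norm * ln (1 + drift_norm) powr \<alpha>)"
    proof (rule mult_left_mono)
      show "0 \<le> C" using FD_estimate_ge[OF FD] by (rule order_trans[rotated]) simp
      show "1 \<le> 1 + drift_norm * ln (1 + drift_norm) powr \<alpha>" using drift_norm_nonneg by simp
    qed
    finally show ?thesis unfolding const by (simp add: g1 ennreal_leI)
  next
    case False
    then have d: "1 \<le> d" by simp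
    have Vm: "(\<lambda>x. k i (v x)) \<in> borel_measurable \<mu>" if "i < d" for i
      by (rule top_dual_v_measurable[OF orthon_top_dual[OF o that]])
    have VB: "L2_set (\<lambda>i. k i (v x)) {..<d} \<le> cm_norm \<gamma> (v x)" for x by (rule L2_set_orthon_le[OF o v_cm])
    have Lint: "integrable \<mu> (\<lambda>x. L2_set (\<lambda>i. k i (v x)) {..<d})"
    proof (rule Bochner_Integration.integrable_bound[OF v_integrable])
      have [measurable]: "(\<lambda>x. \<Sum>i<d. (k i (v x))\<^sup>2) \<in> borel_measurable \<mu>"
        by (intro borel_measurable_sum borel_measurable_power Vm) simp
      show "(\<lambda>x. L2_set (\<lambda>i. k i (v x)) {..<d}) \<in> borel_measurable \<mu>" unfolding L2_set_def by measurable
      show "AE x in \<mu>. norm (L2_set (\<lambda>i. k i (v x)) {..<d}) \<le> norm (cm_norm \<gamma> (v x))"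
        using VB cm_norm_nonneg[OF v_cm] by (intro AE_I2) (simp add: L2_set_nonneg)
    qed
    have eq: "(\<integral>x. (\<Sum>i<d. pderiv_at i (pderiv_at i \<phi>) (?T x)) + (\<Sum>i<d. (- ?T x i + k i (v x)) * pderiv_at i \<phi> (?T x)) \<partial>\<mu>) = 0"
      if \<phi>: "test_fun_Rn d \<phi>" for \<phi>
    proof -
      have "(\<Sum>i<d. (- ?T x i + k i (v x)) * pderiv_at i \<phi> (?T x)) = (\<Sum>i<d. (- k i x + k i (v x)) * pderiv_at i \<phi> (?T x))" for x
        by (intro sum.cong refl) (simp add: tuple_map_def)
      then show ?thesis using stationary_orthon[OF o \<phi>] by (simp only:)
    qed
    show ?thesis
      by (rule FD_estimate_random_vector[OF FD d M.prob_space_axioms Pm Vm Lint integral_mono[OF Lint v_integrable VB] g law eq])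
  qed
  show ?thesis by (rule that[OF g law bound])
qed

text \<open>Projecting contracts the \<open>L\<^sup>1\<close> distance to a cylindrical function, because \<open>g \<circ> P\<close> is the
  conditional expectation of the density \<open>f\<close> given \<open>P\<close>.\<close>

lemma entropy_bound_approx:
  assumes FD: "FD_estimate \<alpha> C" and ac: "absolutely_continuous \<gamma> \<mu>"
    and f: "f \<in> borel_measurable borel" "\<And>x. 0 \<le> f x" "density \<gamma> (\<lambda>x. ennreal (f x)) = \<mu>" "integrable \<gamma> f"
    and \<epsilon>: "0 < \<epsilon>"
  obtains h where "integrable \<gamma> h" "\<And>x. 0 \<le> h x" "(\<integral>x. \<bar>h x - f x\<bar> \<partial>\<gamma>) < \<epsilon>"
    "(\<integral>\<^sup>+x. ennreal (h x * ln (h x + 1) powr \<alpha>) \<partial>\<gamma>) \<le> ennreal (C * (1 + drift_norm * ln (1 + drift_norm) powr \<alpha>))"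
proof -
  have e2: "0 < \<epsilon> / 2" using \<epsilon> by simp
  obtain L G where G: "cyl_fun L G" "integrable \<gamma> G" "(\<integral>x. \<bar>f x - G x\<bar> \<partial>\<gamma>) < \<epsilon> / 2"
    using cyl_fun_approx[OF f(4) e2] by blast
  have L: "finite L" "L \<subseteq> top_dual" and Gm: "G \<in> borel_measurable borel"
    and Gd: "\<And>x y. (\<forall>l\<in>L. l x = l y) \<Longrightarrow> G x = G y" using G(1) unfolding cyl_fun_def by blast+
  have o0: "orthon 0 (\<lambda>_ _. 0)" by (simp add: orthon_def)
  obtain d k where o: "orthon d k" and res: "\<And>l. l \<in> L \<Longrightarrow> ip (residual d k l) (residual d k l) = 0"
    using gram_schmidt[OF L o0] by blast
  let ?P = "PiM {..<d} (\<lambda>_. borel :: real measure)" and ?T = "tuple_map d k"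
  have Pm: "?T \<in> measurable \<mu> ?P" by (rule tuple_map_mu) (rule orthon_top_dual[OF o])
  have Pg: "?T \<in> measurable \<gamma> ?P"
    by (rule tuple_map_measurable) (rule top_dual_measurable[OF orthon_top_dual[OF o]])
  obtain g where g: "g \<in> borel_measurable ?P" "\<And>z. 0 \<le> g z"
    "distr \<mu> ?P ?T = density (std_gauss d) (\<lambda>z. ennreal (g z))"
    "(\<integral>\<^sup>+z. ennreal (g z * ln (g z + 1) powr \<alpha>) \<partial>std_gauss d) \<le> ennreal (C * (1 + drift_norm * ln (1 + drift_norm) powr \<alpha>))"
    by (rule projected_density[OF FD ac o]) blast
  have gs: "g \<in> borel_measurable (std_gauss d)" using g(1) by (simp only: measurable_cong_sets[OF sets_std_gauss refl])
  define h where "h x = g (?T x)" for x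
  have hm: "h \<in> borel_measurable \<gamma>" unfolding h_def by (rule measurable_compose[OF Pg g(1)])
  have nn_h: "(\<integral>\<^sup>+x. F (h x) \<partial>\<gamma>) = (\<integral>\<^sup>+z. F (g z) \<partial>std_gauss d)" if "F \<in> borel_measurable borel" for F
    unfolding orthon_law[OF o, symmetric] h_def
    by (rule nn_integral_distr[OF Pg, symmetric]) (use measurable_compose[OF g(1) that] in simp)
  interpret D: prob_space "distr \<mu> ?P ?T" by (rule M.prob_space_distr[OF Pm])
  have hint: "integrable \<gamma> h"
  proof (rule integrableI_nonneg[OF hm])
    have "(\<integral>\<^sup>+x. ennreal (h x) \<partial>\<gamma>) = (\<integral>\<^sup>+z. ennreal (g z) \<partial>std_gauss d)" by (rule nn_h) simp
    also have "\<dots> = (\<integral>\<^sup>+z. ennreal (g z) * indicator (space (std_gauss d)) z \<partial>std_gauss d)"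
      by (rule nn_integral_cong) simp
    also have "\<dots> = emeasure (density (std_gauss d) (\<lambda>z. ennreal (g z))) (space (std_gauss d))"
      by (rule emeasure_density[OF _ sets.top, symmetric]) (use gs in simp)
    also have "\<dots> = 1" using D.emeasure_space_1 unfolding g(3) by simp
    finally show "(\<integral>\<^sup>+x. ennreal (h x) \<partial>\<gamma>) < \<infinity>" by simp
  qed (simp add: h_def g(2))
  \<comment> \<open>The sign of \<open>g - G\<close> in coordinates, so that after composing with
    the projection its product with \<open>h - G\<close> is \<open>|h - G|\<close> almost
    everywhere.\<close>
  define \<psi> where "\<psi> z = sgn (g z - G (embed d k z))" for z
  have em: "embed d k \<in> borel_measurable ?P" by (rule continuous_on_tuple_borel[OF continuous_embed])
  have \<psi>m: "\<psi> \<in> borel_measurable ?P"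
    unfolding \<psi>_def using g(1) measurable_compose[OF em Gm] by measurable
  have \<psi>b: "\<bar>\<psi> z\<bar> \<le> 1" for z by (simp add: \<psi>_def sgn_real_def)
  have \<psi>T: "(\<lambda>x. \<psi> (?T x)) \<in> borel_measurable \<gamma>" by (rule measurable_compose[OF Pg \<psi>m])
  have ib: "integrable \<gamma> (\<lambda>x. \<psi> (?T x) * q x)" if q: "integrable \<gamma> q" for q
  proof (rule Bochner_Integration.integrable_bound[OF q])
    show "(\<lambda>x. \<psi> (?T x) * q x) \<in> borel_measurable \<gamma>" using \<psi>T borel_measurable_integrable[OF q] by (rule borel_measurable_times)
    show "AE x in \<gamma>. norm (\<psi> (?T x) * q x) \<le> norm (q x)"
    proof (rule AE_I2)
      fix x show "norm (\<psi> (?T x) * q x) \<le> norm (q x)"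
        using mult_right_mono[OF \<psi>b, of "\<bar>q x\<bar>"] by (simp add: abs_mult)
    qed
  qed
  have fg: "f \<in> borel_measurable \<gamma>" using f(1) by (simp only: measurable_cong_sets[OF sets_gamma refl])
  \<comment> \<open>Both sides equal the integral of \<open>\<psi>\<close> of the projection against
    \<open>\<mu>\<close>; this is the conditional expectation property of \<open>h\<close>.\<close>
  have exch: "(\<integral>x. \<psi> (?T x) * h x \<partial>\<gamma>) = (\<integral>x. \<psi> (?T x) * f x \<partial>\<gamma>)"
  proof -
    have "(\<integral>x. \<psi> (?T x) * h x \<partial>\<gamma>) = (\<integral>z. g z *\<^sub>R \<psi> z \<partial>std_gauss d)"
      unfolding orthon_law[OF o, symmetric] h_def
      by (subst integral_distr[OF Pg]) (use g(1) \<psi>m in \<open>simp_all add: mult.commute\<close>)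
    also have "\<dots> = (\<integral>z. \<psi> z \<partial>distr \<mu> ?P ?T)"
      unfolding g(3) by (rule integral_density[symmetric]) (use \<psi>m gs g(2) in \<open>simp_all add: measurable_cong_sets[OF sets_std_gauss refl]\<close>)
    also have "\<dots> = (\<integral>x. \<psi> (?T x) \<partial>\<mu>)" by (rule integral_distr[OF Pm \<psi>m])
    also have "\<dots> = (\<integral>x. \<psi> (?T x) \<partial>density \<gamma> (\<lambda>x. ennreal (f x)))" by (simp only: f(3))
    also have "\<dots> = (\<integral>x. f x *\<^sub>R \<psi> (?T x) \<partial>\<gamma>)" by (rule integral_density) (use \<psi>T fg f(2) in simp_all)
    finally show ?thesis by (simp add: mult.commute)
  qed
  have GT: "AE x in \<gamma>. G (embed d k (?T x)) = G x"
  proof -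
    have "AE x in \<gamma>. \<forall>l\<in>L. residual d k l x = 0"
    proof (rule AE_finite_allI[OF L(1)])
      fix l assume l: "l \<in> L"
      show "AE x in \<gamma>. residual d k l x = 0"
        by (rule ip_eq_0_AE[OF residual_top_dual[OF o subsetD[OF L(2) l]] res[OF l]])
    qed
    then show ?thesis
    proof eventually_elim
      case (elim x)
      have "\<forall>l\<in>L. l (embed d k (?T x)) = l x" using embed_tuple_map[OF o] L(2) elim by blast
      then show ?case by (rule Gd)
    qed
  qed
  have "(\<integral>x. \<bar>h x - G x\<bar> \<partial>\<gamma>) = (\<integral>x. \<psi> (?T x) * h x - \<psi> (?T x) * G x \<partial>\<gamma>)"
  proof (rule integral_cong_AE)
    show "(\<lambda>x. \<bar>h x - G x\<bar>) \<in> borel_measurable \<gamma>" using hint G(2) by (intro borel_measurable_integrable integrable_abs Bochner_Integration.integrable_diff)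
    show "(\<lambda>x. \<psi> (?T x) * h x - \<psi> (?T x) * G x) \<in> borel_measurable \<gamma>"
      by (intro borel_measurable_integrable Bochner_Integration.integrable_diff ib hint G(2))
    show "AE x in \<gamma>. \<bar>h x - G x\<bar> = \<psi> (?T x) * h x - \<psi> (?T x) * G x"
      using GT
    proof eventually_elim
      case (elim x)
      have eq: "\<psi> (?T x) = sgn (h x - G x)" by (simp only: \<psi>_def h_def elim)
      have "\<psi> (?T x) * h x - \<psi> (?T x) * G x = (h x - G x) * \<psi> (?T x)"
        by (simp only: left_diff_distrib mult.commute)
      also have "\<dots> = \<bar>h x - G x\<bar>" unfolding eq by (rule abs_sgn[symmetric])
      finally show ?case by (rule sym)
    qed
  qed
  also have "\<dots> = (\<integral>x. \<psi> (?T x) * h x \<partial>\<gamma>) - (\<integral>x. \<psi> (?T x) * G x \<partial>\<gamma>)"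
    by (rule Bochner_Integration.integral_diff[OF ib[OF hint] ib[OF G(2)]])
  also have "\<dots> = (\<integral>x. \<psi> (?T x) * f x \<partial>\<gamma>) - (\<integral>x. \<psi> (?T x) * G x \<partial>\<gamma>)" by (simp only: exch)
  also have "\<dots> = (\<integral>x. \<psi> (?T x) * f x - \<psi> (?T x) * G x \<partial>\<gamma>)"
    by (rule Bochner_Integration.integral_diff[OF ib[OF f(4)] ib[OF G(2)], symmetric])
  also have "\<dots> \<le> (\<integral>x. \<bar>f x - G x\<bar> \<partial>\<gamma>)"
  proof (rule integral_mono)
    show "integrable \<gamma> (\<lambda>x. \<psi> (?T x) * f x - \<psi> (?T x) * G x)" by (intro Bochner_Integration.integrable_diff ib f(4) G(2))
    show "integrable \<gamma> (\<lambda>x. \<bar>f x - G x\<bar>)" by (intro integrable_abs Bochner_Integration.integrable_diff f(4) G(2))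
    fix x
    have "\<psi> (?T x) * (f x - G x) \<le> \<bar>\<psi> (?T x)\<bar> * \<bar>f x - G x\<bar>"
      using abs_ge_self[of "\<psi> (?T x) * (f x - G x)"] by (simp only: abs_mult)
    also have "\<dots> \<le> 1 * \<bar>f x - G x\<bar>" by (rule mult_right_mono[OF \<psi>b]) simp
    finally show "\<psi> (?T x) * f x - \<psi> (?T x) * G x \<le> \<bar>f x - G x\<bar>" by (simp add: right_diff_distrib)
  qed
  finally have hG: "(\<integral>x. \<bar>h x - G x\<bar> \<partial>\<gamma>) < \<epsilon> / 2" using G(3) by simp
  have "(\<integral>x. \<bar>h x - f x\<bar> \<partial>\<gamma>) \<le> (\<integral>x. \<bar>h x - G x\<bar> + \<bar>f x - G x\<bar> \<partial>\<gamma>)"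
  proof (rule integral_mono)
    show "integrable \<gamma> (\<lambda>x. \<bar>h x - f x\<bar>)" by (intro integrable_abs Bochner_Integration.integrable_diff f(4) hint)
    show "integrable \<gamma> (\<lambda>x. \<bar>h x - G x\<bar> + \<bar>f x - G x\<bar>)"
      by (intro Bochner_Integration.integrable_add integrable_abs Bochner_Integration.integrable_diff f(4) hint G(2))
  qed linarith
  also have "\<dots> = (\<integral>x. \<bar>h x - G x\<bar> \<partial>\<gamma>) + (\<integral>x. \<bar>f x - G x\<bar> \<partial>\<gamma>)"
    by (intro Bochner_Integration.integral_add integrable_abs Bochner_Integration.integrable_diff f(4) hint G(2))
  also have "\<dots> < \<epsilon>" using hG G(3) by simp
  finally have close: "(\<integral>x. \<bar>h x - f x\<bar> \<partial>\<gamma>) < \<epsilon>" .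
  have "(\<integral>\<^sup>+x. ennreal (h x * ln (h x + 1) powr \<alpha>) \<partial>\<gamma>) = (\<integral>\<^sup>+z. ennreal (g z * ln (g z + 1) powr \<alpha>) \<partial>std_gauss d)"
    by (rule nn_h[of "\<lambda>t. ennreal (t * ln (t + 1) powr \<alpha>)"]) measurable
  with g(4) have ent: "(\<integral>\<^sup>+x. ennreal (h x * ln (h x + 1) powr \<alpha>) \<partial>\<gamma>) \<le> ennreal (C * (1 + drift_norm * ln (1 + drift_norm) powr \<alpha>))"
    by (simp only:)
  have "0 \<le> h x" for x unfolding h_def by (rule g(2))
  then show ?thesis by (rule that[OF hint _ close ent])
qed

text \<open>\<open>L\<^sup>1\<close> convergence gives almost everywhere convergence along a
  subsequence, and Fatou's lemma applies to the entropy integrand. The approximants may come from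
  unrelated projections, since each is chosen by its distance to \<open>f\<close> alone.\<close>

lemma entropy_bound:
  assumes FD: "FD_estimate \<alpha> C" and ac: "absolutely_continuous \<gamma> \<mu>"
    and f: "f \<in> borel_measurable borel" "\<And>x. 0 \<le> f x" "density \<gamma> (\<lambda>x. ennreal (f x)) = \<mu>" "integrable \<gamma> f"
  shows "(\<integral>\<^sup>+x. ennreal (f x * ln (f x + 1) powr \<alpha>) \<partial>\<gamma>) \<le> ennreal (C * (1 + drift_norm * ln (1 + drift_norm) powr \<alpha>))"
    (is "_ \<le> ?K")
proof -
  define Q where "Q n h \<longleftrightarrow> integrable \<gamma> h \<and> (\<forall>x. 0 \<le> h x) \<and> (\<integral>x. \<bar>h x - f x\<bar> \<partial>\<gamma>) < inverse (real (Suc n)) \<and>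
      (\<integral>\<^sup>+x. ennreal (h x * ln (h x + 1) powr \<alpha>) \<partial>\<gamma>) \<le> ?K" for n h
  have "\<exists>h. Q n h" for n
  proof -
    have "0 < inverse (real (Suc n))" by simp
    then show ?thesis by (rule entropy_bound_approx[OF FD ac f]) (unfold Q_def, blast)
  qed
  then obtain h where Q: "\<And>n. Q n (h n)" by metis
  have h: "\<And>n. integrable \<gamma> (h n)" "\<And>n x. 0 \<le> h n x" "\<And>n. (\<integral>x. \<bar>h n x - f x\<bar> \<partial>\<gamma>) < inverse (real (Suc n))"
      "\<And>n. (\<integral>\<^sup>+x. ennreal (h n x * ln (h n x + 1) powr \<alpha>) \<partial>\<gamma>) \<le> ?K"
    using Q unfolding Q_def by blast+
  have "(\<lambda>n. \<integral>x. norm (h n x - f x) \<partial>\<gamma>) \<longlonglongrightarrow> 0"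
  proof (rule tendsto_sandwich[OF _ _ tendsto_const LIMSEQ_inverse_real_of_nat])
    show "\<forall>\<^sub>F n in sequentially. 0 \<le> (\<integral>x. norm (h n x - f x) \<partial>\<gamma>)" by simp
    show "\<forall>\<^sub>F n in sequentially. (\<integral>x. norm (h n x - f x) \<partial>\<gamma>) \<le> inverse (real (Suc n))"
      using less_imp_le[OF h(3)] by (intro always_eventually allI) (simp only: real_norm_def)
  qed
  from tendsto_L1_AE_subseq[OF Bochner_Integration.integrable_diff[OF h(1) f(4)] this]
  obtain r where r: "strict_mono (r :: nat \<Rightarrow> nat)" "AE x in \<gamma>. (\<lambda>n. h (r n) x - f x) \<longlonglongrightarrow> 0"
    by blast
  let ?\<Theta> = "\<lambda>t::real. ennreal (t * ln (t + 1) powr \<alpha>)"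
  have "(\<integral>\<^sup>+x. ?\<Theta> (f x) \<partial>\<gamma>) \<le> (\<integral>\<^sup>+x. liminf (\<lambda>n. ?\<Theta> (h (r n) x)) \<partial>\<gamma>)"
  proof (rule nn_integral_mono_AE)
    show "AE x in \<gamma>. ?\<Theta> (f x) \<le> liminf (\<lambda>n. ?\<Theta> (h (r n) x))"
      using r(2)
    proof eventually_elim
      case (elim x)
      show ?case
      proof (cases "f x = 0")
        case False
        then have pos: "0 < f x" using f(2)[of x] by simp
        have lim: "(\<lambda>n. h (r n) x) \<longlonglongrightarrow> f x" using elim by (simp add: LIM_zero_iff)
        have "(\<lambda>n. h (r n) x * ln (h (r n) x + 1) powr \<alpha>) \<longlonglongrightarrow> f x * ln (f x + 1) powr \<alpha>"
          using pos by (intro tendsto_mult lim tendsto_powr tendsto_ln tendsto_add tendsto_const) auto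
        then have "(\<lambda>n. ?\<Theta> (h (r n) x)) \<longlonglongrightarrow> ?\<Theta> (f x)" by (rule tendsto_ennrealI)
        then have "liminf (\<lambda>n. ?\<Theta> (h (r n) x)) = ?\<Theta> (f x)" by (rule lim_imp_Liminf[OF sequentially_bot])
        then show ?thesis by simp
      qed simp
    qed
  qed
  also have "\<dots> \<le> liminf (\<lambda>n. \<integral>\<^sup>+x. ?\<Theta> (h (r n) x) \<partial>\<gamma>)"
  proof (rule nn_integral_liminf)
    have "?\<Theta> \<in> borel_measurable borel" by measurable
    then show "(\<lambda>x. ?\<Theta> (h (r n) x)) \<in> borel_measurable \<gamma>" for n
      by (rule measurable_compose[OF borel_measurable_integrable[OF h(1)]])
  qed
  also have "\<dots> \<le> ?K"
    by (rule Liminf_le[OF sequentially_bot always_eventually]) (rule allI, rule h(4))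
  finally show ?thesis .
qed

end

theorem theorem3p1:
  fixes \<gamma> \<mu> :: "'a::locally_convex_space measure"
    and v :: "'a \<Rightarrow> 'a"
    and I :: "nat set" and e :: "nat \<Rightarrow> 'a" and ehat :: "nat \<Rightarrow> 'a \<Rightarrow> real"
    and \<alpha> C :: real
  assumes gamma: "centered_radon_gaussian \<gamma>"
    and basis: "cm_orthonormal_basis \<gamma> I e"
    and ehat: "\<forall>i\<in>I. ehat i \<in> top_dual \<and> (\<forall>j\<in>I. ehat i (e j) = (if i = j then 1 else 0))"
    and v: "v \<in> measurable borel (cm_borel \<gamma>)"
    and mu: "radon_prob \<mu>"
    and v_int: "integrable \<mu> (\<lambda>x. cm_norm \<gamma> (v x))"
    and stationary: "Lb_stationary \<gamma> I e v \<mu>"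
    and alpha: "\<alpha> < 1/4"
    and FD: "FD_estimate \<alpha> C"
    and FD_exists: "\<alpha> \<le> 0 \<Longrightarrow> \<exists>\<beta> C'. 0 < \<beta> \<and> \<beta> < 1/4 \<and> FD_estimate \<beta> C'"
  shows "absolutely_continuous \<gamma> \<mu> \<and>
    (let f = (\<lambda>x. enn2real (RN_deriv \<gamma> \<mu> x)); N = (\<integral>x. cm_norm \<gamma> (v x) \<partial>\<mu>) in
      (\<integral>\<^sup>+x. ennreal (f x * ln (f x + 1) powr \<alpha>) \<partial>\<gamma>)
        \<le> ennreal (C * (1 + N * ln (1 + N) powr \<alpha>)))"
proof -
  interpret ou_stationary \<gamma> \<mu> v I e
    by (intro ou_stationary.intro radon_gaussian.intro ou_stationary_axioms.intro gamma basis v mu v_int stationary)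
  \<comment> \<open>Absolute continuity is obtained with any positive exponent;
    \<open>\<alpha>\<close> itself serves if positive, otherwise the one supplied by
    \<open>FD_exists\<close>.\<close>
  have "\<exists>\<beta> C'. 0 < \<beta> \<and> FD_estimate \<beta> C'"
  proof (cases "\<alpha> \<le> 0")
    case True
    then show ?thesis using FD_exists by blast
  next
    case False
    then show ?thesis using FD by (intro exI[of _ \<alpha>] exI[of _ C]) simp
  qed
  then obtain \<beta> C' where \<beta>: "0 < \<beta>" "FD_estimate \<beta> C'" by blast
  have ac: "absolutely_continuous \<gamma> \<mu>" by (rule absolutely_continuous_mu[OF \<beta>(2,1)])
  let ?r = "RN_deriv \<gamma> \<mu>"
  have s: "sets \<mu> = sets \<gamma>" by simp
  have dens: "density \<gamma> ?r = \<mu>" by (rule density_RN_deriv[OF ac s])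
  have r: "?r \<in> borel_measurable \<gamma>" by (rule borel_measurable_RN_deriv)
  have "AE x in \<gamma>. ?r x \<noteq> \<infinity>" by (rule RN_deriv_finite[OF M.sigma_finite_measure_axioms ac s])
  \<comment> \<open>The derivative is almost everywhere finite, so its real version is still a
    density of \<open>\<mu>\<close>.\<close>
  then have ae: "AE x in \<gamma>. ?r x = ennreal (enn2real (?r x))" by eventually_elim (simp add: less_top)
  define f where "f x = enn2real (?r x)" for x
  have fg: "f \<in> borel_measurable \<gamma>" unfolding f_def[abs_def] by (rule borel_measurable_enn2real[OF r])
  then have f: "f \<in> borel_measurable borel" by (simp only: measurable_cong_sets[OF sets_gamma refl])
  have f_nn: "0 \<le> f x" for x by (simp add: f_def)
  have fd: "density \<gamma> (\<lambda>x. ennreal (f x)) = \<mu>"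
  proof -
    have "(\<lambda>x. ennreal (enn2real (?r x))) \<in> borel_measurable \<gamma>" using fg unfolding f_def by measurable
    from density_cong[OF r this ae] show ?thesis by (simp only: dens f_def)
  qed
  have f_int: "integrable \<gamma> f"
  proof (rule integrableI_nonneg[OF fg])
    have "(\<integral>\<^sup>+x. ennreal (f x) \<partial>\<gamma>) = emeasure (density \<gamma> (\<lambda>x. ennreal (f x))) UNIV"
      using fg by (simp add: emeasure_density)
    also have "\<dots> = 1" unfolding fd using M.emeasure_space_1 by simp
    finally show "(\<integral>\<^sup>+x. ennreal (f x) \<partial>\<gamma>) < \<infinity>" by simp
  qed (simp add: f_nn)
  show ?thesis
    using ac entropy_bound[OF FD ac f f_nn fd f_int] unfolding Let_def f_def by (rule conjI)
qed

end
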